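(* Let $k\ge2$, $m\ge0$, $n\ge2$, let $a_1,\dots,a_m$ be integers with $a_s>1$ for all $s$, and let $l_1,\dots,l_n$ be integers with $l_j>1$ for all $j$. Let $X\subset\mathbb{A}^{k+m+n}$ be the hypersurface over $\mathbb{K}$ given by $$x_1\cdots x_k\,y_1^{a_1}\cdots y_m^{a_m}=z_1^{l_1}\cdots z_n^{l_n}+1,$$ and let $B=\mathbb{K}[X]$. Let $h$ be a nonzero homogeneous polynomial in the variables $x_2,\dots,x_k,y_1,\dots,y_m,z_2,\dots,z_n$ (so $h$ does not contain $x_1,z_1$) that contains all $z_s$, $s\ne1$, and let $\delta$ be the LND of $B$ defined by $$\delta(x_1)=h\,l_1z_1^{l_1-1}z_2^{l_2}\cdots z_n^{l_n},\qquad \delta(z_1)=h\,y_1^{a_1}\cdots y_m^{a_m}x_2\cdots x_k,$$ $$\delta(x_r)=\delta(y_s)=\delta(z_p)=0\quad\text{for } r\ne1,\ 1\le s\le m,\ p\ne1.$$ Then $$\mathrm{Aut}(B)_\delta=(S_\delta\ltimes\mathbb{H}_\delta)\ltimes\mathcal{U}(\delta).$$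
   Context: $\mathbb{K}$ is an algebraically closed field of characteristic zero. A derivation of $B$ is locally nilpotent (LND) if each element of $B$ is killed by some power of it. Two LNDs are equivalent ($\sim$) if their kernels coincide. Grading and quasitorus. $B$ is graded by $K=\mathbb{Z}^{k+m+n}/\langle(1,\dots,1,a_1,\dots,a_m,0,\dots,0),(0,\dots,0,l_1,\dots,l_n)\rangle$, where the generators $x_1,\dots,x_k,y_1,\dots,y_m,z_1,\dots,z_n$ are homogeneous of degrees the classes of the standard basis vectors. The corresponding quasitorus $\mathbb{H}=\mathrm{Hom}_\mathbb{Z}(K,\mathbb{K}^\times)$ acts on $B$ effectively by rescaling the generators; it consists of all diagonal rescalings leaving both monomials $x_1\cdots x_ky_1^{a_1}\cdots y_m^{a_m}$ and $z_1^{l_1}\cdots z_n^{l_n}$ invariant. "Homogeneous" means homogeneous with respect to this $K$-grading. A polynomial contains a variable if the variable occurs in it. $\mathrm{Aut}(B)_\delta=\{\varphi\in\mathrm{Aut}(B):\varphi\delta=\delta\varphi\}$, $\mathbb{H}_\delta=\mathbb{H}\cap\mathrm{Aut}(B)_\delta$, and $\mathcal{U}(\delta)=\{\exp(\partial):\partial\text{ an LND of }B,\ \partial\sim\delta\text{ or }\partial=0\}$. $S_\delta$ is the group of all permutations of the $k+m+n-2$ variables $x_2,\dots,x_k,y_1,\dots,y_m,z_2,\dots,z_n$ that preserve each of the three polynomials $h$, $h_1=x_2\cdots x_ky_1^{a_1}\cdots y_m^{a_m}$ and $h_2=z_2^{l_2}\cdots z_n^{l_n}$; it is regarded as a subgroup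 of $\mathrm{Aut}(B)_\delta$ by letting it fix $x_1$ and $z_1$. *)

theory Defs
  imports
    "HOL-Algebra.Algebra"
    "HOL-Algebra.Algebraic_Closure_Type"
    "HOL-Computational_Algebra.Computational_Algebra"
    "HOL-Combinatorics.Permutations"
    "HOL-Library.Poly_Mapping"
begin

section \<open>Polynomials\<close>

text \<open>The letters x, y, z, each with indices starting at 1. A polynomial maps exponent vectors
  to coefficients; the library makes this type a commutative ring with convolution as product.\<close>

datatype letter = VX nat | VY nat | VZ nat

type_synonym 'a mpoly = "(letter \<Rightarrow>\<^sub>0 nat) \<Rightarrow>\<^sub>0 'a"

definition Var :: "letter \<Rightarrow> 'a::comm_ring_1 mpoly" where
  "Var v = Poly_Mapping.single (Poly_Mapping.single v 1) 1"

definition Const :: "'a::comm_ring_1 \<Rightarrow> 'a mpoly" where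
  "Const c = Poly_Mapping.single 0 c"

definition occurring :: "'a::comm_ring_1 mpoly \<Rightarrow> letter set" where
  "occurring p = (\<Union>t\<in>Poly_Mapping.keys p. Poly_Mapping.keys t)"

definition subst :: "(letter \<Rightarrow> 'a mpoly) \<Rightarrow> 'a mpoly \<Rightarrow> 'a::comm_ring_1 mpoly" where
  "subst g p = (\<Sum>t\<in>Poly_Mapping.keys p.
     Const (Poly_Mapping.lookup p t) * (\<Prod>v\<in>Poly_Mapping.keys t. g v ^ Poly_Mapping.lookup t v))"

definition poly_ring :: "letter set \<Rightarrow> 'a::comm_ring_1 mpoly ring" where
  "poly_ring V = \<lparr>carrier = {p. occurring p \<subseteq> V}, monoid.mult = (*), one = 1,
     ring.zero = 0, add = (+)\<rparr>"


section \<open>Algebras over a field, their automorphisms and derivations\<close>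

text \<open>A \<open>'a\<close>-algebra is a ring \<open>B\<close> together with its structure map \<open>\<eta>\<close> from \<open>'a\<close> to \<open>B\<close>.
  Automorphisms and derivations are those of the algebra, i.e. linear over \<open>'a\<close>.\<close>

definition alg_aut :: "('b, 'c) ring_scheme \<Rightarrow> ('a \<Rightarrow> 'b) \<Rightarrow> ('b \<Rightarrow> 'b) set" where
  "alg_aut B \<eta> = {\<phi> \<in> Bij (carrier B). \<phi> \<in> ring_hom B B \<and> (\<forall>c. \<phi> (\<eta> c) = \<eta> c)}"

definition derivation :: "('b, 'c) ring_scheme \<Rightarrow> ('a \<Rightarrow> 'b) \<Rightarrow> ('b \<Rightarrow> 'b) \<Rightarrow> bool" where
  "derivation B \<eta> D \<longleftrightarrow> D \<in> carrier B \<rightarrow> carrier B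
     \<and> (\<forall>f\<in>carrier B. \<forall>g\<in>carrier B. D (f \<oplus>\<^bsub>B\<^esub> g) = D f \<oplus>\<^bsub>B\<^esub> D g)
     \<and> (\<forall>f\<in>carrier B. \<forall>g\<in>carrier B. D (f \<otimes>\<^bsub>B\<^esub> g) = (D f \<otimes>\<^bsub>B\<^esub> g) \<oplus>\<^bsub>B\<^esub> (f \<otimes>\<^bsub>B\<^esub> D g))
     \<and> (\<forall>c. \<forall>f\<in>carrier B. D (\<eta> c \<otimes>\<^bsub>B\<^esub> f) = \<eta> c \<otimes>\<^bsub>B\<^esub> D f)"

definition LND :: "('b, 'c) ring_scheme \<Rightarrow> ('a \<Rightarrow> 'b) \<Rightarrow> ('b \<Rightarrow> 'b) \<Rightarrow> bool" where
  "LND B \<eta> D \<longleftrightarrow> derivation B \<eta> D \<and> (\<forall>f\<in>carrier B. \<exists>i. (D ^^ i) f = \<zero>\<^bsub>B\<^esub>)"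

definition der_kernel :: "('b, 'c) ring_scheme \<Rightarrow> ('b \<Rightarrow> 'b) \<Rightarrow> 'b set" where
  "der_kernel B D = {f \<in> carrier B. D f = \<zero>\<^bsub>B\<^esub>}"

definition LND_equiv :: "('b, 'c) ring_scheme \<Rightarrow> ('b \<Rightarrow> 'b) \<Rightarrow> ('b \<Rightarrow> 'b) \<Rightarrow> bool" where
  "LND_equiv B D D' \<longleftrightarrow> der_kernel B D = der_kernel B D'"

text \<open>For a locally nilpotent \<open>D\<close> the index set of the sum is finite.\<close>

definition exp_der :: "('b, 'c) ring_scheme \<Rightarrow> ('a::field_char_0 \<Rightarrow> 'b) \<Rightarrow> ('b \<Rightarrow> 'b) \<Rightarrow> 'b \<Rightarrow> 'b" where
  "exp_der B \<eta> D = (\<lambda>f\<in>carrier B.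
     finsum B (\<lambda>i. \<eta> (1 / fact i) \<otimes>\<^bsub>B\<^esub> (D ^^ i) f) {i. (D ^^ i) f \<noteq> \<zero>\<^bsub>B\<^esub>})"

definition U_group :: "('b, 'c) ring_scheme \<Rightarrow> ('a::field_char_0 \<Rightarrow> 'b) \<Rightarrow> ('b \<Rightarrow> 'b) \<Rightarrow> ('b \<Rightarrow> 'b) set" where
  "U_group B \<eta> \<delta> = {exp_der B \<eta> D | D. LND B \<eta> D
     \<and> (LND_equiv B D \<delta> \<or> (\<forall>f\<in>carrier B. D f = \<zero>\<^bsub>B\<^esub>))}"

definition alg_aut_comm :: "('b, 'c) ring_scheme \<Rightarrow> ('a \<Rightarrow> 'b) \<Rightarrow> ('b \<Rightarrow> 'b) \<Rightarrow> ('b \<Rightarrow> 'b) set" where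
  "alg_aut_comm B \<eta> \<delta> = {\<phi> \<in> alg_aut B \<eta>. \<forall>f\<in>carrier B. \<phi> (\<delta> f) = \<delta> (\<phi> f)}"

definition alg_aut_comm_group :: "('b, 'c) ring_scheme \<Rightarrow> ('a \<Rightarrow> 'b) \<Rightarrow> ('b \<Rightarrow> 'b) \<Rightarrow> ('b \<Rightarrow> 'b) monoid" where
  "alg_aut_comm_group B \<eta> \<delta> = (BijGroup (carrier B))\<lparr>carrier := alg_aut_comm B \<eta> \<delta>\<rparr>"

text \<open>\<open>G\<close> is the internal semidirect product of the subgroup \<open>A\<close> and the normal subgroup \<open>N\<close>.\<close>

definition semidirect :: "('g, 'c) monoid_scheme \<Rightarrow> 'g set \<Rightarrow> 'g set \<Rightarrow> bool" where
  "semidirect G A N \<longleftrightarrow> group G \<and> subgroup A G \<and> N \<lhd> G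
     \<and> A \<inter> N = {\<one>\<^bsub>G\<^esub>} \<and> A <#>\<^bsub>G\<^esub> N = carrier G"


section \<open>The hypersurface\<close>

definition letters :: "nat \<Rightarrow> nat \<Rightarrow> nat \<Rightarrow> letter set" where
  "letters k m n = VX ` {1..k} \<union> VY ` {1..m} \<union> VZ ` {1..n}"

definition letters' :: "nat \<Rightarrow> nat \<Rightarrow> nat \<Rightarrow> letter set" where
  "letters' k m n = VX ` {2..k} \<union> VY ` {1..m} \<union> VZ ` {2..n}"

definition h1 :: "nat \<Rightarrow> nat \<Rightarrow> (nat \<Rightarrow> nat) \<Rightarrow> 'a::comm_ring_1 mpoly" where
  "h1 k m a = (\<Prod>i=2..k. Var (VX i)) * (\<Prod>s=1..m. Var (VY s) ^ a s)"

definition h2 :: "nat \<Rightarrow> (nat \<Rightarrow> nat) \<Rightarrow> 'a::comm_ring_1 mpoly" where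
  "h2 n l = (\<Prod>j=2..n. Var (VZ j) ^ l j)"

definition equation :: "nat \<Rightarrow> nat \<Rightarrow> nat \<Rightarrow> (nat \<Rightarrow> nat) \<Rightarrow> (nat \<Rightarrow> nat) \<Rightarrow> 'a::comm_ring_1 mpoly" where
  "equation k m n a l = (\<Prod>i=1..k. Var (VX i)) * (\<Prod>s=1..m. Var (VY s) ^ a s)
     - ((\<Prod>j=1..n. Var (VZ j) ^ l j) + 1)"

definition eq_ideal :: "nat \<Rightarrow> nat \<Rightarrow> nat \<Rightarrow> (nat \<Rightarrow> nat) \<Rightarrow> (nat \<Rightarrow> nat) \<Rightarrow> 'a::comm_ring_1 mpoly set" where
  "eq_ideal k m n a l = PIdl\<^bsub>poly_ring (letters k m n)\<^esub> (equation k m n a l)"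

definition coord_ring ::
    "nat \<Rightarrow> nat \<Rightarrow> nat \<Rightarrow> (nat \<Rightarrow> nat) \<Rightarrow> (nat \<Rightarrow> nat) \<Rightarrow> 'a::comm_ring_1 mpoly set ring" where
  "coord_ring k m n a l = poly_ring (letters k m n) Quot eq_ideal k m n a l"

definition cls ::
    "nat \<Rightarrow> nat \<Rightarrow> nat \<Rightarrow> (nat \<Rightarrow> nat) \<Rightarrow> (nat \<Rightarrow> nat) \<Rightarrow> 'a::comm_ring_1 mpoly \<Rightarrow> 'a mpoly set" where
  "cls k m n a l p = eq_ideal k m n a l +>\<^bsub>poly_ring (letters k m n)\<^esub> p"

definition scalar ::
    "nat \<Rightarrow> nat \<Rightarrow> nat \<Rightarrow> (nat \<Rightarrow> nat) \<Rightarrow> (nat \<Rightarrow> nat) \<Rightarrow> 'a::comm_ring_1 \<Rightarrow> 'a mpoly set" where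
  "scalar k m n a l c = cls k m n a l (Const c)"

text \<open>The map on the coordinate ring induced by a substitution that maps the ideal to itself;
  then the union is over equal cosets.\<close>

definition induced :: "nat \<Rightarrow> nat \<Rightarrow> nat \<Rightarrow> (nat \<Rightarrow> nat) \<Rightarrow> (nat \<Rightarrow> nat) \<Rightarrow> (letter \<Rightarrow> 'a mpoly)
    \<Rightarrow> 'a::comm_ring_1 mpoly set \<Rightarrow> 'a mpoly set" where
  "induced k m n a l g = (\<lambda>A\<in>carrier (coord_ring k m n a l). \<Union>p\<in>A. cls k m n a l (subst g p))"


section \<open>The grading and the quasitorus\<close>

definition relations :: "nat \<Rightarrow> nat \<Rightarrow> nat \<Rightarrow> (nat \<Rightarrow> nat) \<Rightarrow> (nat \<Rightarrow> nat) \<Rightarrow> (letter \<Rightarrow>\<^sub>0 int) set" where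
  "relations k m n a l = generate (free_Abelian_group (letters k m n))
     {(\<Sum>i=1..k. frag_of (VX i)) + (\<Sum>s=1..m. frag_cmul (int (a s)) (frag_of (VY s))),
      (\<Sum>j=1..n. frag_cmul (int (l j)) (frag_of (VZ j)))}"

definition grading_group ::
    "nat \<Rightarrow> nat \<Rightarrow> nat \<Rightarrow> (nat \<Rightarrow> nat) \<Rightarrow> (nat \<Rightarrow> nat) \<Rightarrow> (letter \<Rightarrow>\<^sub>0 int) set monoid" where
  "grading_group k m n a l = free_Abelian_group (letters k m n) Mod relations k m n a l"

definition deg_class ::
    "nat \<Rightarrow> nat \<Rightarrow> nat \<Rightarrow> (nat \<Rightarrow> nat) \<Rightarrow> (nat \<Rightarrow> nat) \<Rightarrow> (letter \<Rightarrow>\<^sub>0 int) \<Rightarrow> (letter \<Rightarrow>\<^sub>0 int) set" where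
  "deg_class k m n a l e = relations k m n a l #>\<^bsub>free_Abelian_group (letters k m n)\<^esub> e"

definition homogeneous ::
    "nat \<Rightarrow> nat \<Rightarrow> nat \<Rightarrow> (nat \<Rightarrow> nat) \<Rightarrow> (nat \<Rightarrow> nat) \<Rightarrow> 'a::comm_ring_1 mpoly \<Rightarrow> bool" where
  "homogeneous k m n a l p \<longleftrightarrow> (\<exists>w\<in>carrier (grading_group k m n a l).
     \<forall>t\<in>Poly_Mapping.keys p. deg_class k m n a l (Poly_Mapping.map int t) = w)"

definition quasitorus :: "nat \<Rightarrow> nat \<Rightarrow> nat \<Rightarrow> (nat \<Rightarrow> nat) \<Rightarrow> (nat \<Rightarrow> nat)
    \<Rightarrow> ('a::field mpoly set \<Rightarrow> 'a mpoly set) set" where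
  "quasitorus k m n a l =
     {induced k m n a l (\<lambda>v. Const (\<chi> (deg_class k m n a l (frag_of v))) * Var v) | \<chi>.
        \<chi> \<in> hom (grading_group k m n a l) (units_of (ring_of_type_algebra :: 'a ring))}"

definition H_delta :: "nat \<Rightarrow> nat \<Rightarrow> nat \<Rightarrow> (nat \<Rightarrow> nat) \<Rightarrow> (nat \<Rightarrow> nat)
    \<Rightarrow> ('a::field mpoly set \<Rightarrow> 'a mpoly set) \<Rightarrow> ('a mpoly set \<Rightarrow> 'a mpoly set) set" where
  "H_delta k m n a l \<delta> = quasitorus k m n a l
     \<inter> alg_aut_comm (coord_ring k m n a l) (scalar k m n a l) \<delta>"


section \<open>The permutation group\<close>

definition rename :: "(letter \<Rightarrow> letter) \<Rightarrow> 'a::comm_ring_1 mpoly \<Rightarrow> 'a mpoly" where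
  "rename \<sigma> = subst (\<lambda>v. Var (\<sigma> v))"

definition S_delta :: "nat \<Rightarrow> nat \<Rightarrow> nat \<Rightarrow> (nat \<Rightarrow> nat) \<Rightarrow> (nat \<Rightarrow> nat)
    \<Rightarrow> 'a::comm_ring_1 mpoly \<Rightarrow> ('a mpoly set \<Rightarrow> 'a mpoly set) set" where
  "S_delta k m n a l h = {induced k m n a l (\<lambda>v. Var (\<sigma> v)) | \<sigma>. \<sigma> permutes letters' k m n
     \<and> rename \<sigma> h = h
     \<and> rename \<sigma> (h1 k m a) = (h1 k m a :: 'a mpoly)
     \<and> rename \<sigma> (h2 n l) = (h2 n l :: 'a mpoly)}"

end

theory Submission
  imports Defs
begin

text \<open>Write \<open>A = K[x\<^sub>2, ..., x\<^sub>k, y\<^sub>1, ..., y\<^sub>m, z\<^sub>2, ..., z\<^sub>n]\<close>, \<open>z = z\<^sub>1\<close>, \<open>l = l\<^sub>1\<close>, so that the equation of the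
hypersurface reads \<open>x\<^sub>1 h\<^sub>1 = z\<^sup>l h\<^sub>2 + 1\<close>. Two homogeneous monomials without \<open>x\<^sub>1\<close> and \<open>z\<^sub>1\<close> whose degrees
agree are equal, because the relations of the grading group involve \<open>x\<^sub>1\<close> and \<open>z\<^sub>1\<close> independently. Hence
\<open>h\<close> is a scalar times a monomial (\<open>homogeneous_imp_monomial\<close>), and \<open>h h\<^sub>1\<close> is a monomial in which every
letter of \<open>A\<close> occurs.

Solving the equation for \<open>x\<^sub>1\<close> embeds \<open>B\<close> into the polynomials in \<open>z\<close> over the fraction field of \<open>A\<close>
(\<open>ev_kernel\<close>). There \<open>\<delta>\<close> is \<open>h h\<^sub>1 \<cdot> d/dz\<close>, its kernel is \<open>A\<close>, and questions about \<open>B\<close> become questions about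
coefficients. What makes this work is the control of elements of low degree in \<open>z\<close>: an element of \<open>B\<close> of
degree less than \<open>l\<close> has coefficients in \<open>A\<close> (\<open>Bs_degree_less\<close>), and if the degree is at most \<open>l\<close>, then the
coefficient at \<open>z\<^sup>l\<close> lies in \<open>(A h\<^sub>1 + A h\<^sub>2) / h\<^sub>1\<close> (\<open>Bs_degree_le\<close>). Both follow by lowering the degree in
\<open>x\<^sub>1\<close> of an expression of the element: \<open>z\<^sup>l h\<^sub>2 + 1\<close> has leading coefficient \<open>h\<^sub>2\<close>, which is no zero divisor
modulo \<open>h\<^sub>1\<close>.

Let \<open>\<phi>\<close> be an automorphism that commutes with \<open>\<delta>\<close> (\<open>classification\<close>). It maps \<open>A = ker \<delta>\<close> to itself, and
since \<open>\<delta> (\<phi> z) = \<phi> (h h\<^sub>1)\<close> lies in \<open>A\<close>, one gets \<open>\<phi> z = \<mu> z + g\<close> with \<open>\<mu>, g\<close> in \<open>A\<close> and \<open>\<phi> (h h\<^sub>1) = \<mu> h h\<^sub>1\<close>; by symmetry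
\<open>\<mu>\<close> is a unit, that is, a scalar. Factors of a monomial are monomials, so \<open>\<phi>\<close> maps every letter of \<open>A\<close> to a
monomial, and so does its inverse: \<open>\<phi>\<close> permutes and rescales the letters of \<open>A\<close>. The coefficient of \<open>\<phi> x\<^sub>1\<close>
at \<open>z\<^sup>l\<close> is a scalar times \<open>\<phi> h\<^sub>2 / \<phi> h\<^sub>1\<close>, and its shape \<open>(\<alpha> h\<^sub>1 + \<beta> h\<^sub>2) / h\<^sub>1\<close> forces the permutation to fix both
monomials \<open>h\<^sub>1\<close> and \<open>h\<^sub>2\<close>, hence also \<open>h\<close>. Subtracting the right multiple of \<open>x\<^sub>1\<close> from \<open>\<phi> x\<^sub>1\<close> leaves an element
of degree less than \<open>l\<close>; its coefficients at \<open>z\<^sup>l\<^sup>-\<^sup>1\<close> and at \<open>1\<close> show that \<open>h\<^sub>1\<close> divides \<open>g\<close> and that the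
scalars satisfy the relation of the torus.

So \<open>\<phi>\<close> agrees on \<open>A\<close> with the composition of an element of \<open>S\<^sub>\<delta>\<close> and one of \<open>H\<^sub>\<delta>\<close> (\<open>monomial_part\<close>). The
automorphisms in question that fix \<open>A\<close> pointwise are the translations \<open>z \<mapsto> z + h\<^sub>1 g\<close>; by Taylor's formula these
are the exponentials of the derivations \<open>h\<^sub>1 g \<cdot> d/dz\<close>, and every locally nilpotent derivation with kernel \<open>A\<close> has
the form \<open>b \<cdot> d/dz\<close> (\<open>locally_nilpotent_derivation_eq\<close>). Hence \<open>U(\<delta>)\<close> is the pointwise stabiliser of \<open>A\<close>
(\<open>U_group_eq\<close>), which is normal, since \<open>A\<close> is invariant, and meets the monomial automorphisms trivially.\<close>

section \<open>Polynomials in several letters\<close>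

alias keys = Poly_Mapping.keys
alias lookup = Poly_Mapping.lookup
alias single = Poly_Mapping.single
alias coeff = Polynomial.coeff
alias degree = Polynomial.degree
alias monom = Polynomial.monom

text \<open>Any linear order on the letters will do: it orders the exponent vectors, and looking at extremal exponents
shows that polynomials over a domain form a domain.\<close>

instantiation letter :: linorder
begin

fun letter_code :: "letter \<Rightarrow> nat" where
  "letter_code (VX i) = 3 * i"
| "letter_code (VY i) = 3 * i + 1"
| "letter_code (VZ i) = 3 * i + 2"

definition less_eq_letter :: "letter \<Rightarrow> letter \<Rightarrow> bool" where
  "v \<le> w \<longleftrightarrow> letter_code v \<le> letter_code w"

definition less_letter :: "letter \<Rightarrow> letter \<Rightarrow> bool" where
  "v < w \<longleftrightarrow> letter_code v < letter_code w"

lemma letter_code_inject: "letter_code v = letter_code w \<Longrightarrow> v = w"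
  by (cases v; cases w; simp; presburger)

instance
  by standard (auto simp: less_eq_letter_def less_letter_def intro: letter_code_inject)

end

instance fract :: ("{idom,ring_char_0}") ring_char_0
proof
  have of_nat_fract: "(of_nat i :: 'a fract) = to_fract (of_nat i)" for i
    by (induction i) simp_all
  show "inj (of_nat :: nat \<Rightarrow> 'a fract)"
    by (simp add: inj_on_def of_nat_fract)
qed

subsection \<open>Monomials\<close>

abbreviation mon :: "(letter \<Rightarrow>\<^sub>0 nat) \<Rightarrow> 'a::comm_ring_1 mpoly" where
  "mon e \<equiv> single e 1"

lemma Const_0 [simp]: "Const 0 = 0"
  and Const_1 [simp]: "Const 1 = 1"
  and Const_add: "Const (c + d) = Const c + Const d"
  and Const_mult: "Const (c * d) = Const c * Const d"
  and Const_diff: "Const (c - d) = Const c - Const d"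
  and Const_uminus: "Const (- c) = - Const c"
  by (simp_all add: Const_def single_add single_diff single_uminus mult_single)

lemma Const_power: "Const (c ^ i) = Const c ^ i"
  by (induction i) (simp_all add: Const_mult)

lemma Const_prod: "Const (prod f I) = (\<Prod>i\<in>I. Const (f i))"
  by (induction I rule: infinite_finite_induct) (simp_all add: Const_mult)

lemma Const_eq_iff [simp]: "Const c = Const d \<longleftrightarrow> c = d"
  by (metis Const_def lookup_single_eq)

lemma Const_eq_0_iff [simp]: "Const c = 0 \<longleftrightarrow> c = 0"
  by (metis Const_0 Const_eq_iff)

lemma single_conv_Const_mon: "single e c = Const c * mon e"
  by (simp add: Const_def mult_single)

lemma mon_add: "mon (e + f) = mon e * mon f"
  by (simp add: mult_single)

lemma Var_power: "Var v ^ i = mon (single v i)"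
  by (induction i) (simp_all add: Var_def mult_single flip: single_add)

lemma sum_single_lookup: "(\<Sum>v\<in>keys p. single v (lookup p v)) = p"
proof (rule poly_mapping_eqI)
  fix w
  show "lookup (\<Sum>v\<in>keys p. single v (lookup p v)) w
      = lookup p w"
  proof (cases "w \<in> keys p")
    case True
    then show ?thesis
      by (simp add: lookup_sum lookup_single when_def sum.delta)
  next
    case False
    then have "(\<Sum>v\<in>keys p. lookup
        (single v (lookup p v)) w) = 0"
      by (intro sum.neutral) (auto simp: lookup_single when_def)
    with False show ?thesis by (simp add: lookup_sum in_keys_iff)
  qed
qed

lemma mon_sum: "finite I \<Longrightarrow> mon (\<Sum>i\<in>I. f i) = (\<Prod>i\<in>I. mon (f i))"
  by (induction I rule: finite_induct) (simp_all add: mon_add)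

lemma mon_eq_prod_Var:
  "mon e = (\<Prod>v\<in>keys e. Var v ^ lookup e v)"
  by (simp add: Var_power sum_single_lookup flip: mon_sum)

lemma mpoly_expansion:
  "p = (\<Sum>t\<in>keys p. Const (lookup p t) *
      (\<Prod>v\<in>keys t. Var v ^ lookup t v))"
  by (simp add: sum_single_lookup flip: mon_eq_prod_Var single_conv_Const_mon)


subsection \<open>Occurring letters\<close>

lemma occurring_add: "occurring (p + q) \<subseteq> occurring p \<union> occurring q"
  using keys_add[of p q] by (auto simp: occurring_def)

lemma occurring_uminus [simp]: "occurring (- p) = occurring p"
  by (simp add: occurring_def in_keys_iff)

lemma occurring_mult: "occurring (p * q) \<subseteq> occurring p \<union> occurring q"
proof
  fix v assume "v \<in> occurring (p * q)"
  then obtain t where "t \<in> keys (p * q)" "v \<in> keys t"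
    by (auto simp: occurring_def)
  then obtain a b where "a \<in> keys p" "b \<in> keys q" "v \<in> keys (a + b)"
    using keys_mult[of p q] by auto
  then show "v \<in> occurring p \<union> occurring q"
    using keys_add[of a b] by (auto simp: occurring_def)
qed

lemma occurring_0 [simp]: "occurring 0 = {}"
  and occurring_1 [simp]: "occurring 1 = {}"
  and occurring_Const [simp]: "occurring (Const c) = {}"
  by (auto simp: occurring_def Const_def split: if_splits)

lemma occurring_mon [simp]: "occurring (mon e :: 'a::comm_ring_1 mpoly) = keys e"
  by (simp add: occurring_def)

lemma occurring_Var [simp]: "occurring (Var v :: 'a::comm_ring_1 mpoly) = {v}"
  by (simp add: occurring_def Var_def)

text \<open>The subalgebra on the letters in \<open>V\<close>, as a set inside the type of all polynomials.\<close>

definition Polys :: "letter set \<Rightarrow> 'a::comm_ring_1 mpoly set" where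
  "Polys V = {p. occurring p \<subseteq> V}"

lemma Polys_add [intro]: "p \<in> Polys V \<Longrightarrow> q \<in> Polys V \<Longrightarrow> p + q \<in> Polys V"
  using occurring_add[of p q] by (auto simp: Polys_def)

lemma Polys_mult [intro]: "p \<in> Polys V \<Longrightarrow> q \<in> Polys V \<Longrightarrow> p * q \<in> Polys V"
  using occurring_mult[of p q] by (auto simp: Polys_def)

lemma Polys_uminus [intro]: "p \<in> Polys V \<Longrightarrow> - p \<in> Polys V"
  by (auto simp: Polys_def)

lemma Polys_diff [intro]: "p \<in> Polys V \<Longrightarrow> q \<in> Polys V \<Longrightarrow> p - q \<in> Polys V"
  using Polys_add[of p V "- q"] Polys_uminus[of q V] by simp

lemma Polys_0 [intro, simp]: "0 \<in> Polys V"
  and Polys_1 [intro, simp]: "1 \<in> Polys V"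
  and Polys_Const [intro, simp]: "Const c \<in> Polys V"
  and Polys_Var [simp]: "Var v \<in> Polys V \<longleftrightarrow> v \<in> V"
  and Polys_mon [simp]: "mon e \<in> Polys V \<longleftrightarrow> keys e \<subseteq> V"
  by (simp_all add: Polys_def)

lemma Polys_power [intro]: "p \<in> Polys V \<Longrightarrow> p ^ i \<in> Polys V"
  by (induction i) auto

lemma Polys_mono: "V \<subseteq> W \<Longrightarrow> p \<in> Polys V \<Longrightarrow> p \<in> Polys W"
  by (auto simp: Polys_def)

text \<open>Homomorphisms and derivations are compared on generators by this rule.\<close>

lemma Polys_induct [consumes 1, case_names Const Var add mult]:
  assumes "p \<in> Polys V"
    and Const: "\<And>c. P (Const c)"
    and Var: "\<And>v. v \<in> V \<Longrightarrow> P (Var v)"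
    and add: "\<And>p q. p \<in> Polys V \<Longrightarrow> q \<in> Polys V \<Longrightarrow> P p \<Longrightarrow> P q \<Longrightarrow> P (p + q)"
    and mult: "\<And>p q. p \<in> Polys V \<Longrightarrow> q \<in> Polys V \<Longrightarrow> P p \<Longrightarrow> P q \<Longrightarrow> P (p * q)"
  shows "P p"
proof -
  let ?Q = "\<lambda>p. p \<in> Polys V \<and> P p"
  have Q_0: "?Q 0" and Q_1: "?Q 1"
    using Const[of 0] Const[of 1] by auto
  have Q_power: "?Q (Var v ^ i)" if "v \<in> V" for v i
    using Q_1 Var[OF that] that by (induction i) (auto intro!: mult)
  have Q_prod: "?Q (\<Prod>v\<in>W. Var v ^ f v)" if "finite W" "W \<subseteq> V" for W f
    using that Q_1 Q_power by (induction W rule: finite_induct) (auto intro!: mult simp del: Var_power)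
  have "?Q (\<Sum>t\<in>T. Const (c t) * (\<Prod>v\<in>keys t. Var v ^ lookup t v))"
    if "finite T" "T \<subseteq> keys p" for T c
    using that
  proof (induction T rule: finite_induct)
    case empty
    then show ?case using Q_0 by simp
  next
    case (insert t T)
    have "keys t \<subseteq> V"
      using insert.prems assms(1) by (auto simp: Polys_def occurring_def)
    then have "?Q (\<Prod>v\<in>keys t. Var v ^ lookup t v)"
      by (intro Q_prod) auto
    with insert show ?case
      by (auto intro!: add mult Const)
  qed
  from this[of "keys p" "lookup p"] show ?thesis
    by (simp flip: mpoly_expansion)
qed


subsection \<open>Evaluation\<close>

text \<open>Evaluation in an arbitrary ring; substitution is the case where the target consists of polynomials again.\<close>

definition evalp :: "('a \<Rightarrow> 'b) \<Rightarrow> (letter \<Rightarrow> 'b) \<Rightarrow> 'a::comm_ring_1 mpoly \<Rightarrow> 'b::comm_ring_1" where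
  "evalp C g p = (\<Sum>t\<in>keys p.
     C (lookup p t) * (\<Prod>v\<in>keys t. g v ^ lookup t v))"

lemma subst_eq_evalp: "subst g = evalp Const g"
  by (simp add: fun_eq_iff subst_def evalp_def)

locale coefficient_hom =
  fixes C :: "'a::comm_ring_1 \<Rightarrow> 'b::comm_ring_1"
  assumes C_1 [simp]: "C 1 = 1"
    and C_add: "C (c + d) = C c + C d"
    and C_mult: "C (c * d) = C c * C d"
begin

lemma C_0 [simp]: "C 0 = 0"
  using C_add[of 0 0] by simp

lemma evalp_superset:
  assumes "finite T" "keys p \<subseteq> T"
  shows "evalp C g p = (\<Sum>t\<in>T. C (lookup p t) *
      (\<Prod>v\<in>keys t. g v ^ lookup t v))"
  unfolding evalp_def using assms
  by (intro sum.mono_neutral_left) (auto simp: in_keys_iff)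

lemma evalp_add: "evalp C g (p + q) = evalp C g p + evalp C g q"
proof -
  let ?T = "keys p \<union> keys q"
  have "keys (p + q) \<subseteq> ?T" by (rule keys_add)
  then show ?thesis
    by (simp add: evalp_superset[of ?T] lookup_add C_add distrib_right sum.distrib)
qed

lemma evalp_0 [simp]: "evalp C g 0 = 0"
  by (simp add: evalp_def)

lemma evalp_sum: "evalp C g (sum f I) = (\<Sum>i\<in>I. evalp C g (f i))"
  by (induction I rule: infinite_finite_induct) (simp_all add: evalp_add)

lemma evalp_single: "evalp C g (single t c) =
    C c * (\<Prod>v\<in>keys t. g v ^ lookup t v)"
  by (cases "c = 0") (simp_all add: evalp_def)

lemma prod_power_lookup_add:
  fixes g :: "letter \<Rightarrow> 'b"
  shows "(\<Prod>v\<in>keys (s + t). g v ^ lookup (s + t) v) =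
    (\<Prod>v\<in>keys s. g v ^ lookup s v) *
    (\<Prod>v\<in>keys t. g v ^ lookup t v)"
proof -
  let ?W = "keys s \<union> keys t"
  have superset: "(\<Prod>v\<in>keys u. g v ^ lookup u v) =
      (\<Prod>v\<in>?W. g v ^ lookup u v)" if "keys u \<subseteq> ?W" for u
    using that by (intro prod.mono_neutral_left) (auto simp: in_keys_iff)
  show ?thesis
    using superset[OF keys_add] superset[of s] superset[of t]
    by (simp add: lookup_add power_add prod.distrib)
qed

lemma evalp_mult: "evalp C g (p * q) = evalp C g p * evalp C g q"
proof -
  have singles: "evalp C g (single s c * single t d) =
      evalp C g (single s c) * evalp C g (single t d)" for s t c d
    by (simp add: mult_single evalp_single prod_power_lookup_add C_mult algebra_simps)
  have "evalp C g (p * q) = evalp C g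
      ((\<Sum>s\<in>keys p. single s (lookup p s)) *
       (\<Sum>t\<in>keys q. single t (lookup q t)))"
    by (simp add: sum_single_lookup)
  also have "\<dots> = evalp C g (\<Sum>s\<in>keys p. single s (lookup p s)) *
       evalp C g (\<Sum>t\<in>keys q. single t (lookup q t))"
    by (simp only: sum_product evalp_sum singles)
  finally show ?thesis by (simp add: sum_single_lookup)
qed

lemma evalp_Const [simp]: "evalp C g (Const c) = C c"
  by (simp add: Const_def evalp_single)

lemma evalp_1 [simp]: "evalp C g 1 = 1"
  using evalp_Const[of g 1] by simp

lemma evalp_Var [simp]: "evalp C g (Var v) = g v"
  by (simp add: Var_def evalp_single)

lemma evalp_uminus: "evalp C g (- p) = - evalp C g p"
  using evalp_add[of g p "- p"] by (simp add: eq_neg_iff_add_eq_0 add.commute)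

lemma evalp_diff: "evalp C g (p - q) = evalp C g p - evalp C g q"
  using evalp_add[of g p "- q"] by (simp add: evalp_uminus)

lemma evalp_power: "evalp C g (p ^ i) = evalp C g p ^ i"
  by (induction i) (simp_all add: evalp_mult)

lemma evalp_prod: "evalp C g (prod f I) = (\<Prod>i\<in>I. evalp C g (f i))"
  by (induction I rule: infinite_finite_induct) (simp_all add: evalp_mult)

lemma evalp_mon: "evalp C g (mon e) = (\<Prod>v\<in>keys e. g v ^ lookup e v)"
  by (simp add: evalp_single)

end

interpretation subst: coefficient_hom "Const :: 'a::comm_ring_1 \<Rightarrow> 'a mpoly"
  by standard (simp_all add: Const_add Const_mult)

lemmas subst_simps = subst.evalp_add subst.evalp_mult subst.evalp_diff subst.evalp_power
  subst.evalp_prod subst.evalp_sum subst.evalp_mon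

lemma evalp_hom_unique:
  assumes "p \<in> Polys V"
    and "coefficient_hom C"
    and "\<And>c. F (Const c) = C c"
    and "\<And>v. v \<in> V \<Longrightarrow> F (Var v) = g v"
    and "\<And>p q. p \<in> Polys V \<Longrightarrow> q \<in> Polys V \<Longrightarrow> F (p + q) = F p + F q"
    and "\<And>p q. p \<in> Polys V \<Longrightarrow> q \<in> Polys V \<Longrightarrow> F (p * q) = F p * F q"
  shows "F p = evalp C g p"
proof -
  interpret coefficient_hom C by fact
  from assms(1) show ?thesis
    by (induction rule: Polys_induct) (simp_all add: assms(3-6) evalp_add evalp_mult)
qed

lemma subst_in_Polys:
  assumes "p \<in> Polys V" "\<And>v. v \<in> V \<Longrightarrow> g v \<in> Polys W"
  shows "evalp Const g p \<in> Polys W"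
  using assms(1) by (induction rule: Polys_induct) (auto simp: subst_simps assms(2))

lemma evalp_subst:
  assumes "p \<in> Polys V" "coefficient_hom C" "\<And>v. v \<in> V \<Longrightarrow> f v = evalp C g' (g v)"
  shows "evalp C g' (evalp Const g p) = evalp C f p"
proof -
  interpret coefficient_hom C by fact
  from assms(1) show ?thesis
    by (induction rule: Polys_induct) (simp_all add: assms(3) evalp_add evalp_mult subst_simps)
qed

lemma subst_Var: "evalp Const Var p = p"
  unfolding evalp_def by (rule mpoly_expansion[symmetric])


subsection \<open>Divisibility by monomials\<close>

text \<open>If an exponent arises in a single way as a sum of exponents of the factors, no cancellation can occur there.\<close>

lemma lookup_times_extremal:
  fixes p q :: "('e::comm_monoid_add) \<Rightarrow>\<^sub>0 'a::comm_ring_1"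
  assumes "\<And>a' b'. a' \<in> keys p \<Longrightarrow> b' \<in> keys q \<Longrightarrow> a' + b' = a + b \<Longrightarrow> a' = a \<and> b' = b"
  shows "lookup (p * q) (a + b) = lookup p a * lookup q b"
proof -
  have "p * q = (\<Sum>s\<in>keys p. single s (lookup p s)) *
       (\<Sum>t\<in>keys q. single t (lookup q t))"
    by (simp add: sum_single_lookup)
  also have "\<dots> = (\<Sum>(s, t)\<in>keys p \<times> keys q.
      single (s + t) (lookup p s * lookup q t))"
    by (simp add: sum_product mult_single sum.cartesian_product)
  finally have "lookup (p * q) (a + b) = (\<Sum>(s, t)\<in>keys p \<times> keys q.
      (lookup p s * lookup q t when s + t = a + b))"
    by (simp add: lookup_sum lookup_single case_prod_unfold)
  also have "\<dots> = (\<Sum>st\<in>keys p \<times> keys q.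
      if st = (a, b) then lookup p a * lookup q b else 0)"
    using assms by (intro sum.cong) (auto simp: when_def split: if_splits)
  also have "\<dots> = lookup p a * lookup q b"
    by (subst sum.delta) (auto simp: in_keys_iff)
  finally show ?thesis .
qed

lemma keys_single_times:
  assumes "c \<noteq> (0::'a::idom)"
  shows "keys (single (e::letter \<Rightarrow>\<^sub>0 nat) c * p) = (+) e ` keys p"
proof -
  have "lookup (single e c * p) (e + t) = c * lookup p t" for t
    using lookup_times_extremal[of "single e c" p e t] assms by simp
  moreover have "keys (single e c * p) \<subseteq> (+) e ` keys p"
    using keys_mult[of "single e c" p] assms by auto
  ultimately show ?thesis
    using assms by (auto simp: in_keys_iff)
qed

lemma mon_dvdI:
  assumes "\<And>t v. t \<in> keys p \<Longrightarrow> lookup e v \<le> lookup t v"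
  shows "mon e dvd p"
proof -
  have "mon e dvd single t (lookup p t)" if "t \<in> keys p" for t
  proof -
    have "e + (t - e) = t"
      using assms[OF that] by (intro poly_mapping_eqI) (simp add: lookup_add lookup_minus)
    then have "single t (lookup p t) =
        mon e * single (t - e) (lookup p t)"
      by (simp add: mult_single)
    then show ?thesis by (rule dvdI)
  qed
  then have "mon e dvd (\<Sum>t\<in>keys p. single t (lookup p t))"
    by (rule dvd_sum)
  then show ?thesis by (simp add: sum_single_lookup)
qed

lemma mon_dvd_keysD:
  assumes "mon e dvd (p :: 'a::idom mpoly)" "t \<in> keys p"
  shows "lookup e v \<le> lookup t v"
proof -
  obtain q where q: "p = mon e * q" using assms(1) by (rule dvdE)
  obtain s where "t = e + s" using assms(2) keys_single_times[of "1::'a" e q] q by auto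
  then show ?thesis by (simp add: lookup_add)
qed

text \<open>Divisibility by a monomial is a condition on each exponent vector, and a monomial in other letters does not
influence it.\<close>

lemma mon_coprime_dvd:
  assumes "keys e \<inter> keys f = {}" "mon e dvd mon f * (p :: 'a::idom mpoly)"
  shows "mon e dvd p"
proof (rule mon_dvdI)
  fix t v assume "t \<in> keys p"
  then have "f + t \<in> keys (mon f * p)"
    by (simp add: keys_single_times)
  then have "lookup e v \<le> lookup f v + lookup t v"
    using mon_dvd_keysD[OF assms(2)] by (fastforce simp: lookup_add)
  moreover have "lookup e v = 0 \<or> lookup f v = 0"
    using assms(1) by (auto simp: in_keys_iff)
  ultimately show "lookup e v \<le> lookup t v" by auto
qed

lemma mon_times_in_Polys_cancel:
  assumes "mon e * (p :: 'a::idom mpoly) \<in> Polys V"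
  shows "p \<in> Polys V"
  unfolding Polys_def occurring_def
proof clarify
  fix t v assume "t \<in> keys p" "v \<in> keys t"
  then have "e + t \<in> keys (mon e * p)" "v \<in> keys (e + t)"
    by (auto simp: keys_single_times in_keys_iff lookup_add)
  then show "v \<in> V" using assms by (auto simp: Polys_def occurring_def)
qed

lemma mon_dvd_Const:
  assumes "mon e dvd (Const c :: 'a::idom mpoly)" "e \<noteq> 0"
  shows "c = 0"
proof (rule ccontr)
  assume "c \<noteq> 0"
  then have "lookup e v = 0" for v
    using mon_dvd_keysD[OF assms(1), of 0 v] by (simp add: Const_def)
  then show False using assms(2) by (metis lookup_zero poly_mapping_eqI)
qed

text \<open>The sum of the largest exponents and the sum of the smallest exponents of the factors both survive in the
product. If the product has a single term, they coincide, so that each factor has a single term.\<close>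

lemma factor_of_monomial:
  fixes p q :: "('e::{ordered_cancel_comm_monoid_add,linorder}) \<Rightarrow>\<^sub>0 'a::idom"
  assumes pq: "p * q = single t c" and "c \<noteq> 0"
  shows "\<exists>s d. d \<noteq> 0 \<and> p = single s d"
proof -
  let ?P = "keys p" and ?Q = "keys q"
  have "p * q \<noteq> 0" using assms by (metis lookup_single_eq lookup_zero)
  then have ne: "?P \<noteq> {}" "?Q \<noteq> {}" by (auto simp: keys_eq_empty)
  have top: "a' = Max ?P \<and> b' = Max ?Q"
    if "a' \<in> ?P" "b' \<in> ?Q" "a' + b' = Max ?P + Max ?Q" for a' b'
  proof -
    have "a' \<le> Max ?P" "b' \<le> Max ?Q" using that by auto
    then show ?thesis
      using that(3) add_strict_mono[of a' "Max ?P" b' "Max ?Q"] by (auto simp: le_less)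
  qed
  have bottom: "a' = Min ?P \<and> b' = Min ?Q"
    if "a' \<in> ?P" "b' \<in> ?Q" "a' + b' = Min ?P + Min ?Q" for a' b'
  proof -
    have "Min ?P \<le> a'" "Min ?Q \<le> b'" using that by auto
    then show ?thesis
      using that(3) add_strict_mono[of "Min ?P" a' "Min ?Q" b'] by (auto simp: le_less)
  qed
  have in_keys: "Max ?P \<in> ?P" "Max ?Q \<in> ?Q" "Min ?P \<in> ?P" "Min ?Q \<in> ?Q"
    using ne by auto
  have "lookup (p * q) (Max ?P + Max ?Q) \<noteq> 0"
    using lookup_times_extremal[of p q "Max ?P" "Max ?Q"] top in_keys by (simp add: in_keys_iff)
  moreover have "lookup (p * q) (Min ?P + Min ?Q) \<noteq> 0"
    using lookup_times_extremal[of p q "Min ?P" "Min ?Q"] bottom in_keys by (simp add: in_keys_iff)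
  ultimately have "Max ?P + Max ?Q = Min ?P + Min ?Q"
    unfolding pq by (simp add: lookup_single when_def split: if_splits)
  then have "Max ?P = Min ?P"
    using bottom[OF in_keys(1,2)] by blast
  then have "a = Max ?P" if "a \<in> ?P" for a
    using Max_ge[OF finite_keys that] Min_le[OF finite_keys that] by simp
  then have "?P = {Max ?P}"
    using in_keys(1) by blast
  then have "p = single (Max ?P) (lookup p (Max ?P))"
    by (metis sum_single_lookup sum.insert sum.empty finite.emptyI empty_iff add_0_right)
  with in_keys(1) show ?thesis by (metis in_keys_iff)
qed


lemma mon_nonzero [simp]: "mon e \<noteq> (0 :: 'a::comm_ring_1 mpoly)"
  by (metis lookup_single_eq lookup_zero zero_neq_one)

section \<open>The coordinate ring inside a polynomial ring in one variable\<close>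

text \<open>The ambient ring consists of the polynomials in \<open>z\<^sub>1\<close>, written \<open>zz\<close>, over the fraction field of all polynomials
in the letters.\<close>

abbreviation zz :: "'a::comm_ring_1 poly" where
  "zz \<equiv> [:0, 1:]"

abbreviation emb :: "'a::idom mpoly \<Rightarrow> 'a mpoly fract poly" where
  "emb p \<equiv> [:to_fract p:]"

lemma to_fract_power: "to_fract (p ^ i) = to_fract p ^ i"
  by (induction i) simp_all

lemma smult_sum_right: "smult a (sum f I) = (\<Sum>i\<in>I. smult a (f i))"
  by (induction I rule: infinite_finite_induct) (simp_all add: smult_add_right)

text \<open>The image of the coordinate ring, once \<open>x\<close> is the fraction that \<open>x\<^sub>1\<close> is equal to.\<close>

inductive_set generated :: "letter set \<Rightarrow> 'a::idom mpoly fract poly \<Rightarrow> 'a mpoly fract poly set"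
  for V :: "letter set" and x :: "'a::idom mpoly fract poly" where
  Const: "emb (Const c) \<in> generated V x"
| Var: "v \<in> V \<Longrightarrow> emb (Var v) \<in> generated V x"
| zz: "zz \<in> generated V x"
| gen: "x \<in> generated V x"
| add: "f \<in> generated V x \<Longrightarrow> g \<in> generated V x \<Longrightarrow> f + g \<in> generated V x"
| mult: "f \<in> generated V x \<Longrightarrow> g \<in> generated V x \<Longrightarrow> f * g \<in> generated V x"

text \<open>The data of the hypersurface that the algebra depends on: \<open>V\<close> is the set of letters other than \<open>x\<^sub>1, z\<^sub>1\<close>, the
exponents \<open>e1\<close>, \<open>e2\<close> are those of \<open>h\<^sub>1\<close>, \<open>h\<^sub>2\<close>, and \<open>h\<close> is \<open>c\<close> times the monomial with exponent \<open>eh\<close>. The last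
assumption says that every letter of \<open>V\<close> divides \<open>h h\<^sub>1\<close>.\<close>

locale trinomial =
  fixes V :: "letter set" and e1 e2 eh :: "letter \<Rightarrow>\<^sub>0 nat" and l :: nat and c :: "'a::field_char_0"
  assumes finite_V: "finite V"
    and e1_V: "keys e1 \<subseteq> V" and e2_V: "keys e2 \<subseteq> V"
    and eh_V: "keys eh \<subseteq> V"
    and disjoint: "keys e1 \<inter> keys e2 = {}"
    and e1_nonzero: "e1 \<noteq> 0" and l_ge_2: "l \<ge> 2" and c_nonzero: "c \<noteq> 0"
    and V_covered: "V \<subseteq> keys eh \<union> keys e1"
begin

text \<open>The images of \<open>h\<^sub>1\<close>, \<open>h\<^sub>2\<close>, \<open>z\<^sup>l h\<^sub>2 + 1\<close> and \<open>x\<^sub>1\<close>, and the image of the coordinate ring.\<close>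

definition m1 :: "'a mpoly fract" where "m1 = to_fract (mon e1)"
definition m2 :: "'a mpoly fract" where "m2 = to_fract (mon e2)"
definition q :: "'a mpoly fract poly" where "q = smult m2 (zz ^ l) + 1"
definition x1 :: "'a mpoly fract poly" where "x1 = smult (1 / m1) q"
definition Bs :: "'a mpoly fract poly set" where "Bs = generated V x1"
text \<open>This is \<open>h h\<^sub>1\<close>, the value of the derivation at \<open>z\<^sub>1\<close>.\<close>

definition s :: "'a mpoly" where "s = Const c * mon eh * mon e1"
definition der :: "'a mpoly fract poly \<Rightarrow> 'a mpoly fract poly" where
  "der f = smult (to_fract s) (pderiv f)"

lemma m1_nonzero [simp]: "m1 \<noteq> 0" and m2_nonzero [simp]: "m2 \<noteq> 0"
  by (simp_all add: m1_def m2_def)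

lemmas keys_V [simp] = e1_V e2_V eh_V

lemma s_in_Polys: "s \<in> Polys V"
  unfolding s_def by (intro Polys_mult) simp_all

lemma s_nonzero [simp]: "s \<noteq> 0"
  using c_nonzero by (simp add: s_def)

lemma m1_x1: "smult m1 x1 = q"
  by (simp add: x1_def)

lemma emb_m1_x1: "emb (mon e1) * x1 = q"
  using m1_x1 by (simp add: m1_def)

lemma Bs_intros [intro]:
  "x1 \<in> Bs" "zz \<in> Bs" "f \<in> Bs \<Longrightarrow> g \<in> Bs \<Longrightarrow> f + g \<in> Bs" "f \<in> Bs \<Longrightarrow> g \<in> Bs \<Longrightarrow> f * g \<in> Bs"
  by (auto simp: Bs_def intro: generated.intros)

lemma emb_in_Bs [intro]: "p \<in> Polys V \<Longrightarrow> emb p \<in> Bs"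
proof (induction rule: Polys_induct)
  case (add p q)
  then show ?case using Bs_intros(3)[of "emb p" "emb q"] by simp
next
  case (mult p q)
  then show ?case using Bs_intros(4)[of "emb p" "emb q"] by (simp add: mult.commute)
qed (auto simp: Bs_def intro: generated.intros)

lemma Bs_smult [intro]: "p \<in> Polys V \<Longrightarrow> f \<in> Bs \<Longrightarrow> smult (to_fract p) f \<in> Bs"
  using Bs_intros(4)[OF emb_in_Bs, of p f] by simp

lemma Bs_0 [simp]: "0 \<in> Bs" and Bs_1 [simp]: "1 \<in> Bs"
  using emb_in_Bs[of 0] emb_in_Bs[of 1] by (simp_all add: one_pCons)

lemma Bs_uminus [intro]: "f \<in> Bs \<Longrightarrow> - f \<in> Bs"
  using Bs_smult[of "- 1" f] by (auto simp del: to_fract_uminus simp: to_fract_uminus)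

lemma Bs_diff [intro]: "f \<in> Bs \<Longrightarrow> g \<in> Bs \<Longrightarrow> f - g \<in> Bs"
  using Bs_intros(3)[of f "- g"] Bs_uminus by simp

lemma Bs_power [intro]: "f \<in> Bs \<Longrightarrow> f ^ i \<in> Bs"
  by (induction i) auto

lemma Bs_of_nat [simp]: "of_nat i \<in> Bs"
  by (induction i) auto

lemma Bs_sum [intro]: "(\<And>i. i \<in> I \<Longrightarrow> f i \<in> Bs) \<Longrightarrow> sum f I \<in> Bs"
  by (induction I rule: infinite_finite_induct) auto

lemma Bs_induct [consumes 1, case_names emb zz x1 add mult]:
  assumes "f \<in> Bs"
    and "\<And>p. p \<in> Polys V \<Longrightarrow> P (emb p)" "P zz" "P x1"
    and "\<And>f g. f \<in> Bs \<Longrightarrow> g \<in> Bs \<Longrightarrow> P f \<Longrightarrow> P g \<Longrightarrow> P (f + g)"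
    and "\<And>f g. f \<in> Bs \<Longrightarrow> g \<in> Bs \<Longrightarrow> P f \<Longrightarrow> P g \<Longrightarrow> P (f * g)"
  shows "P f"
  using assms(1) unfolding Bs_def
  by (induction rule: generated.induct) (auto intro: assms(2-) simp flip: Bs_def)


subsection \<open>Elements of small degree\<close>

text \<open>The ring \<open>A[z\<^sub>1]\<close>, and below the principal ideal of \<open>A\<close> generated by \<open>h\<^sub>1\<close>.\<close>

definition A_polys :: "'a mpoly fract poly set" where
  "A_polys = {f. \<forall>i. coeff f i \<in> to_fract ` Polys V}"

definition m1A :: "'a mpoly fract set" where
  "m1A = {m1 * to_fract p | p. p \<in> Polys V}"

lemma A_add: "a \<in> to_fract ` Polys V \<Longrightarrow> b \<in> to_fract ` Polys V \<Longrightarrow> a + b \<in> to_fract ` Polys V"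
  by (auto simp flip: to_fract_add)

lemma A_mult: "a \<in> to_fract ` Polys V \<Longrightarrow> b \<in> to_fract ` Polys V \<Longrightarrow> a * b \<in> to_fract ` Polys V"
  by (auto simp flip: to_fract_mult)

lemma A_diff: "a \<in> to_fract ` Polys V \<Longrightarrow> b \<in> to_fract ` Polys V \<Longrightarrow> a - b \<in> to_fract ` Polys V"
  by (auto simp flip: to_fract_diff)

lemma A_01: "(0 :: 'a mpoly fract) \<in> to_fract ` Polys V" "(1 :: 'a mpoly fract) \<in> to_fract ` Polys V"
  using imageI[OF Polys_0[of V], of "to_fract :: 'a mpoly \<Rightarrow> _"]
    imageI[OF Polys_1[of V], of "to_fract :: 'a mpoly \<Rightarrow> _"] by simp_all

lemma A_sum: "(\<And>i. i \<in> I \<Longrightarrow> f i \<in> to_fract ` Polys V) \<Longrightarrow> sum f I \<in> to_fract ` Polys V"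
  by (induction I rule: infinite_finite_induct) (simp_all add: A_add A_01)

lemma A_m12: "m1 \<in> to_fract ` Polys V" "m2 \<in> to_fract ` Polys V"
  by (simp_all add: m1_def m2_def)

lemma A_polys_add: "f \<in> A_polys \<Longrightarrow> g \<in> A_polys \<Longrightarrow> f + g \<in> A_polys"
  by (simp add: A_polys_def A_add)

lemma A_polys_diff: "f \<in> A_polys \<Longrightarrow> g \<in> A_polys \<Longrightarrow> f - g \<in> A_polys"
  by (simp add: A_polys_def A_diff)

lemma A_polys_mult: "f \<in> A_polys \<Longrightarrow> g \<in> A_polys \<Longrightarrow> f * g \<in> A_polys"
  by (auto simp: A_polys_def coeff_mult intro!: A_sum A_mult)

lemma A_polys_emb: "p \<in> Polys V \<Longrightarrow> emb p \<in> A_polys"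
  by (auto simp: A_polys_def coeff_pCons A_01 split: nat.splits)

lemma A_polys_0: "0 \<in> A_polys" and A_polys_1: "1 \<in> A_polys"
  using A_polys_emb[of 0] A_polys_emb[of 1] by (simp_all add: one_pCons)

lemma A_polys_sum: "(\<And>i. i \<in> I \<Longrightarrow> f i \<in> A_polys) \<Longrightarrow> sum f I \<in> A_polys"
  by (induction I rule: infinite_finite_induct) (simp_all add: A_polys_add A_polys_0)

lemma A_polys_power: "f \<in> A_polys \<Longrightarrow> f ^ i \<in> A_polys"
  by (induction i) (simp_all add: A_polys_mult A_polys_1)

lemma A_polys_zz: "zz \<in> A_polys"
  by (auto simp: A_polys_def coeff_pCons A_01 split: nat.splits)

lemma A_polys_smult: "a \<in> to_fract ` Polys V \<Longrightarrow> f \<in> A_polys \<Longrightarrow> smult a f \<in> A_polys"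
  by (auto simp: A_polys_def intro: A_mult)

lemma A_polys_q: "q \<in> A_polys"
  unfolding q_def by (intro A_polys_add A_polys_smult A_polys_power A_polys_zz A_polys_1 A_m12)

lemma m1A_iff: "a \<in> m1A \<longleftrightarrow> (\<exists>b\<in>to_fract ` Polys V. a = m1 * b)"
  by (auto simp: m1A_def)

lemma m1A_0: "0 \<in> m1A"
  unfolding m1A_iff using A_01 by (intro bexI[of _ 0]) simp_all

lemma m1A_diff:
  assumes "a \<in> m1A" "b \<in> m1A"
  shows "a - b \<in> m1A"
proof -
  obtain p r where "p \<in> Polys V" "a = m1 * to_fract p" "r \<in> Polys V" "b = m1 * to_fract r"
    using assms by (auto simp: m1A_def)
  then have "a - b = m1 * to_fract (p - r)" "p - r \<in> Polys V"
    by (auto simp: right_diff_distrib)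
  then show ?thesis unfolding m1A_def by blast
qed

lemma m1A_cancel_m2:
  assumes "a \<in> to_fract ` Polys V" "m2 * a \<in> m1A"
  shows "a \<in> m1A"
proof -
  obtain p r where p: "p \<in> Polys V" "a = to_fract p" and r: "m2 * a = m1 * to_fract r"
    using assms by (auto simp: m1A_iff)
  have "mon e2 * p = mon e1 * r"
    using r unfolding p m1_def m2_def by (simp only: to_fract_eq_iff flip: to_fract_mult)
  then have "mon e1 dvd p"
    using mon_coprime_dvd[OF disjoint, of p] by simp
  then obtain t where t: "p = mon e1 * t" by (rule dvdE)
  then have "t \<in> Polys V" using p(1) mon_times_in_Polys_cancel[of e1 t V] by simp
  then show ?thesis unfolding p t m1A_def by (auto simp: m1_def)
qed

lemma coeff_times_q: "coeff (P * q) (i + l) = m2 * coeff P i + coeff P (i + l)"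
proof -
  have "P * q = smult m2 (monom 1 l * P) + P"
    by (simp add: q_def algebra_simps monom_altdef)
  then show ?thesis
    by (simp add: coeff_monom_mult)
qed

text \<open>The coefficient of \<open>P q\<close> at \<open>i + l\<close> is \<open>h\<^sub>2 P\<^sub>i + P\<^bsub>i+l\<^esub>\<close>. So divisibility by \<open>h\<^sub>1\<close> passes from \<open>P q\<close> to \<open>P\<close>,
from the top coefficient downwards.\<close>

lemma m1A_coeff_of_times_q:
  assumes "P \<in> A_polys" "\<And>i. i \<ge> i0 \<Longrightarrow> coeff (P * q) (i + l) \<in> m1A" "i \<ge> i0"
  shows "coeff P i \<in> m1A"
  using assms(3)
proof (induction "Suc (degree P) - i" arbitrary: i rule: less_induct)
  case less
  show ?case
  proof (cases "i > degree P")
    case True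
    then show ?thesis by (simp add: coeff_eq_0 m1A_0)
  next
    case False
    then have "coeff P (i + l) \<in> m1A"
      using less l_ge_2 by (intro less.hyps) auto
    with assms(2)[OF less.prems] have "m2 * coeff P i \<in> m1A"
      using m1A_diff by (fastforce simp: coeff_times_q)
    then show ?thesis using assms(1) m1A_cancel_m2 by (auto simp: A_polys_def)
  qed
qed

lemma m1A_coeff_of_times_q_power:
  assumes "P \<in> A_polys" "\<And>i. i \<ge> i0 \<Longrightarrow> coeff (P * q ^ d) (i + d * l) \<in> m1A" "i \<ge> i0"
  shows "coeff P i \<in> m1A"
  using assms(2,3)
proof (induction d arbitrary: i)
  case 0
  then show ?case by simp
next
  case (Suc d)
  have "coeff (P * q ^ d) j \<in> m1A" if "j \<ge> i0 + d * l" for j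
  proof (rule m1A_coeff_of_times_q)
    show "P * q ^ d \<in> A_polys" using assms(1) A_polys_q by (intro A_polys_mult A_polys_power)
    show "i0 + d * l \<le> j" by fact
    fix j assume j: "i0 + d * l \<le> j"
    then show "coeff (P * q ^ d * q) (j + l) \<in> m1A"
      using Suc.prems(1)[of "j - d * l"] by (simp add: mult.assoc power_commutes algebra_simps)
  qed
  then show ?case using Suc.IH Suc.prems(2) by simp
qed

text \<open>Elements are polynomials in \<open>x\<^sub>1\<close> with coefficients in \<open>A[z\<^sub>1]\<close>; \<open>Q\<close> collects these coefficients.\<close>

lemma Bs_expansion:
  assumes "f \<in> Bs"
  shows "\<exists>Q. (\<forall>j. coeff Q j \<in> A_polys) \<and> f = poly Q x1"
  using assms
proof (induction rule: Bs_induct)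
  case (emb p)
  then show ?case
    by (intro exI[of _ "[:emb p:]"]) (auto simp: coeff_pCons A_polys_emb A_polys_0 split: nat.splits)
next
  case zz
  show ?case
    by (intro exI[of _ "[:zz:]"]) (auto simp: coeff_pCons A_polys_zz A_polys_0 split: nat.splits)
next
  case x1
  show ?case
    by (intro exI[of _ "[:0, 1:]"]) (auto simp: coeff_pCons A_polys_1 A_polys_0 split: nat.splits)
next
  case (add f g)
  then obtain Q R where "\<forall>j. coeff Q j \<in> A_polys" "f = poly Q x1"
    "\<forall>j. coeff R j \<in> A_polys" "g = poly R x1" by blast
  then show ?case by (intro exI[of _ "Q + R"]) (simp add: A_polys_add)
next
  case (mult f g)
  then obtain Q R where "\<forall>j. coeff Q j \<in> A_polys" "f = poly Q x1"
    "\<forall>j. coeff R j \<in> A_polys" "g = poly R x1" by blast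
  then show ?case
    by (intro exI[of _ "Q * R"]) (auto simp: coeff_mult intro!: A_polys_sum A_polys_mult)
qed

text \<open>Multiplication by \<open>h\<^sub>1\<^sup>d\<close> clears the denominators; modulo \<open>h\<^sub>1\<close> only the leading term in \<open>x\<^sub>1\<close> remains.\<close>

lemma m1_power_poly_x1:
  "smult (m1 ^ degree Q) (poly Q x1) = coeff Q (degree Q) * q ^ degree Q +
    smult m1 (\<Sum>j<degree Q. smult (m1 ^ (degree Q - 1 - j)) (coeff Q j * q ^ j))"
proof -
  let ?d = "degree Q"
  have m1_power: "smult (m1 ^ ?d) (f * x1 ^ j) = smult (m1 ^ (?d - j)) (f * q ^ j)" if "j \<le> ?d" for f j
  proof -
    have "m1 ^ ?d = m1 ^ (?d - j) * m1 ^ j" using that by (simp flip: power_add)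
    moreover have "f * q ^ j = smult (m1 ^ j) (f * x1 ^ j)"
      unfolding m1_x1[symmetric] smult_power by simp
    ultimately show ?thesis by simp
  qed
  have "smult (m1 ^ ?d) (poly Q x1) = (\<Sum>j\<le>?d. smult (m1 ^ ?d) (coeff Q j * x1 ^ j))"
    by (simp only: poly_altdef smult_sum_right)
  also have "\<dots> = (\<Sum>j\<le>?d. smult (m1 ^ (?d - j)) (coeff Q j * q ^ j))"
    by (intro sum.cong refl m1_power) simp
  also have "\<dots> = coeff Q ?d * q ^ ?d + (\<Sum>j<?d. smult (m1 ^ (?d - j)) (coeff Q j * q ^ j))"
    by (simp add: lessThan_Suc_atMost[symmetric])
  also have "(\<Sum>j<?d. smult (m1 ^ (?d - j)) (coeff Q j * q ^ j)) =
      (\<Sum>j<?d. smult m1 (smult (m1 ^ (?d - 1 - j)) (coeff Q j * q ^ j)))"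
    by (intro sum.cong) (simp_all add: Suc_diff_Suc flip: power_Suc)
  finally show ?thesis by (simp only: smult_sum_right)
qed

text \<open>Beyond the degree of the element the left-hand side of \<open>m1_power_poly_x1\<close> vanishes, so that \<open>Q\<^sub>d q\<^sup>d\<close> is zero
modulo \<open>h\<^sub>1\<close> there, and the factors \<open>q\<close> can be dropped.\<close>

lemma leading_coeff_in_m1A:
  assumes "\<And>j. coeff Q j \<in> A_polys" "i + degree Q * l > degree (poly Q x1)"
  shows "coeff (coeff Q (degree Q)) i \<in> m1A"
proof (rule m1A_coeff_of_times_q_power)
  let ?d = "degree Q"
  let ?R = "\<Sum>j<?d. smult (m1 ^ (?d - 1 - j)) (coeff Q j * q ^ j)"
  have zero_sum: "0 = a + b \<Longrightarrow> a = 0 - b" for a b :: "'a mpoly fract"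
    by (simp add: eq_neg_iff_add_eq_0)
  show "coeff Q ?d \<in> A_polys" by fact
  show "i \<le> i" ..
  fix i' assume "i \<le> i'"
  then have "0 = coeff (smult (m1 ^ ?d) (poly Q x1)) (i' + ?d * l)"
    using assms(2) by (simp add: coeff_eq_0)
  also have "\<dots> = coeff (coeff Q ?d * q ^ ?d) (i' + ?d * l) + m1 * coeff ?R (i' + ?d * l)"
    by (simp only: m1_power_poly_x1 coeff_add coeff_smult)
  finally have "coeff (coeff Q ?d * q ^ ?d) (i' + ?d * l) = 0 - m1 * coeff ?R (i' + ?d * l)"
    by (rule zero_sum)
  moreover have "m1 ^ i \<in> to_fract ` Polys V" for i
    by (induction i) (simp_all add: A_01 A_mult A_m12)
  then have "?R \<in> A_polys"
    using assms(1) by (intro A_polys_sum A_polys_smult A_polys_mult A_polys_power A_polys_q)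
  then have "m1 * coeff ?R (i' + ?d * l) \<in> m1A"
    by (auto simp: m1A_iff A_polys_def)
  ultimately show "coeff (coeff Q ?d * q ^ ?d) (i' + ?d * l) \<in> m1A"
    using m1A_diff[OF m1A_0] by (simp only:)
qed

text \<open>The relation \<open>h\<^sub>1 x\<^sub>1 = q\<close> turns a leading coefficient divisible by \<open>h\<^sub>1\<close> into a term of lower degree in \<open>x\<^sub>1\<close>.\<close>

lemma lower_x1_degree:
  assumes Q: "\<And>j. coeff Q j \<in> A_polys" and d: "degree Q > 0"
    and div: "\<And>i. coeff (coeff Q (degree Q)) i \<in> m1A"
  shows "\<exists>R. (\<forall>j. coeff R j \<in> A_polys) \<and> poly R x1 = poly Q x1 \<and> degree R < degree Q"
proof -
  obtain d where d: "degree Q = Suc d" using d by (cases "degree Q") auto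
  define P where "P = smult (1 / m1) (coeff Q (Suc d))"
  have P: "smult m1 P = coeff Q (Suc d)" by (simp add: P_def)
  have P_A_polys: "P \<in> A_polys"
    unfolding A_polys_def
  proof (intro CollectI allI)
    fix i
    obtain b where "b \<in> to_fract ` Polys V" "coeff (coeff Q (Suc d)) i = m1 * b"
      using div[of i] unfolding d m1A_iff by blast
    then show "coeff P i \<in> to_fract ` Polys V" by (simp add: P_def)
  qed
  define R where "R = Q - monom (coeff Q (Suc d)) (Suc d) + monom (P * q) d"
  have "coeff R j \<in> A_polys" for j
    unfolding R_def using Q P_A_polys A_polys_q by (auto intro!: A_polys_add A_polys_diff A_polys_mult A_polys_0)
  moreover have "poly R x1 = poly Q x1"
    by (simp add: R_def poly_monom m1_x1[symmetric] mult.assoc flip: P)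
  moreover have "degree R \<le> d"
    unfolding R_def using d by (intro degree_le) (auto simp: coeff_eq_0)
  ultimately show ?thesis using d by (intro exI[of _ R]) auto
qed

lemma minimal_expansion:
  assumes "f \<in> Bs"
  obtains Q where "\<And>j. coeff Q j \<in> A_polys" "f = poly Q x1"
    "degree Q = 0 \<or> (\<exists>i. coeff (coeff Q (degree Q)) i \<notin> m1A)"
proof -
  let ?E = "\<lambda>Q. (\<forall>j. coeff Q j \<in> A_polys) \<and> f = poly Q x1"
  obtain Q where Q: "?E Q" "\<And>R. ?E R \<Longrightarrow> degree Q \<le> degree R"
    using Bs_expansion[OF assms] exists_least_iff[of "\<lambda>d. \<exists>Q. ?E Q \<and> degree Q = d"]
    by (metis linorder_not_le)
  then have "degree Q = 0 \<or> (\<exists>i. coeff (coeff Q (degree Q)) i \<notin> m1A)"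
    using lower_x1_degree[of Q] by (metis gr0I linorder_not_le)
  with Q(1) show ?thesis using that by blast
qed

text \<open>In an expression of minimal degree \<open>d > 0\<close> in \<open>x\<^sub>1\<close>, all coefficients of the leading coefficient would be divisible
by \<open>h\<^sub>1\<close>, as \<open>d l\<close> exceeds the degree in \<open>z\<^sub>1\<close>. So \<open>x\<^sub>1\<close> does not occur at all.\<close>

lemma Bs_degree_less:
  assumes "f \<in> Bs" "degree f < l"
  shows "f \<in> A_polys"
proof -
  obtain Q where Q: "\<And>j. coeff Q j \<in> A_polys" "f = poly Q x1"
    "degree Q = 0 \<or> (\<exists>i. coeff (coeff Q (degree Q)) i \<notin> m1A)"
    using minimal_expansion[OF assms(1)] by metis
  have "degree Q = 0"
  proof (rule ccontr)
    assume d: "degree Q \<noteq> 0"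
    then have "l \<le> degree Q * l" by simp
    then have "degree (poly Q x1) < i + degree Q * l" for i
      using assms(2) unfolding Q(2) by (metis less_le_trans trans_less_add2)
    then show False using leading_coeff_in_m1A[OF Q(1)] Q(3) d by blast
  qed
  then obtain a where "Q = [:a:]" by (rule degree_eq_zeroE)
  then show ?thesis using Q(1)[of 0] Q(2) by simp
qed

text \<open>The same argument rules out \<open>d \<ge> 2\<close> and leaves, for \<open>d = 1\<close>, only the constant coefficient of the leading
coefficient undivided by \<open>h\<^sub>1\<close>.\<close>

lemma Bs_degree_le:
  assumes "f \<in> Bs" "degree f \<le> l"
  shows "\<exists>p\<in>Polys V. \<exists>r\<in>Polys V. m1 * coeff f l = m1 * to_fract p + m2 * to_fract r"
proof -
  obtain Q where Q: "\<And>j. coeff Q j \<in> A_polys" "f = poly Q x1"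
    "degree Q = 0 \<or> (\<exists>i. coeff (coeff Q (degree Q)) i \<notin> m1A)"
    using minimal_expansion[OF assms(1)] by metis
  have in_m1A: "coeff (coeff Q (degree Q)) i \<in> m1A"
    if "l < i + degree Q * l" for i
    using leading_coeff_in_m1A[OF Q(1)] that assms(2) Q(2) by simp
  have "degree Q \<le> 1"
  proof (rule ccontr)
    assume d: "\<not> degree Q \<le> 1"
    then have "2 * l \<le> degree Q * l" by simp
    then have "l < i + degree Q * l" for i
      using l_ge_2 by linarith
    then show False using in_m1A Q(3) d by auto
  qed
  then have Q_eq: "Q = [:coeff Q 0, coeff Q 1:]"
    by (intro poly_eqI) (auto simp: coeff_pCons coeff_eq_0 split: nat.splits)
  have f: "f = coeff Q 0 + coeff Q 1 * x1"
    unfolding Q(2) by (subst Q_eq) (simp add: mult.commute)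
  have "m1 * coeff f l = m1 * coeff (coeff Q 0) l + coeff (coeff Q 1 * q) (0 + l)"
    unfolding f m1_x1[symmetric] by (simp add: algebra_simps)
  also have "\<dots> = m1 * coeff (coeff Q 0) l +
      (m2 * coeff (coeff Q 1) 0 + coeff (coeff Q 1) l)"
    by (simp only: coeff_times_q) simp
  finally have eq: "m1 * coeff f l = m1 * coeff (coeff Q 0) l +
      (m2 * coeff (coeff Q 1) 0 + coeff (coeff Q 1) l)" .
  have "coeff (coeff Q 1) l \<in> m1A"
  proof (cases "degree Q = 1")
    case True
    then show ?thesis using in_m1A[of l] l_ge_2 by simp
  next
    case False
    then show ?thesis using \<open>degree Q \<le> 1\<close> m1A_0 by (simp add: coeff_eq_0)
  qed
  then obtain b where b: "b \<in> Polys V" "coeff (coeff Q 1) l = m1 * to_fract b"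
    by (auto simp: m1A_def)
  obtain a where a: "a \<in> Polys V" "coeff (coeff Q 0) l = to_fract a"
    using Q(1)[of 0] by (auto simp: A_polys_def)
  obtain r where r: "r \<in> Polys V" "coeff (coeff Q 1) 0 = to_fract r"
    using Q(1)[of 1] by (auto simp: A_polys_def)
  show ?thesis
    using a b r eq by (intro bexI[of _ "a + b"] bexI[of _ r]) (auto simp: algebra_simps)
qed

end


instance fract :: ("{idom,ring_char_0}") field_char_0 ..

section \<open>Derivations and exponentials\<close>

lemma smult_cancel_left: "a \<noteq> 0 \<Longrightarrow> smult a p = smult a r \<longleftrightarrow> p = (r :: 'a::idom poly)"
  by (metis eq_iff_diff_eq_0 smult_diff_right smult_eq_0_iff)

lemma pderiv_funpow_zz_times:
  "(pderiv ^^ Suc i) (zz * f) = zz * (pderiv ^^ Suc i) f + of_nat (Suc i) * (pderiv ^^ i) f"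
proof (induction i)
  case 0
  then show ?case by (simp add: pderiv_mult pderiv_pCons)
next
  case (Suc i)
  have "pderiv (zz :: 'a poly) = 1" by (simp add: pderiv_pCons)
  with Suc show ?case
    by (simp add: pderiv_mult pderiv_add del: mult_pCons_left) (simp add: algebra_simps del: mult_pCons_left mult_pCons_right)
qed

lemma pderiv_funpow_const: "(pderiv ^^ Suc i) [:a:] = 0"
  by (induction i) simp_all

lemma pderiv_funpow_add: "(pderiv ^^ i) (f + g) = (pderiv ^^ i) f + (pderiv ^^ i) g"
  by (induction i) (simp_all add: pderiv_add)

text \<open>Taylor's formula identifies the exponential of \<open>b \<cdot> d/dz\<close> with the translation \<open>z \<mapsto> z + b\<close>.\<close>

lemma Taylor_pcompose:
  fixes f :: "'a::field_char_0 poly"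
  assumes "degree f < N"
  shows "(\<Sum>i<N. smult (b ^ i / fact i) ((pderiv ^^ i) f)) = pcompose f [:b, 1:]"
  using assms
proof (induction f arbitrary: N)
  case 0
  have "(pderiv ^^ i) (0 :: 'a poly) = 0" for i by (induction i) simp_all
  then show ?case by simp
next
  case (pCons a f)
  let ?T = "\<lambda>N. \<Sum>i<N. smult (b ^ i / fact i) ((pderiv ^^ i) f)"
  show ?case
  proof (cases "f = 0")
    case True
    obtain M where N: "N = Suc M" using pCons.prems by (cases N) auto
    show ?thesis
      unfolding N sum.lessThan_Suc_shift using True by (simp add: pderiv_funpow_const del: funpow.simps)
  next
    case False
    obtain M where N: "N = Suc M" using pCons.prems by (cases N) auto
    with False pCons.prems have M: "degree f < M" by simp
    have coeff: "b ^ Suc i / fact (Suc i) * of_nat (Suc i) = b * (b ^ i / fact i)" for i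
      by (simp add: fact_Suc field_simps del: of_nat_Suc)
    have "pCons a f = [:a:] + zz * f" by simp
    then have "(\<Sum>i<N. smult (b ^ i / fact i) ((pderiv ^^ i) (pCons a f))) =
        pCons a f + (\<Sum>i<M. smult (b ^ Suc i / fact (Suc i))
          (zz * (pderiv ^^ Suc i) f + of_nat (Suc i) * (pderiv ^^ i) f))"
      unfolding N sum.lessThan_Suc_shift
      by (simp only: pderiv_funpow_add pderiv_funpow_const pderiv_funpow_zz_times) simp
    also have "(\<Sum>i<M. smult (b ^ Suc i / fact (Suc i))
          (zz * (pderiv ^^ Suc i) f + of_nat (Suc i) * (pderiv ^^ i) f)) =
        (\<Sum>i<M. zz * smult (b ^ Suc i / fact (Suc i)) ((pderiv ^^ Suc i) f) +
          smult b (smult (b ^ i / fact i) ((pderiv ^^ i) f)))"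
    proof (intro sum.cong refl)
      fix i
      have "smult (b ^ Suc i / fact (Suc i)) (of_nat (Suc i) * (pderiv ^^ i) f) =
          smult (b ^ Suc i / fact (Suc i) * of_nat (Suc i)) ((pderiv ^^ i) f)"
        by (simp only: of_nat_poly mult_pCons_left pCons_0_0 add_0_right mult_zero_left smult_smult)
      also have "\<dots> = smult b (smult (b ^ i / fact i) ((pderiv ^^ i) f))"
        by (simp only: coeff smult_smult)
      finally show "smult (b ^ Suc i / fact (Suc i))
          (zz * (pderiv ^^ Suc i) f + of_nat (Suc i) * (pderiv ^^ i) f) =
        zz * smult (b ^ Suc i / fact (Suc i)) ((pderiv ^^ Suc i) f) +
          smult b (smult (b ^ i / fact i) ((pderiv ^^ i) f))"
        by (simp only: smult_add_right mult_smult_right)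
    qed
    also have "\<dots> = zz * (\<Sum>i<M. smult (b ^ Suc i / fact (Suc i)) ((pderiv ^^ Suc i) f)) + smult b (?T M)"
      by (simp only: sum.distrib sum_distrib_left smult_sum_right)
    also have "pCons a f + (zz * (\<Sum>i<M. smult (b ^ Suc i / fact (Suc i)) ((pderiv ^^ Suc i) f)) + smult b (?T M)) =
        [:a:] + zz * ?T N + smult b (?T M)"
      unfolding N sum.lessThan_Suc_shift by (simp add: algebra_simps)
    also have "\<dots> = [:a:] + [:b, 1:] * pcompose f [:b, 1:]"
      using pCons.IH[of N] pCons.IH[of M] M N by simp
    finally show ?thesis by (simp add: pcompose_pCons)
  qed
qed

lemma funpow_smult_pderiv:
  "((\<lambda>f. smult b (pderiv f)) ^^ i) f = smult (b ^ i) ((pderiv ^^ i) f)"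
  by (induction i) (simp_all add: pderiv_smult)

lemma pderiv_funpow_degree:
  fixes f :: "'a::field_char_0 poly"
  shows "degree f < i \<Longrightarrow> (pderiv ^^ i) f = 0"
proof (induction i arbitrary: f)
  case (Suc i)
  show ?case
  proof (cases "degree f = 0")
    case True
    then have "pderiv f = 0" by (simp add: pderiv_eq_0_iff)
    moreover have "(pderiv ^^ i) (0 :: 'a poly) = 0" by (induction i) simp_all
    ultimately show ?thesis by (simp add: funpow_Suc_right del: funpow.simps)
  next
    case False
    then have "(pderiv ^^ i) (pderiv f) = 0"
      using Suc by (intro Suc.IH) (simp add: degree_pderiv)
    then show ?thesis by (simp add: funpow_Suc_right del: funpow.simps)
  qed
qed simp

context trinomial
begin

lemma q_eq: "q = emb (mon e2) * zz ^ l + emb 1"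
  by (simp add: q_def m2_def one_pCons)

text \<open>In the case of \<open>x\<^sub>1\<close> the claim is available for \<open>q = h\<^sub>1 x\<^sub>1\<close>. This suits properties that allow cancelling \<open>h\<^sub>1\<close>, such
as the agreement of two derivations.\<close>

lemma Bs_induct_q [consumes 1, case_names emb zz x1 add mult]:
  assumes "f \<in> Bs"
    and emb: "\<And>p. p \<in> Polys V \<Longrightarrow> P (emb p)" and zz: "P zz" and x1: "P q \<Longrightarrow> P x1"
    and add: "\<And>f g. f \<in> Bs \<Longrightarrow> g \<in> Bs \<Longrightarrow> P f \<Longrightarrow> P g \<Longrightarrow> P (f + g)"
    and mult: "\<And>f g. f \<in> Bs \<Longrightarrow> g \<in> Bs \<Longrightarrow> P f \<Longrightarrow> P g \<Longrightarrow> P (f * g)"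
  shows "P f"
proof -
  have "P (zz ^ i)" for i
  proof (induction i)
    case 0
    show ?case using emb[of 1] by (simp add: one_pCons)
  next
    case (Suc i)
    have "P (zz * zz ^ i)" by (rule mult[OF _ _ zz Suc]) (rule Bs_intros Bs_power)+
    then show ?case by (simp only: power_Suc)
  qed
  then have "P (emb (mon e2) * zz ^ l)"
    by (intro mult emb emb_in_Bs Bs_power Bs_intros) simp_all
  then have "P q"
    unfolding q_eq by (intro add emb emb_in_Bs Bs_power Bs_intros) simp_all
  then have "P x1" by (rule x1)
  with assms(1) emb zz show ?thesis
    by (induction rule: Bs_induct) (auto intro: add mult)
qed

lemma m1_pderiv_x1: "smult m1 (pderiv x1) = pderiv q"
  by (simp flip: pderiv_smult add: m1_x1)

text \<open>The derivation \<open>h\<^sub>1 \<cdot> d/dz\<close> sends \<open>x\<^sub>1\<close> to \<open>dq/dz\<close>, which has no denominator.\<close>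

lemma m1_pderiv_in_Bs: "f \<in> Bs \<Longrightarrow> smult m1 (pderiv f) \<in> Bs"
proof (induction rule: Bs_induct)
  case zz
  have "smult m1 1 \<in> Bs" unfolding m1_def by (intro Bs_smult Bs_1) simp
  then show ?case by (simp add: pderiv_pCons)
next
  case x1
  have "pderiv q = smult m2 (of_nat l * zz ^ (l - 1))"
    by (simp add: q_def pderiv_add pderiv_smult pderiv_power pderiv_pCons of_nat_poly)
  also have "\<dots> \<in> Bs" unfolding m2_def by (intro Bs_smult Bs_intros Bs_power Bs_of_nat) simp
  finally show ?case by (simp add: m1_pderiv_x1)
next
  case (add f g)
  then show ?case by (simp add: pderiv_add smult_add_right Bs_intros)
next
  case (mult f g)
  then have "f * smult m1 (pderiv g) + g * smult m1 (pderiv f) \<in> Bs"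
    by (intro Bs_intros)
  then show ?case by (simp add: pderiv_mult smult_add_right)
qed simp

lemma smult_pderiv_in_Bs:
  assumes "p \<in> Polys V" "f \<in> Bs"
  shows "smult (m1 * to_fract p) (pderiv f) \<in> Bs"
proof -
  have "smult (to_fract p) (smult m1 (pderiv f)) \<in> Bs"
    using assms m1_pderiv_in_Bs by (intro Bs_smult)
  then show ?thesis by (simp add: mult.commute)
qed

lemma der_in_Bs: "f \<in> Bs \<Longrightarrow> der f \<in> Bs"
proof -
  assume "f \<in> Bs"
  moreover have "Const c * mon eh \<in> Polys V" by (intro Polys_mult) simp_all
  moreover have "to_fract s = m1 * to_fract (Const c * mon eh)"
    by (simp add: s_def m1_def mult.commute flip: to_fract_mult)
  ultimately show ?thesis unfolding der_def using smult_pderiv_in_Bs by metis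
qed

lemma der_emb [simp]: "der (emb p) = 0"
  and der_zz: "der zz = emb s"
  and der_add: "der (f + g) = der f + der g"
  and der_mult: "der (f * g) = f * der g + g * der f"
  by (simp_all add: der_def pderiv_pCons pderiv_add pderiv_mult smult_add_right)

lemma der_eq_0_iff: "der f = 0 \<longleftrightarrow> degree f = 0"
  by (simp add: der_def pderiv_eq_0_iff)

lemma Bs_degree_0: "f \<in> Bs \<Longrightarrow> degree f = 0 \<Longrightarrow> \<exists>p\<in>Polys V. f = emb p"
proof -
  assume "f \<in> Bs" and deg: "degree f = 0"
  then have "coeff f 0 \<in> to_fract ` Polys V"
    using Bs_degree_less[of f] l_ge_2 by (simp add: A_polys_def)
  moreover have "f = [:coeff f 0:]"
    using deg by (metis degree_eq_zeroE coeff_pCons_0)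
  ultimately show ?thesis by auto
qed

text \<open>A derivation that kills \<open>A\<close> is determined by its value \<open>w\<close> at \<open>z\<^sub>1\<close> and equals \<open>w \<cdot> d/dz\<close>. If \<open>w\<close> had positive degree,
this operator would never lower the degree of a nonconstant element, which contradicts nilpotency. So \<open>w\<close> is a
constant, and it lies in \<open>A\<close> by \<open>Bs_degree_less\<close>.\<close>

lemma locally_nilpotent_derivation_eq:
  assumes G_Bs: "\<And>f. f \<in> Bs \<Longrightarrow> G f \<in> Bs"
    and G_add: "\<And>f g. f \<in> Bs \<Longrightarrow> g \<in> Bs \<Longrightarrow> G (f + g) = G f + G g"
    and G_mult: "\<And>f g. f \<in> Bs \<Longrightarrow> g \<in> Bs \<Longrightarrow> G (f * g) = G f * g + f * G g"
    and G_emb: "\<And>p. p \<in> Polys V \<Longrightarrow> G (emb p) = 0"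
    and nilpotent: "(G ^^ i) zz = 0"
  shows "\<exists>b\<in>Polys V. \<forall>f\<in>Bs. G f = smult (to_fract b) (pderiv f)"
proof -
  define w where "w = G zz"
  have P: "G f = w * pderiv f" if "f \<in> Bs" for f
    using that
  proof (induction rule: Bs_induct_q)
    case x1
    have "emb (mon e1) * G x1 = G (emb (mon e1) * x1)"
      by (subst G_mult) (auto simp: G_emb)
    also have "\<dots> = w * pderiv q"
      using x1 by (simp only: emb_m1_x1)
    also have "\<dots> = emb (mon e1) * (w * pderiv x1)"
      by (simp flip: m1_pderiv_x1 add: m1_def)
    finally show ?case by (simp add: smult_cancel_left)
  next
    case (add f g)
    then show ?case by (simp add: G_add pderiv_add distrib_left)
  next
    case (mult f g)
    then show ?case by (simp add: G_mult pderiv_mult distrib_left mult.left_commute mult.commute)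
  qed (simp_all add: G_emb w_def pderiv_pCons)
  have "degree w = 0"
  proof (rule ccontr)
    assume w: "degree w \<noteq> 0"
    have step: "degree (w * pderiv f) \<noteq> 0" if "degree f \<noteq> 0" for f
    proof -
      have "pderiv f \<noteq> 0" "w \<noteq> 0" using that w by (auto simp: pderiv_eq_0_iff)
      then show ?thesis using w that by (simp add: degree_mult_eq degree_pderiv)
    qed
    have "(G ^^ i) zz \<in> Bs \<and> degree ((G ^^ i) zz) \<noteq> 0"
    proof (induction i)
      case (Suc i)
      then show ?case using P[of "(G ^^ i) zz"] step[of "(G ^^ i) zz"] G_Bs[of "(G ^^ i) zz"]
        by simp
    qed auto
    then show False using nilpotent by simp
  qed
  moreover have "w \<in> Bs" unfolding w_def by (intro G_Bs Bs_intros)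
  ultimately obtain b where "b \<in> Polys V" "w = emb b" using Bs_degree_0 by blast
  then show ?thesis using P by auto
qed


section \<open>Endomorphisms\<close>

text \<open>Only the values on \<open>Bs\<close> matter, the function being total on the ambient type.\<close>

definition endo :: "('a mpoly fract poly \<Rightarrow> 'a mpoly fract poly) \<Rightarrow> bool" where
  "endo F \<longleftrightarrow> (\<forall>f\<in>Bs. F f \<in> Bs) \<and> (\<forall>f\<in>Bs. \<forall>g\<in>Bs. F (f + g) = F f + F g)
     \<and> (\<forall>f\<in>Bs. \<forall>g\<in>Bs. F (f * g) = F f * F g) \<and> (\<forall>b. F (emb (Const b)) = emb (Const b))"

lemma endo_in_Bs [intro]: "endo F \<Longrightarrow> f \<in> Bs \<Longrightarrow> F f \<in> Bs"
  and endo_add: "endo F \<Longrightarrow> f \<in> Bs \<Longrightarrow> g \<in> Bs \<Longrightarrow> F (f + g) = F f + F g"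
  and endo_mult: "endo F \<Longrightarrow> f \<in> Bs \<Longrightarrow> g \<in> Bs \<Longrightarrow> F (f * g) = F f * F g"
  and endo_Const: "endo F \<Longrightarrow> F (emb (Const b)) = emb (Const b)"
  by (auto simp: endo_def)

lemma endo_0: "endo F \<Longrightarrow> F 0 = 0" and endo_1: "endo F \<Longrightarrow> F 1 = 1"
  using endo_Const[of F 0] endo_Const[of F 1] by (simp_all add: one_pCons)

lemma endo_power: "endo F \<Longrightarrow> f \<in> Bs \<Longrightarrow> F (f ^ i) = F f ^ i"
  by (induction i) (simp_all add: endo_1 endo_mult Bs_power)

lemma endo_emb_add: "endo F \<Longrightarrow> p \<in> Polys V \<Longrightarrow> r \<in> Polys V \<Longrightarrow> F (emb (p + r)) = F (emb p) + F (emb r)"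
  using endo_add[of F "emb p" "emb r"] by (auto simp: emb_in_Bs)

lemma endo_emb_mult: "endo F \<Longrightarrow> p \<in> Polys V \<Longrightarrow> r \<in> Polys V \<Longrightarrow> F (emb (p * r)) = F (emb p) * F (emb r)"
  using endo_mult[of F "emb p" "emb r"] by (auto simp: emb_in_Bs mult.commute)

lemma endo_q: "endo F \<Longrightarrow> F q = F (emb (mon e2)) * F zz ^ l + 1"
proof -
  assume F: "endo F"
  have q: "q = emb (mon e2) * zz ^ l + 1" by (simp add: q_def m2_def)
  have in_Bs: "emb (mon e2) \<in> Bs" "zz ^ l \<in> Bs" "emb (mon e2) * zz ^ l \<in> Bs"
    by (intro Bs_intros Bs_power emb_in_Bs; simp)+
  have "F q = F (emb (mon e2) * zz ^ l) + F 1"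
    unfolding q by (rule endo_add[OF F in_Bs(3) Bs_1])
  also have "F (emb (mon e2) * zz ^ l) = F (emb (mon e2)) * F zz ^ l"
    using endo_mult[OF F in_Bs(1,2)] endo_power[OF F Bs_intros(2)] by (simp only:)
  finally show ?thesis by (simp only: endo_1[OF F])
qed

lemma endo_x1: "endo F \<Longrightarrow> F (emb (mon e1)) * F x1 = F (emb (mon e2)) * F zz ^ l + 1"
  using endo_mult[of F "emb (mon e1)" x1] endo_q[of F] emb_in_Bs[of "mon e1"] Bs_intros(1)
  by (simp only: emb_m1_x1 Polys_mon keys_V)

text \<open>The value at \<open>x\<^sub>1\<close> is determined by the others, because \<open>x\<^sub>1 h\<^sub>1 = z\<^sup>l h\<^sub>2 + 1\<close> in a domain.\<close>

lemma endo_eqI: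
  assumes F: "endo F" and G: "endo G"
    and vars: "\<And>v. v \<in> V \<Longrightarrow> F (emb (Var v)) = G (emb (Var v))" and zz: "F zz = G zz"
    and nonzero: "F (emb (mon e1)) \<noteq> 0"
    and f: "f \<in> Bs"
  shows "F f = G f"
proof -
  have emb: "F (emb p) = G (emb p)" if "p \<in> Polys V" for p
    using that
    by (induction rule: Polys_induct)
       (simp_all add: endo_Const[OF F] endo_Const[OF G] vars endo_emb_add[OF F] endo_emb_add[OF G]
          endo_emb_mult[OF F] endo_emb_mult[OF G] del: to_fract_add to_fract_mult)
  have x1: "F x1 = G x1"
  proof -
    have "F (emb (mon e1)) * F x1 = F (emb (mon e1)) * G x1"
      using endo_x1[OF F] endo_x1[OF G] by (simp only: emb Polys_mon keys_V zz)
    then show ?thesis using nonzero by (simp only: mult_cancel_left simp_thms)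
  qed
  show ?thesis
    using f by (induction rule: Bs_induct)
      (simp_all add: emb x1 zz endo_add[OF F] endo_add[OF G] endo_mult[OF F] endo_mult[OF G])
qed

text \<open>On \<open>A\<close> both sides vanish, and at \<open>z\<^sub>1\<close> they agree by the assumption on \<open>s\<close>. The elements with this property form a
ring, and \<open>x\<^sub>1\<close> belongs to it by cancellation of \<open>h\<^sub>1\<close>.\<close>

lemma endo_commutes_der:
  assumes F: "endo F"
    and A: "\<And>p. p \<in> Polys V \<Longrightarrow> \<exists>r\<in>Polys V. F (emb p) = emb r"
    and s: "F (emb s) = emb (s * \<mu>)" and zz: "F zz = [:g, to_fract \<mu>:]"
    and nonzero: "F (emb (mon e1)) \<noteq> 0"
    and f: "f \<in> Bs"
  shows "F (der f) = der (F f)"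
proof -
  show ?thesis
    using f
  proof (induction rule: Bs_induct_q)
    case (emb p)
    then obtain r where "F (emb p) = emb r" using A by blast
    then show ?case by (simp add: endo_0[OF F])
  next
    case zz
    have "der (F zz) = emb (s * \<mu>)" by (simp add: assms(4) der_def pderiv_pCons)
    then show ?case by (simp only: der_zz s)
  next
    case x1
    obtain r where r: "F (emb (mon e1)) = emb r" using A[of "mon e1"] by auto
    have m1_Bs: "emb (mon e1) \<in> Bs" by (intro emb_in_Bs) simp
    have "emb r * F (der x1) = F (emb (mon e1) * der x1)"
      unfolding r[symmetric] by (rule endo_mult[OF F m1_Bs der_in_Bs[OF Bs_intros(1)], symmetric])
    also have "emb (mon e1) * der x1 = der (emb (mon e1) * x1)"
      by (simp only: der_mult der_emb mult_zero_right add_0_right)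
    also have "F \<dots> = der (F (emb (mon e1) * x1))"
      using x1 by (simp only: emb_m1_x1)
    also have "F (emb (mon e1) * x1) = emb r * F x1"
      unfolding r[symmetric] by (rule endo_mult[OF F m1_Bs Bs_intros(1)])
    also have "der (emb r * F x1) = emb r * der (F x1)"
      by (simp only: der_mult der_emb mult_zero_right add_0_right)
    finally show ?case
      using nonzero r by (simp add: smult_cancel_left)
  next
    case (add f g)
    then show ?case by (simp add: endo_add[OF F] der_add der_in_Bs)
  next
    case (mult f g)
    then show ?case
      by (simp add: endo_add[OF F] endo_mult[OF F] der_mult der_in_Bs Bs_intros)
  qed
qed

end


section \<open>Permuting and rescaling the letters\<close>

text \<open>The exponent that results from renaming the letters by \<open>\<sigma>\<close>.\<close>

definition permute :: "(letter \<Rightarrow> letter) \<Rightarrow> (letter \<Rightarrow>\<^sub>0 nat) \<Rightarrow> (letter \<Rightarrow>\<^sub>0 nat)" where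
  "permute \<sigma> = Poly_Mapping.map_key (Hilbert_Choice.inv \<sigma>)"

text \<open>The factor by which a monomial is multiplied when each letter \<open>v\<close> is rescaled by \<open>lam v\<close>.\<close>

definition weight :: "(letter \<Rightarrow> 'a::comm_ring_1) \<Rightarrow> (letter \<Rightarrow>\<^sub>0 nat) \<Rightarrow> 'a" where
  "weight lam e = (\<Prod>v\<in>keys e. lam v ^ lookup e v)"

lemma weight_1: "(\<And>v. v \<in> keys e \<Longrightarrow> lam v = 1) \<Longrightarrow> weight lam e = 1"
  by (simp add: weight_def)

lemma lookup_permute: "bij \<sigma> \<Longrightarrow> lookup (permute \<sigma> e) v = lookup e (Hilbert_Choice.inv \<sigma> v)"
  by (simp add: permute_def map_key.rep_eq bij_imp_bij_inv bij_is_inj)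

lemma permute_single: "bij \<sigma> \<Longrightarrow> permute \<sigma> (single v i) = single (\<sigma> v) i"
  using map_key_single[of "Hilbert_Choice.inv \<sigma>" "\<sigma> v" i] by (simp add: permute_def bij_imp_bij_inv bij_is_inj)

lemma permute_add: "bij \<sigma> \<Longrightarrow> permute \<sigma> (e + f) = permute \<sigma> e + permute \<sigma> f"
  by (simp add: permute_def map_key_plus bij_imp_bij_inv bij_is_inj)

lemma permute_0: "bij \<sigma> \<Longrightarrow> permute \<sigma> 0 = 0"
  by (simp add: permute_def map_key_zero bij_imp_bij_inv bij_is_inj)

lemma permute_sum: "bij \<sigma> \<Longrightarrow> permute \<sigma> (sum f I) = (\<Sum>i\<in>I. permute \<sigma> (f i))"
  by (induction I rule: infinite_finite_induct) (simp_all add: permute_0 permute_add)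

lemma permute_expansion:
  "bij \<sigma> \<Longrightarrow> permute \<sigma> e = (\<Sum>v\<in>keys e. single (\<sigma> v) (lookup e v))"
  by (subst sum_single_lookup[of e, symmetric]) (simp only: permute_sum permute_single)

lemma evalp_monomial_map_mon:
  assumes "bij \<sigma>"
  shows "evalp Const (\<lambda>v. Const (lam v) * Var (\<sigma> v)) (mon e) = Const (weight lam e) * mon (permute \<sigma> e)"
  by (simp add: subst.evalp_mon weight_def Const_prod Const_power power_mult_distrib prod.distrib Var_power
      permute_expansion[OF assms] mon_sum)

lemma keys_permute:
  assumes "\<sigma> permutes V" "keys e \<subseteq> V"
  shows "keys (permute \<sigma> e) \<subseteq> V"
proof
  fix v assume "v \<in> keys (permute \<sigma> e)"
  then have "Hilbert_Choice.inv \<sigma> v \<in> V"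
    using assms permutes_bij[OF assms(1)] by (auto simp: in_keys_iff lookup_permute)
  then show "v \<in> V" using permutes_in_image[OF permutes_inv[OF assms(1)]] by simp
qed

text \<open>A permutation of \<open>V\<close> preserves the total degree, so that an inequality between the exponents is an equality.\<close>

lemma permute_le_imp_eq:
  assumes perm: "\<sigma> permutes V" and fin: "finite V" and e: "keys e \<subseteq> V"
    and le: "(\<forall>v. lookup (permute \<sigma> e) v \<le> lookup e v) \<or>
      (\<forall>v. lookup e v \<le> lookup (permute \<sigma> e) v)"
  shows "permute \<sigma> e = e"
proof (rule poly_mapping_eqI)
  fix v
  have sums: "(\<Sum>v\<in>V. lookup (permute \<sigma> e) v) = (\<Sum>v\<in>V. lookup e v)"
    using sum.permute[OF permutes_inv[OF perm], of "lookup e"]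
    by (simp add: lookup_permute[OF permutes_bij[OF perm]] comp_def)
  show "lookup (permute \<sigma> e) v = lookup e v"
  proof (cases "v \<in> V")
    case True
    from le show ?thesis
    proof
      assume "\<forall>v. lookup (permute \<sigma> e) v \<le> lookup e v"
      then show ?thesis using sum_mono_inv[OF sums _ True fin] by blast
    next
      assume "\<forall>v. lookup e v \<le> lookup (permute \<sigma> e) v"
      then show ?thesis using sum_mono_inv[OF sums[symmetric] _ True fin] by metis
    qed
  next
    case False
    then show ?thesis using e keys_permute[OF perm e] by (metis in_keys_iff subsetD)
  qed
qed

lemma single_eq_imp:
  assumes "single s x = single t y" "x \<noteq> 0"
  shows "s = t \<and> x = y"
  using arg_cong[OF assms(1), of "\<lambda>p. lookup p s"] assms(2)
  by (simp add: lookup_single when_def split: if_splits)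

text \<open>The factors of the monomial \<open>1\<close> are monomials, and their exponents add up to zero.\<close>

lemma unit_imp_Const:
  fixes p r :: "'a::idom mpoly"
  assumes "p * r = 1"
  shows "\<exists>d. d \<noteq> 0 \<and> p = Const d"
proof -
  have pr: "p * r = single 0 1" using assms by simp
  obtain t d where p: "d \<noteq> 0" "p = single t d"
    using factor_of_monomial[OF pr] by auto
  obtain u b where r: "b \<noteq> 0" "r = single u b"
    using factor_of_monomial[of r p 0 1] pr by (auto simp: mult.commute)
  have "lookup (p * r) (t + u) \<noteq> 0"
    using p r by (simp add: mult_single)
  then have "t + u = 0"
    using assms by (simp add: lookup_one when_def split: if_splits)
  then have "lookup t v = 0" for v
    by (metis add_is_0 lookup_add lookup_zero)
  then have "t = 0" by (intro poly_mapping_eqI) simp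
  with p show ?thesis by (auto simp: Const_def)
qed


section \<open>Automorphisms commuting with the derivation\<close>

text \<open>The inverse \<open>F'\<close> is part of the data since the arguments below apply to it as well.\<close>

locale der_automorphism = trinomial V e1 e2 eh l c
  for V e1 e2 eh l and c :: "'a::field_char_0" +
  fixes F F' :: "'a mpoly fract poly \<Rightarrow> 'a mpoly fract poly"
  assumes F: "endo F" and F': "endo F'"
    and F'_F: "\<And>f. f \<in> Bs \<Longrightarrow> F' (F f) = f" and F_F': "\<And>f. f \<in> Bs \<Longrightarrow> F (F' f) = f"
    and F_der: "\<And>f. f \<in> Bs \<Longrightarrow> F (der f) = der (F f)"
begin

lemma inverse: "der_automorphism V e1 e2 eh l c F' F"
proof unfold_locales
  fix f assume f: "f \<in> Bs"
  then have f': "F' f \<in> Bs" using F' by blast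
  have "F' (der f) = F' (der (F (F' f)))" using f by (simp add: F_F')
  also have "\<dots> = F' (F (der (F' f)))" using f' by (simp add: F_der)
  also have "\<dots> = der (F' f)" using f' by (simp add: F'_F der_in_Bs)
  finally show "F' (der f) = der (F' f)" .
qed (simp_all add: F F' F'_F F_F')

text \<open>The action on the kernel of the derivation. An element that \<open>der\<close> kills has degree zero and so comes from a
polynomial over \<open>V\<close>, which is unique because \<open>emb\<close> is injective.\<close>

definition A :: "'a mpoly \<Rightarrow> 'a mpoly" where
  "A p = (SOME r. r \<in> Polys V \<and> F (emb p) = emb r)"

lemma
  assumes "p \<in> Polys V"
  shows A_in_Polys: "A p \<in> Polys V" and F_emb: "F (emb p) = emb (A p)"
proof -
  have "der (F (emb p)) = 0"
    using F_der[OF emb_in_Bs[OF assms]] endo_0[OF F] by simp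
  then have "\<exists>r. r \<in> Polys V \<and> F (emb p) = emb r"
    using Bs_degree_0[of "F (emb p)"] endo_in_Bs[OF F emb_in_Bs[OF assms]] by (auto simp: der_eq_0_iff)
  from someI_ex[OF this] show "A p \<in> Polys V" "F (emb p) = emb (A p)"
    by (simp_all add: A_def)
qed

lemma A_Const: "A (Const d) = Const d"
  using F_emb[of "Const d"] endo_Const[OF F, of d] by simp

lemma A_add: "p \<in> Polys V \<Longrightarrow> r \<in> Polys V \<Longrightarrow> A (p + r) = A p + A r"
  using endo_emb_add[OF F, of p r] F_emb[of p] F_emb[of r] F_emb[of "p + r"] Polys_add[of p V r]
  by (simp flip: to_fract_add)

lemma A_mult: "p \<in> Polys V \<Longrightarrow> r \<in> Polys V \<Longrightarrow> A (p * r) = A p * A r"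
  using endo_emb_mult[OF F, of p r] F_emb[of p] F_emb[of r] F_emb[of "p * r"] Polys_mult[of p V r]
  by (simp flip: to_fract_mult add: mult.commute)

lemma A_inject:
  assumes "p \<in> Polys V" "r \<in> Polys V" "A p = A r"
  shows "p = r"
proof -
  have "emb p = emb r"
    using F'_F[OF emb_in_Bs[OF assms(1)]] F'_F[OF emb_in_Bs[OF assms(2)]] F_emb[OF assms(1)] F_emb[OF assms(2)] assms(3)
    by simp
  then show ?thesis by simp
qed

text \<open>The derivative of \<open>F zz\<close> has degree zero, since \<open>F zz\<close> is a local slice like \<open>zz\<close>. As \<open>l \<ge> 2\<close>, the coefficients of
this linear polynomial lie in \<open>A\<close>.\<close>

lemma F_zz_linear: "\<exists>g\<in>Polys V. \<exists>u\<in>Polys V. F zz = [:to_fract g, to_fract u:] \<and> A s = s * u"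
proof -
  have zz: "F zz \<in> Bs" using F by blast
  have der_F_zz: "smult (to_fract s) (pderiv (F zz)) = emb (A s)"
  proof -
    have "der (F zz) = F (emb s)"
      unfolding der_zz[symmetric] by (rule F_der[OF Bs_intros(2), symmetric])
    then show ?thesis unfolding F_emb[OF s_in_Polys] der_def[of "F zz"] .
  qed
  then have "degree (smult (to_fract s) (pderiv (F zz))) = 0" by simp
  then have deg: "degree (F zz) \<le> 1" by (simp add: degree_pderiv)
  then have "F zz \<in> A_polys" using Bs_degree_less[OF zz] l_ge_2 by simp
  then obtain g u where g: "g \<in> Polys V" "coeff (F zz) 0 = to_fract g"
    and u: "u \<in> Polys V" "coeff (F zz) 1 = to_fract u"
    unfolding A_polys_def by blast
  have F_zz: "F zz = [:to_fract g, to_fract u:]"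
    using deg g(2) u(2) by (intro poly_eqI) (auto simp: coeff_pCons coeff_eq_0 split: nat.splits)
  have "to_fract (s * u) = to_fract (A s)"
    using der_F_zz unfolding F_zz by (simp add: pderiv_pCons)
  then show ?thesis using g u F_zz by (metis to_fract_eq_iff)
qed

text \<open>The inverse automorphism also multiplies \<open>s\<close> by an element of \<open>A\<close>. Hence the slope \<open>u\<close> is a unit.\<close>

lemma F_zz_unit: "\<exists>g\<in>Polys V. \<exists>d. d \<noteq> 0 \<and> F zz = [:to_fract g, to_fract (Const d):] \<and> A s = s * Const d"
proof -
  interpret inv: der_automorphism V e1 e2 eh l c F' F by (rule inverse)
  obtain g u where u: "g \<in> Polys V" "u \<in> Polys V" "F zz = [:to_fract g, to_fract u:]" "A s = s * u"
    using F_zz_linear by blast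
  obtain u' where u': "u' \<in> Polys V" "inv.A s = s * u'"
    using inv.F_zz_linear by blast
  have "emb (A (s * u')) = F (emb (inv.A s))"
    using u' F_emb s_in_Polys by (metis Polys_mult)
  also have "\<dots> = emb s"
    using inv.F_emb[OF s_in_Polys] F_F'[OF emb_in_Bs[OF s_in_Polys]] by simp
  finally have "A (s * u') = s" by simp
  then have "s * (u * A u') = s * 1"
    using A_mult[OF s_in_Polys u'(1)] u(4) by (simp add: mult.assoc)
  then have "u * A u' = 1" by (simp only: mult_cancel_left s_nonzero) simp
  then obtain d where "d \<noteq> 0" "u = Const d" using unit_imp_Const by blast
  then show ?thesis using u by blast
qed

text \<open>The letter \<open>v\<close> divides the monomial \<open>s\<close>, and \<open>s\<close> is mapped to a scalar multiple of itself; factors of monomials are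
monomials.\<close>

lemma A_Var_monomial:
  assumes v: "v \<in> V"
  shows "\<exists>t d. d \<noteq> 0 \<and> t \<noteq> 0 \<and> A (Var v) = single t d"
proof -
  have "v \<in> keys (eh + e1)"
    using v V_covered by (auto simp: in_keys_iff lookup_add)
  then have e: "single v 1 + (eh + e1 - single v 1) = eh + e1"
    by (intro poly_mapping_eqI) (auto simp: lookup_add lookup_minus lookup_single when_def in_keys_iff)
  define r where "r = (single (eh + e1 - single v 1) c :: 'a mpoly)"
  have s: "s = single (eh + e1) c"
    by (simp add: s_def Const_def mult_single add.assoc)
  have s_eq: "s = Var v * r"
    by (simp only: s r_def Var_def mult_single e mult_1)
  have "r \<in> Polys V"
  proof -
    have "Var v * r \<in> Polys V" using s_in_Polys s_eq by simp
    then show ?thesis using mon_times_in_Polys_cancel[of "single v 1" r V] by (simp add: Var_def)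
  qed
  then have "A (Var v) * A r = A s"
    using v by (simp add: s_eq A_mult)
  moreover obtain d where "d \<noteq> 0" "A s = s * Const d" using F_zz_unit by blast
  ultimately have "A (Var v) * A r = single (eh + e1) (c * d)" "c * d \<noteq> 0"
    using c_nonzero by (simp_all add: s Const_def mult_single)
  then obtain t b where t: "b \<noteq> 0" "A (Var v) = single t b"
    using factor_of_monomial by blast
  have "t \<noteq> 0"
  proof
    assume "t = 0"
    then have "A (Var v) = A (Const b)" using t by (simp add: A_Const) (simp add: Const_def)
    then have "Var v = (Const b :: 'a mpoly)" using v by (elim A_inject[rotated 2]) simp_all
    then have "occurring (Var v :: 'a mpoly) = {}" by simp
    then show False by simp
  qed
  with t show ?thesis by blast
qed

text \<open>Let \<open>w\<close> be a letter of the monomial that \<open>v\<close> is mapped to. The inverse maps this monomial back to \<open>v\<close>, and it maps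
\<open>w\<close> to a monomial different from \<open>1\<close>. So the cofactor of \<open>w\<close> is mapped to a scalar and is a scalar itself.\<close>

lemma A_Var:
  assumes v: "v \<in> V"
  shows "\<exists>w\<in>V. \<exists>d. d \<noteq> 0 \<and> A (Var v) = Const d * Var w"
proof -
  interpret inv: der_automorphism V e1 e2 eh l c F' F by (rule inverse)
  obtain t d where t: "d \<noteq> 0" "t \<noteq> 0" "A (Var v) = single t d"
    using A_Var_monomial[OF v] by blast
  then obtain w where w: "w \<in> keys t" by (metis all_not_in_conv keys_eq_empty)
  have t_V: "keys t \<subseteq> V"
  proof -
    have "single t d \<in> Polys V"
      using A_in_Polys[of "Var v"] v t(3) by (simp only: Polys_Var)
    then show ?thesis using t(1) by (simp add: Polys_def occurring_def)
  qed
  then have w_V: "w \<in> V" using w by blast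
  define r where "r = (single (t - single w 1) d :: 'a mpoly)"
  have t_split: "single w 1 + (t - single w 1) = t"
    using w by (intro poly_mapping_eqI) (auto simp: lookup_add lookup_minus lookup_single when_def in_keys_iff)
  have A_v: "A (Var v) = Var w * r"
    by (simp only: t(3) r_def Var_def[of w] mult_single t_split mult_1)
  have r: "r \<in> Polys V"
    using A_in_Polys[of "Var v"] v A_v mon_times_in_Polys_cancel[of "single w 1" r V]
    by (simp add: Var_def)
  have "emb (inv.A (A (Var v))) = emb (Var v)"
    using inv.F_emb[OF A_in_Polys] F'_F[of "emb (Var v)"] F_emb[of "Var v"] v by (auto simp: emb_in_Bs)
  then have "inv.A (A (Var v)) = Var v"
    by simp
  then have "inv.A (Var w) * inv.A r = Var v"
    using inv.A_mult[of "Var w" r] w_V r by (simp add: A_v)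
  then have prod: "inv.A (Var w) * inv.A r = single (single v 1) 1"
    by (simp add: Var_def)
  obtain a b where a: "b \<noteq> 0" "a \<noteq> 0" "inv.A (Var w) = single a b"
    using inv.A_Var_monomial[OF w_V] by blast
  obtain a' b' where a': "b' \<noteq> 0" "inv.A r = single a' b'"
    using factor_of_monomial[of "inv.A r" "inv.A (Var w)"] prod by (metis mult.commute zero_neq_one)
  have "lookup (inv.A (Var w) * inv.A r) (a + a') \<noteq> 0"
    using a a' by (simp add: mult_single)
  then have sum: "a + a' = single v 1"
    unfolding prod by (simp add: lookup_single when_def split: if_splits)
  have lookups: "lookup a u + lookup a' u = (if u = v then 1 else 0)" for u
    using arg_cong[OF sum, of "\<lambda>p. lookup p u"] by (simp add: lookup_add lookup_single when_def)
  obtain u where "lookup a u \<noteq> 0"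
    using a(2) by (metis lookup_zero poly_mapping_eqI)
  then have "lookup a v = 1" "lookup a' v = 0"
    using lookups[of u] lookups[of v] by (auto split: if_splits)
  then have "lookup a' u = 0" for u
    using lookups[of u] by (cases "u = v") auto
  then have "a' = 0" by (intro poly_mapping_eqI) simp
  then have "inv.A r = inv.A (Const b')"
    using a' by (simp add: inv.A_Const) (simp add: Const_def)
  then have "r = Const b'" using r by (elim inv.A_inject[rotated 2]) simp_all
  then show ?thesis using A_v a'(1) w_V by (auto simp: mult.commute)
qed

lemma A_permutes_letters:
  obtains \<sigma> lam where "\<sigma> permutes V" "\<And>v. v \<in> V \<Longrightarrow> lam v \<noteq> 0"
    "\<And>v. v \<in> V \<Longrightarrow> A (Var v) = Const (lam v) * Var (\<sigma> v)"
proof -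
  obtain w d where w: "\<And>v. v \<in> V \<Longrightarrow> w v \<in> V \<and> d v \<noteq> 0 \<and> A (Var v) = Const (d v) * Var (w v)"
    using A_Var by metis
  define \<sigma> where "\<sigma> v = (if v \<in> V then w v else v)" for v
  have "inj_on \<sigma> V"
  proof (rule inj_onI)
    fix u v assume uv: "u \<in> V" "v \<in> V" "\<sigma> u = \<sigma> v"
    then have "A (Const (d v) * Var u) = A (Const (d u) * Var v)"
      using w by (simp add: A_mult A_Const \<sigma>_def mult.left_commute)
    then have "Const (d v) * Var u = (Const (d u) * Var v :: 'a mpoly)"
      using uv by (elim A_inject[rotated 2]) (auto intro: Polys_mult)
    then have "single (single u 1) (d v) = (single (single v 1) (d u) :: 'a mpoly)"
      by (simp add: Const_def Var_def mult_single)
    then have "keys (single (single u (1::nat)) (d v)) =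
        keys (single (single v (1::nat)) (d u))"
      by simp
    then have "single u (1::nat) = single v 1"
      using w uv by simp
    then have "keys (single u (1::nat)) = keys (single v (1::nat))"
      by (rule arg_cong)
    then show "u = v" by simp
  qed
  moreover have "\<sigma> ` V \<subseteq> V" using w by (auto simp: \<sigma>_def)
  ultimately have "bij_betw \<sigma> V V"
    using endo_inj_surj[OF finite_V] by (simp add: bij_betw_def)
  then have "\<sigma> permutes V"
    by (rule bij_imp_permutes) (simp add: \<sigma>_def)
  then show ?thesis using that[of \<sigma> d] w by (auto simp: \<sigma>_def)
qed


lemma A_mon:
  assumes perm: "\<sigma> permutes V"
    and A_Var: "\<And>v. v \<in> V \<Longrightarrow> A (Var v) = Const (lam v) * Var (\<sigma> v)"
    and e: "keys e \<subseteq> V"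
  shows "A (mon e) = Const (weight lam e) * mon (permute \<sigma> e)"
proof -
  have "A p = evalp Const (\<lambda>v. Const (lam v) * Var (\<sigma> v)) p" if "p \<in> Polys V" for p
    using that by (rule evalp_hom_unique) (simp_all add: A_Const A_Var A_add A_mult subst.coefficient_hom_axioms)
  then show ?thesis
    using e evalp_monomial_map_mon[OF permutes_bij[OF perm]] by simp
qed

lemma weight_nonzero:
  fixes lam :: "letter \<Rightarrow> 'a"
  assumes "\<And>v. v \<in> V \<Longrightarrow> lam v \<noteq> 0" "keys e \<subseteq> V"
  shows "weight lam e \<noteq> 0"
  using assms by (auto simp: weight_def)

text \<open>The coefficient of \<open>F x1\<close> at \<open>z\<^sup>l\<close> is a scalar times \<open>\<sigma> h\<^sub>2 / \<sigma> h\<^sub>1\<close>, and by \<open>Bs_degree_le\<close> it lies in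
\<open>(A h\<^sub>1 + A h\<^sub>2) / h\<^sub>1\<close>. Hence \<open>\<sigma> h\<^sub>1\<close> divides \<open>h\<^sub>1 \<cdot> \<sigma> h\<^sub>2\<close>. It is coprime to \<open>\<sigma> h\<^sub>2\<close>, so it divides \<open>h\<^sub>1\<close> and is equal to
it. After cancellation \<open>\<sigma> h\<^sub>2\<close> lies in the monomial ideal generated by \<open>h\<^sub>1\<close> and \<open>h\<^sub>2\<close>. It is not a multiple of \<open>h\<^sub>1\<close>, so it
is a multiple of \<open>h\<^sub>2\<close> and equal to it.\<close>

lemma permuted_e1_e2:
  assumes perm: "\<sigma> permutes V" and lam: "\<And>v. v \<in> V \<Longrightarrow> lam v \<noteq> 0"
    and A_Var: "\<And>v. v \<in> V \<Longrightarrow> A (Var v) = Const (lam v) * Var (\<sigma> v)"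
    and F_zz: "F zz = [:to_fract g, to_fract (Const d):]" and d: "d \<noteq> 0"
  shows "permute \<sigma> e1 = e1 \<and> permute \<sigma> e2 = e2"
proof -
  let ?n1 = "permute \<sigma> e1" and ?n2 = "permute \<sigma> e2"
  let ?w1 = "weight lam e1" and ?w2 = "weight lam e2"
  let ?y = "F x1"
  have w: "?w1 \<noteq> 0" "?w2 \<noteq> 0" by (rule weight_nonzero[OF lam]; simp)+
  have A_m1: "A (mon e1) = Const ?w1 * mon ?n1" and A_m2: "A (mon e2) = Const ?w2 * mon ?n2"
    using A_mon[OF perm A_Var] by simp_all
  have "F (emb (mon e1)) * ?y = F (emb (mon e2)) * F zz ^ l + 1"
    by (rule endo_x1[OF F])
  then have y: "smult (to_fract (A (mon e1))) ?y = smult (to_fract (A (mon e2))) ([:to_fract g, to_fract (Const d):] ^ l) + 1"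
    by (simp add: F_emb F_zz)
  have A_m1_nonzero: "to_fract (A (mon e1)) \<noteq> 0"
    using w by (simp add: A_m1)
  have "degree ([:to_fract g, to_fract (Const d):] ^ l) \<le> l"
    by (rule order_trans[OF degree_power_le]) simp
  then have "degree (smult (to_fract (A (mon e1))) ?y) \<le> l"
    unfolding y by (intro degree_add_le order_trans[OF degree_smult_le]) auto
  then have deg_y: "degree ?y \<le> l"
    using A_m1_nonzero by simp
  have "coeff (smult (to_fract (A (mon e1))) ?y) l = to_fract (A (mon e2)) * to_fract (Const d) ^ l"
    unfolding y using l_ge_2 by (simp add: coeff_linear_poly_power)
  then have coeff_y: "to_fract (A (mon e1)) * coeff ?y l = to_fract (A (mon e2) * Const d ^ l)"
    by (simp add: to_fract_power)
  obtain p r where pr: "m1 * coeff ?y l = m1 * to_fract p + m2 * to_fract r"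
    using Bs_degree_le[OF endo_in_Bs[OF F Bs_intros(1)] deg_y] by blast
  have "to_fract (A (mon e1)) * (m1 * coeff ?y l) = m1 * to_fract (A (mon e2) * Const d ^ l)"
    using coeff_y by (simp only: mult.left_commute)
  then have "to_fract (A (mon e1)) * (m1 * to_fract p + m2 * to_fract r) = m1 * to_fract (A (mon e2) * Const d ^ l)"
    by (simp only: pr)
  then have "to_fract (A (mon e1) * (mon e1 * p + mon e2 * r)) = to_fract (mon e1 * (A (mon e2) * Const d ^ l))"
    unfolding m1_def m2_def by (simp only: to_fract_mult to_fract_add)
  then have "Const ?w1 * mon ?n1 * (mon e1 * p + mon e2 * r) = mon e1 * (Const ?w2 * mon ?n2 * Const d ^ l)"
    by (simp only: to_fract_eq_iff A_m1 A_m2)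
  also have "\<dots> = single (e1 + ?n2) (?w2 * d ^ l)"
    by (simp only: Const_power[symmetric]) (simp add: Const_def mult_single)
  finally have main: "mon ?n1 * (Const ?w1 * (mon e1 * p + mon e2 * r)) = single (e1 + ?n2) (?w2 * d ^ l)"
    by (simp only: mult.assoc mult.left_commute)
  have coeff_nonzero: "?w2 * d ^ l \<noteq> 0" using w d by simp
  have bij: "bij \<sigma>" using perm by (rule permutes_bij)
  have lookup_le: "lookup ?n1 v \<le> lookup (e1 + ?n2) v" for v
    by (rule mon_dvd_keysD[OF dvdI[OF main[symmetric]]]) (simp add: coeff_nonzero del: mult_eq_0_iff)
  have "lookup ?n1 v = 0 \<or> lookup ?n2 v = 0" for v
    using disjoint by (auto simp: lookup_permute[OF bij] in_keys_iff)
  then have "lookup ?n1 v \<le> lookup e1 v" for v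
    using lookup_le[of v] by (metis add_0_right le0 lookup_add)
  then have n1: "?n1 = e1"
    using permute_le_imp_eq[OF perm finite_V e1_V] by blast
  have "mon e1 * (Const ?w1 * (mon e1 * p + mon e2 * r)) = mon e1 * single ?n2 (?w2 * d ^ l)"
    using main unfolding n1 by (simp add: mult_single)
  then have "Const ?w1 * (mon e1 * p + mon e2 * r) = single ?n2 (?w2 * d ^ l)"
    by (simp only: mult_cancel_left mon_nonzero simp_thms)
  then have "mon e1 * (Const ?w1 * p) + mon e2 * (Const ?w1 * r) = single ?n2 (?w2 * d ^ l)"
    by (simp only: distrib_left mult.left_commute)
  then have "?n2 \<in> keys (mon e1 * (Const ?w1 * p) + mon e2 * (Const ?w1 * r))"
    using coeff_nonzero by simp
  then have "?n2 \<in> keys (mon e1 * (Const ?w1 * p)) \<or> ?n2 \<in> keys (mon e2 * (Const ?w1 * r))"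
    by (simp only: Un_iff[symmetric]) (rule subsetD[OF keys_add])
  moreover have "?n2 \<notin> keys (mon e1 * (Const ?w1 * p))"
  proof
    assume "?n2 \<in> keys (mon e1 * (Const ?w1 * p))"
    then have le: "lookup ?n1 v \<le> lookup ?n2 v" for v
      unfolding n1 by (intro mon_dvd_keysD) auto
    have "lookup ?n1 v = 0" for v
      using le[of v] \<open>lookup ?n1 v = 0 \<or> lookup ?n2 v = 0\<close> by auto
    then have "?n1 = 0" by (intro poly_mapping_eqI) simp
    then show False using n1 e1_nonzero by simp
  qed
  ultimately have "?n2 \<in> keys (mon e2 * (Const ?w1 * r))" by blast
  then have "lookup e2 v \<le> lookup ?n2 v" for v
    by (intro mon_dvd_keysD) auto
  then show ?thesis
    using permute_le_imp_eq[OF perm finite_V e2_V] n1 by blast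
qed

text \<open>Here \<open>y\<close> is \<open>F x1\<close> minus the multiple of \<open>x1\<close> that cancels the coefficient at \<open>z\<^sup>l\<close>. By \<open>Bs_degree_less\<close> its
coefficients lie in \<open>A\<close>. The one at \<open>z\<^sup>l\<^sup>-\<^sup>1\<close> is a scalar times \<open>g h\<^sub>2 / h\<^sub>1\<close>, which gives that \<open>h\<^sub>1\<close> divides \<open>g\<close>. Modulo
\<open>h\<^sub>1\<close> the numerator of the one at \<open>1\<close> is then the scalar \<open>1 - w2 d\<^sup>l\<close>, which has to vanish.\<close>

lemma translation_divisible:
  assumes A_m1: "A (mon e1) = Const w1 * mon e1" and A_m2: "A (mon e2) = Const w2 * mon e2"
    and w: "w1 \<noteq> 0" "w2 \<noteq> 0"
    and F_zz: "F zz = [:to_fract g, to_fract (Const d):]" and d: "d \<noteq> 0" and g: "g \<in> Polys V"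
  shows "w2 * d ^ l = 1 \<and> mon e1 dvd g"
proof -
  let ?K = "to_fract \<circ> Const :: 'a \<Rightarrow> 'a mpoly fract"
  define y where "y = F x1 - smult (?K (w2 * d ^ l / w1)) x1"
  have y_Bs: "y \<in> Bs"
    unfolding y_def comp_def by (intro Bs_diff Bs_smult endo_in_Bs[OF F] Bs_intros) simp
  have Const_cancel: "?K w1 * ?K (w2 * d ^ l / w1) = ?K (w2 * d ^ l)"
    using w by (simp flip: to_fract_mult Const_mult)
  have "F (emb (mon e1)) * F x1 = F (emb (mon e2)) * F zz ^ l + 1"
    by (rule endo_x1[OF F])
  then have F_x1: "smult (?K w1 * m1) (F x1) = smult (?K w2 * m2) ([:to_fract g, ?K d:] ^ l) + 1"
    by (simp add: F_emb F_zz A_m1 A_m2 m1_def m2_def)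
  have "smult (?K w1 * m1) (smult (?K (w2 * d ^ l / w1)) x1) = smult (?K w1 * ?K (w2 * d ^ l / w1)) (smult m1 x1)"
    by (simp add: mult_ac)
  also have "\<dots> = smult (?K (w2 * d ^ l)) q"
    by (simp only: Const_cancel m1_x1)
  finally have y: "smult (?K w1 * m1) y =
      smult (?K w2 * m2) ([:to_fract g, ?K d:] ^ l) + 1 - smult (?K (w2 * d ^ l)) (smult m2 (zz ^ l) + 1)"
    unfolding y_def smult_diff_right F_x1 q_def by simp
  have K_power: "?K (w2 * d ^ l) = ?K w2 * ?K d ^ l"
    by (simp add: Const_mult Const_power to_fract_power)
  have coeff_zz: "coeff (zz ^ l) i = (if i = l then 1 else (0 :: 'a mpoly fract))" for i
    using coeff_monom[of "1 :: 'a mpoly fract" l i] by (simp add: monom_altdef)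
  have coeff_y: "?K w1 * m1 * coeff y i = ?K w2 * m2 * (of_nat (l choose i) * ?K d ^ i * to_fract g ^ (l - i))
      + (if i = 0 then 1 - ?K (w2 * d ^ l) else 0) - (if i = l then ?K (w2 * d ^ l) * m2 else 0)" if "i \<le> l" for i
    using arg_cong[OF y, of "\<lambda>p. coeff p i"] that
    by (cases "i = 0"; cases "i = l") (simp_all add: coeff_linear_poly_power coeff_zz algebra_simps)
  have wm_nonzero: "?K w1 * m1 \<noteq> 0" using w by simp
  have "degree (smult (?K w1 * m1) y) \<le> l"
    unfolding y
    by (intro degree_add_le degree_diff_le order_trans[OF degree_smult_le] order_trans[OF degree_power_le]) auto
  then have "degree y \<le> l" using wm_nonzero by simp
  moreover have "coeff y l = 0"
  proof -
    have "?K w1 * m1 * coeff y l = 0"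
      using coeff_y[of l] l_ge_2 K_power by simp
    then show ?thesis using wm_nonzero by (simp only: mult_eq_0_iff simp_thms)
  qed
  ultimately have "degree y < l"
    using l_ge_2 leading_coeff_neq_0[of y] by (cases "degree y = l") auto
  then have y_A_polys: "y \<in> A_polys" using Bs_degree_less[OF y_Bs] by blast
  have "mon e1 dvd g"
  proof -
    obtain p where p: "p \<in> Polys V" "coeff y (l - 1) = to_fract p"
      using y_A_polys unfolding A_polys_def by blast
    have choose: "l choose (l - 1) = l"
      using binomial_symmetric[of 1 l] l_ge_2 by simp
    have "?K w1 * m1 * to_fract p = ?K w2 * m2 * (of_nat l * ?K d ^ (l - 1) * to_fract g)"
      using coeff_y[of "l - 1"] l_ge_2 unfolding p choose by simp
    moreover have "(of_nat l :: 'a mpoly fract) = ?K (of_nat l)"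
      by (induction l) (simp_all add: Const_add)
    ultimately have "to_fract (mon e1 * (Const w1 * p)) = to_fract (mon e2 * (Const (w2 * of_nat l * d ^ (l - 1)) * g))"
      by (simp add: m1_def m2_def Const_mult Const_power to_fract_power mult_ac)
    then have "mon e1 * (Const w1 * p) = mon e2 * (Const (w2 * of_nat l * d ^ (l - 1)) * g)"
      by (simp only: to_fract_eq_iff)
    then have "mon e1 dvd Const (w2 * of_nat l * d ^ (l - 1)) * g"
      using mon_coprime_dvd[OF disjoint] by (metis dvd_triv_left)
    then have "mon e1 dvd Const (inverse (w2 * of_nat l * d ^ (l - 1))) * (Const (w2 * of_nat l * d ^ (l - 1)) * g)"
      by (rule dvd_mult)
    moreover have "w2 * of_nat l * d ^ (l - 1) \<noteq> 0" using w d l_ge_2 by simp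
    then have "Const (inverse (w2 * of_nat l * d ^ (l - 1))) * Const (w2 * of_nat l * d ^ (l - 1)) = (1 :: 'a mpoly)"
      by (simp only: left_inverse Const_1 simp_thms not_False_eq_True flip: Const_mult)
    ultimately show ?thesis by (simp only: mult_1 flip: mult.assoc)
  qed
  moreover have "w2 * d ^ l = 1"
  proof -
    obtain p where p: "p \<in> Polys V" "coeff y 0 = to_fract p"
      using y_A_polys unfolding A_polys_def by blast
    have "?K w1 * m1 * to_fract p = ?K w2 * m2 * to_fract g ^ l + (1 - ?K (w2 * d ^ l))"
      using coeff_y[of 0] l_ge_2 unfolding p by simp
    then have "to_fract (mon e1 * (Const w1 * p)) = to_fract (Const w2 * mon e2 * g ^ l + Const (1 - w2 * d ^ l))"
      by (simp add: m1_def m2_def Const_diff to_fract_power mult_ac)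
    then have eq: "mon e1 * (Const w1 * p) = Const w2 * mon e2 * g ^ l + Const (1 - w2 * d ^ l)"
      by (simp only: to_fract_eq_iff)
    have "mon e1 dvd Const w2 * mon e2 * g ^ l"
      using \<open>mon e1 dvd g\<close> l_ge_2 by (intro dvd_mult) (simp add: dvd_power_le dvd_trans[OF _ dvd_power])
    moreover have "mon e1 dvd Const w2 * mon e2 * g ^ l + Const (1 - w2 * d ^ l)"
      unfolding eq[symmetric] by simp
    ultimately have "mon e1 dvd (Const (1 - w2 * d ^ l) :: 'a mpoly)"
      by (simp add: dvd_add_right_iff)
    then show ?thesis using mon_dvd_Const e1_nonzero by fastforce
  qed
  ultimately show ?thesis by blast
qed

text \<open>The letters of \<open>A\<close> are permuted and rescaled, \<open>h\<^sub>1\<close>, \<open>h\<^sub>2\<close>, \<open>h\<close> are preserved by the permutation, and the scalars satisfy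
the relations that describe the torus part. That \<open>h\<close> is preserved follows by comparing the two sides of
\<open>A s = s * Const d\<close>.\<close>

theorem classification:
  obtains \<sigma> lam d g where "\<sigma> permutes V" "\<And>v. v \<in> V \<Longrightarrow> lam v \<noteq> 0" "d \<noteq> 0" "g \<in> Polys V"
    "\<And>v. v \<in> V \<Longrightarrow> F (emb (Var v)) = emb (Const (lam v) * Var (\<sigma> v))"
    "F zz = [:to_fract (mon e1 * g), to_fract (Const d):]"
    "permute \<sigma> e1 = e1" "permute \<sigma> e2 = e2" "permute \<sigma> eh = eh"
    "weight lam e2 * d ^ l = 1" "weight lam eh * weight lam e1 = d"
proof -
  obtain \<sigma> lam where perm: "\<sigma> permutes V" and lam: "\<And>v. v \<in> V \<Longrightarrow> lam v \<noteq> 0"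
    and A_Var: "\<And>v. v \<in> V \<Longrightarrow> A (Var v) = Const (lam v) * Var (\<sigma> v)"
    using A_permutes_letters by blast
  obtain g d where g: "g \<in> Polys V" and d: "d \<noteq> 0"
    and F_zz: "F zz = [:to_fract g, to_fract (Const d):]" and A_s: "A s = s * Const d"
    using F_zz_unit by blast
  have e12: "permute \<sigma> e1 = e1" "permute \<sigma> e2 = e2"
    using permuted_e1_e2[OF perm lam A_Var F_zz d] by simp_all
  note A_mon' = A_mon[OF perm A_Var]
  have w: "weight lam e1 \<noteq> 0" "weight lam e2 \<noteq> 0" "weight lam eh \<noteq> 0"
    by (rule weight_nonzero[OF lam]; simp)+
  have A_m12: "A (mon e1) = Const (weight lam e1) * mon e1" "A (mon e2) = Const (weight lam e2) * mon e2"
    using A_mon'[of e1] A_mon'[of e2] e12 by simp_all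
  have td: "weight lam e2 * d ^ l = 1" "mon e1 dvd g"
    using translation_divisible[OF A_m12 w(1,2) F_zz d g] by simp_all
  obtain b where b: "g = mon e1 * b" using td(2) by (rule dvdE)
  have b_Polys: "b \<in> Polys V" using g unfolding b by (rule mon_times_in_Polys_cancel)
  have "A s = Const c * A (mon eh) * A (mon e1)"
    unfolding s_def by (subst A_mult A_Const; auto intro: Polys_mult simp: A_mult A_Const)+
  then have "Const c * (Const (weight lam eh) * mon (permute \<sigma> eh)) * (Const (weight lam e1) * mon e1) = Const c * mon eh * mon e1 * Const d"
    using A_s A_mon'[of eh] A_m12(1) by (simp add: s_def)
  then have "single (permute \<sigma> eh + e1) (c * weight lam eh * weight lam e1) = (single (eh + e1) (c * d) :: 'a mpoly)"
    by (simp add: Const_def mult_single mult_ac add.commute)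
  moreover have "c * weight lam eh * weight lam e1 \<noteq> 0" using w c_nonzero by simp
  ultimately have "permute \<sigma> eh + e1 = eh + e1 \<and> c * weight lam eh * weight lam e1 = c * d"
    by (rule single_eq_imp)
  then have eh: "permute \<sigma> eh = eh" "weight lam eh * weight lam e1 = d"
    using c_nonzero by (simp_all add: mult.assoc)
  have F_Var: "F (emb (Var v)) = emb (Const (lam v) * Var (\<sigma> v))" if "v \<in> V" for v
    using F_emb[of "Var v"] A_Var[OF that] that by simp
  show ?thesis
    using that[OF perm lam d b_Polys F_Var _ e12 eh(1) td(1) eh(2)] F_zz unfolding b by blast
qed

end


section \<open>The equation of the hypersurface\<close>

text \<open>The indices of \<open>x\<^sub>1\<close> and \<open>z\<^sub>1\<close> are kept in the form \<open>1\<close>.\<close>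

declare One_nat_def [simp del]

text \<open>The exponents of the monomials \<open>h\<^sub>1\<close> and \<open>h\<^sub>2\<close>.\<close>

definition expo1 :: "nat \<Rightarrow> nat \<Rightarrow> (nat \<Rightarrow> nat) \<Rightarrow> (letter \<Rightarrow>\<^sub>0 nat)" where
  "expo1 k m a = (\<Sum>i=2..k. single (VX i) 1) + (\<Sum>j=1..m. single (VY j) (a j))"

definition expo2 :: "nat \<Rightarrow> (nat \<Rightarrow> nat) \<Rightarrow> (letter \<Rightarrow>\<^sub>0 nat)" where
  "expo2 n l = (\<Sum>j=2..n. single (VZ j) (l j))"

lemma h1_eq_mon: "h1 k m a = mon (expo1 k m a)"
  by (simp only: h1_def expo1_def mon_add mon_sum finite_atLeastAtMost Var_power) (simp add: Var_def)

lemma h2_eq_mon: "h2 n l = mon (expo2 n l)"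
  by (simp add: h2_def expo2_def mon_sum Var_power)

lemma sum_single_inj:
  "finite I \<Longrightarrow> inj f \<Longrightarrow> lookup (\<Sum>i\<in>I. single (f i) (g i)) (f j) = (if j \<in> I then g j else 0)"
  by (auto simp: lookup_sum lookup_single when_def inj_eq)

lemma sum_single_range:
  "v \<notin> range f \<Longrightarrow> lookup (\<Sum>i\<in>I. single (f i) (g i)) v = 0"
  by (auto simp: lookup_sum lookup_single when_def intro!: sum.neutral)

lemma inj_letter: "inj VX" "inj VY" "inj VZ"
  by (auto intro: injI)

lemma lookup_expo1 [simp]:
  "lookup (expo1 k m a) (VX i) = (if 2 \<le> i \<and> i \<le> k then 1 else 0)"
  "lookup (expo1 k m a) (VY i) = (if 1 \<le> i \<and> i \<le> m then a i else 0)"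
  "lookup (expo1 k m a) (VZ i) = 0"
proof -
  have range: "VX i \<notin> range VY" "VY i \<notin> range VX" "VZ i \<notin> range VX" "VZ i \<notin> range VY" for i by auto
  show "lookup (expo1 k m a) (VX i) = (if 2 \<le> i \<and> i \<le> k then 1 else 0)"
    "lookup (expo1 k m a) (VY i) = (if 1 \<le> i \<and> i \<le> m then a i else 0)"
    "lookup (expo1 k m a) (VZ i) = 0"
    unfolding expo1_def lookup_add
    using sum_single_inj[where I = "{2..k}" and f = VX and g = "\<lambda>_. 1" and j = i, OF finite_atLeastAtMost inj_letter(1)]
      sum_single_inj[where I = "{1..m}" and f = VY and g = a and j = i, OF finite_atLeastAtMost inj_letter(2)]
    by (simp_all only: sum_single_range[OF range(1)] sum_single_range[OF range(2)] sum_single_range[OF range(3)]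
      sum_single_range[OF range(4)] atLeastAtMost_iff add_0_left add_0_right)
qed

lemma lookup_expo2 [simp]:
  "lookup (expo2 n l) (VX i) = 0"
  "lookup (expo2 n l) (VY i) = 0"
  "lookup (expo2 n l) (VZ i) = (if 2 \<le> i \<and> i \<le> n then l i else 0)"
proof -
  have range: "VX i \<notin> range VZ" "VY i \<notin> range VZ" for i by auto
  show "lookup (expo2 n l) (VX i) = 0" "lookup (expo2 n l) (VY i) = 0"
    "lookup (expo2 n l) (VZ i) = (if 2 \<le> i \<and> i \<le> n then l i else 0)"
    unfolding expo2_def
    using sum_single_inj[where I = "{2..n}" and f = VZ and g = l and j = i, OF finite_atLeastAtMost inj_letter(3)]
    by (simp_all only: sum_single_range[OF range(1)] sum_single_range[OF range(2)] atLeastAtMost_iff)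
qed

lemma keys_expo1_subset: "keys (expo1 k m a) \<subseteq> letters' k m n"
proof
  fix v assume "v \<in> keys (expo1 k m a)"
  then show "v \<in> letters' k m n"
    by (cases v) (auto simp: in_keys_iff letters'_def split: if_splits)
qed

lemma keys_expo2_subset: "keys (expo2 n l) \<subseteq> letters' k m n"
proof
  fix v assume "v \<in> keys (expo2 n l)"
  then show "v \<in> letters' k m n"
    by (cases v) (auto simp: in_keys_iff letters'_def split: if_splits)
qed

lemma keys_expo_disjoint: "keys (expo1 k m a) \<inter> keys (expo2 n l) = {}"
proof (rule equals0I)
  fix v assume "v \<in> keys (expo1 k m a) \<inter> keys (expo2 n l)"
  then show False by (cases v) (auto simp: in_keys_iff)
qed

locale hypersurface =
  fixes k m n :: nat and a l :: "nat \<Rightarrow> nat" and c :: "'a::field_char_0" and eh :: "letter \<Rightarrow>\<^sub>0 nat"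
  assumes k_ge_2: "k \<ge> 2" and n_ge_2: "n \<ge> 2"
    and a_gt_1: "\<And>i. i \<in> {1..m} \<Longrightarrow> a i > 1" and l_gt_1: "\<And>j. j \<in> {1..n} \<Longrightarrow> l j > 1"
    and c_nonzero: "c \<noteq> 0" and keys_eh: "keys eh \<subseteq> letters' k m n"
    and VZ_in_eh: "\<And>j. j \<in> {2..n} \<Longrightarrow> VZ j \<in> keys eh"

sublocale hypersurface \<subseteq> trinomial "letters' k m n" "expo1 k m a" "expo2 n l" eh "l 1" c
proof unfold_locales
  show "finite (letters' k m n)" by (simp add: letters'_def)
  show "keys (expo1 k m a) \<subseteq> letters' k m n" by (rule keys_expo1_subset)
  show "keys (expo2 n l) \<subseteq> letters' k m n" by (rule keys_expo2_subset)
  show "keys eh \<subseteq> letters' k m n" by (rule keys_eh)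
  show "keys (expo1 k m a) \<inter> keys (expo2 n l) = {}" by (rule keys_expo_disjoint)
  have "lookup (expo1 k m a) (VX 2) = 1" using k_ge_2 by simp
  then show "expo1 k m a \<noteq> 0" by (metis lookup_zero zero_neq_one)
  show "2 \<le> l 1" using l_gt_1[of 1] n_ge_2 by simp
  show "c \<noteq> 0" by (rule c_nonzero)
  show "letters' k m n \<subseteq> keys eh \<union> keys (expo1 k m a)"
  proof
    fix v assume "v \<in> letters' k m n"
    then consider i where "v = VX i" "i \<in> {2..k}" | i where "v = VY i" "i \<in> {1..m}" | i where "v = VZ i" "i \<in> {2..n}"
      by (auto simp: letters'_def)
    then show "v \<in> keys eh \<union> keys (expo1 k m a)"
    proof cases
      case 1
      then show ?thesis by (simp add: in_keys_iff)
    next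
      case 2
      then show ?thesis using a_gt_1[of i] by (simp add: in_keys_iff)
    next
      case 3
      then show ?thesis using VZ_in_eh by simp
    qed
  qed
qed

context hypersurface
begin

abbreviation V :: "letter set" where "V \<equiv> letters' k m n"
abbreviation V0 :: "letter set" where "V0 \<equiv> letters k m n"
abbreviation e1 where "e1 \<equiv> expo1 k m a"
abbreviation e2 where "e2 \<equiv> expo2 n l"
abbreviation eq :: "'a mpoly" where "eq \<equiv> equation k m n a l"
abbreviation P :: "'a mpoly ring" where "P \<equiv> poly_ring V0"
abbreviation I :: "'a mpoly set" where "I \<equiv> eq_ideal k m n a l"
abbreviation B :: "'a mpoly set ring" where "B \<equiv> coord_ring k m n a l"
abbreviation \<pi> :: "'a mpoly \<Rightarrow> 'a mpoly set" where "\<pi> \<equiv> cls k m n a l"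
abbreviation \<eta> :: "'a \<Rightarrow> 'a mpoly set" where "\<eta> \<equiv> scalar k m n a l"

lemma V0_eq: "V0 = insert (VX 1) (insert (VZ 1) V)"
proof -
  have "{1..k} = insert 1 {2..k}" "{1..n} = insert 1 {2..n}" using k_ge_2 n_ge_2 by auto
  then show ?thesis by (auto simp: letters_def letters'_def)
qed

lemma VX1_VZ1 [simp]: "VX 1 \<notin> V" "VZ 1 \<notin> V" "VX 1 \<in> V0" "VZ 1 \<in> V0"
  by (auto simp: letters'_def V0_eq)

lemma V_subset_V0: "V \<subseteq> V0" by (auto simp: V0_eq)

lemma finite_V0: "finite V0" by (simp add: V0_eq finite_V)

lemma Polys_V_V0: "p \<in> Polys V \<Longrightarrow> p \<in> Polys V0"
  using V_subset_V0 by (rule Polys_mono)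

lemma eq_eq: "eq = Var (VX 1) * mon e1 - (Var (VZ 1) ^ l 1 * mon e2 + 1)"
proof -
  have "{1..k} = insert 1 {2..k}" "{1..n} = insert 1 {2..n}" using k_ge_2 n_ge_2 by auto
  then show ?thesis
    by (simp add: equation_def h1_def h2_def mult.assoc flip: h1_eq_mon h2_eq_mon)
qed

lemma mon_in_Polys_V0: "mon e1 \<in> Polys V0" "mon e2 \<in> Polys V0"
  using subset_trans[OF keys_V(1) V_subset_V0] subset_trans[OF keys_V(2) V_subset_V0] by simp_all

lemma eq_in_Polys: "eq \<in> Polys V0"
  unfolding eq_eq
  by (intro Polys_diff Polys_add Polys_mult Polys_power Polys_1 mon_in_Polys_V0) simp_all

text \<open>Solving the equation for \<open>x\<^sub>1\<close> defines the evaluation into the polynomials in \<open>z\<^sub>1\<close>.\<close>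

definition gen :: "letter \<Rightarrow> 'a mpoly fract poly" where
  "gen v = (if v = VX 1 then x1 else if v = VZ 1 then zz else emb (Var v))"

definition ev :: "'a mpoly \<Rightarrow> 'a mpoly fract poly" where
  "ev = evalp (\<lambda>b. emb (Const b)) gen"

lemma coefficient_hom_emb: "coefficient_hom (\<lambda>b :: 'a. emb (Const b))"
  by unfold_locales (simp_all add: Const_add Const_mult one_pCons mult.commute)

sublocale ev: coefficient_hom "\<lambda>b :: 'a. emb (Const b)"
  by (rule coefficient_hom_emb)

lemmas ev_simps = ev.evalp_add[of gen, folded ev_def] ev.evalp_mult[of gen, folded ev_def]
  ev.evalp_diff[of gen, folded ev_def] ev.evalp_uminus[of gen, folded ev_def] ev.evalp_power[of gen, folded ev_def]
  ev.evalp_0[of gen, folded ev_def] ev.evalp_1[of gen, folded ev_def] ev.evalp_Const[of gen, folded ev_def]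

lemma ev_Var: "ev (Var (VX 1)) = x1" "ev (Var (VZ 1)) = zz" "v \<in> V \<Longrightarrow> ev (Var v) = emb (Var v)"
  using VX1_VZ1 by (auto simp: ev_def gen_def)


lemma ev_emb: "p \<in> Polys V \<Longrightarrow> ev p = emb p"
  by (induction rule: Polys_induct) (simp_all add: ev_simps ev_Var mult.commute)

lemma ev_eq: "ev eq = 0"
  using emb_m1_x1 by (simp add: eq_eq ev_simps ev_Var ev_emb q_def m2_def mult.commute)

lemma ev_in_Bs: "p \<in> Polys V0 \<Longrightarrow> ev p \<in> Bs"
proof (induction rule: Polys_induct)
  case (Var v)
  then consider "v = VX 1" | "v = VZ 1" | "v \<in> V" by (auto simp: V0_eq)
  then show ?case
  proof cases
    case 3
    then show ?thesis using emb_in_Bs[of "Var v"] by (simp add: ev_Var)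
  qed (simp_all add: ev_Var Bs_intros)
qed (auto simp: ev_simps intro: Bs_intros emb_in_Bs)

lemma Bs_in_ev: "f \<in> Bs \<Longrightarrow> \<exists>p\<in>Polys V0. f = ev p"
proof (induction rule: Bs_induct)
  case (emb p)
  then show ?case using ev_emb Polys_V_V0 by metis
next
  case zz
  show ?case by (rule bexI[of _ "Var (VZ 1)"]) (simp_all add: ev_Var)
next
  case x1
  show ?case by (rule bexI[of _ "Var (VX 1)"]) (simp_all add: ev_Var)
next
  case (add f g)
  then obtain p r where "p \<in> Polys V0" "f = ev p" "r \<in> Polys V0" "g = ev r" by blast
  then show ?case by (intro bexI[of _ "p + r"]) (auto simp: ev_simps)
next
  case (mult f g)
  then obtain p r where "p \<in> Polys V0" "f = ev p" "r \<in> Polys V0" "g = ev r" by blast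
  then show ?case by (intro bexI[of _ "p * r"]) (auto simp: ev_simps)
qed


subsection \<open>The kernel of the evaluation\<close>

lemma ev_poly_in_z:
  "p \<in> Polys (insert (VZ 1) V) \<Longrightarrow> \<exists>Q. p = poly Q (Var (VZ 1)) \<and> ev p = map_poly to_fract Q"
proof (induction rule: Polys_induct)
  case (Const b)
  show ?case by (rule exI[of _ "[:Const b:]"]) (simp add: ev_simps map_poly_pCons)
next
  case (Var v)
  show ?case
  proof (cases "v = VZ 1")
    case True
    then show ?thesis by (intro exI[of _ "[:0, 1:]"]) (simp add: ev_Var map_poly_pCons)
  next
    case False
    then show ?thesis using Var by (intro exI[of _ "[:Var v:]"]) (auto simp: ev_Var map_poly_pCons)
  qed
next
  case (add p r)
  then obtain Q R where "p = poly Q (Var (VZ 1))" "ev p = map_poly to_fract Q"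
    "r = poly R (Var (VZ 1))" "ev r = map_poly to_fract R" by blast
  then show ?case by (intro exI[of _ "Q + R"]) (simp add: ev_simps)
next
  case (mult p r)
  then obtain Q R where "p = poly Q (Var (VZ 1))" "ev p = map_poly to_fract Q"
    "r = poly R (Var (VZ 1))" "ev r = map_poly to_fract R" by blast
  then show ?case by (intro exI[of _ "Q * R"]) (simp add: ev_simps)
qed

lemma ev_injective_without_x1:
  assumes "p \<in> Polys (insert (VZ 1) V)" "ev p = 0"
  shows "p = 0"
  using ev_poly_in_z[OF assms(1)] assms(2) by auto

text \<open>Modulo the equation, each occurrence of \<open>x\<^sub>1\<close> can be traded for a factor \<open>h\<^sub>1\<close>.\<close>

lemma pseudo_division:
  "p \<in> Polys V0 \<Longrightarrow> \<exists>N r d. r \<in> Polys (insert (VZ 1) V) \<and> d \<in> Polys V0 \<and> mon e1 ^ N * p = r + d * eq"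
proof (induction rule: Polys_induct)
  case (Const b)
  show ?case by (rule exI[of _ 0], rule exI[of _ "Const b"], rule exI[of _ 0]) simp
next
  case (Var v)
  show ?case
  proof (cases "v = VX 1")
    case True
    have "mon e2 \<in> Polys (insert (VZ 1) V)" using keys_V(2) by (simp add: subset_insertI2)
    then have "Var (VZ 1) ^ l 1 * mon e2 + 1 \<in> Polys (insert (VZ 1) V)"
      by (intro Polys_add Polys_mult Polys_power) auto
    then show ?thesis
      using True by (intro exI[of _ 1] exI[of _ "Var (VZ 1) ^ l 1 * mon e2 + 1"]) (auto simp: eq_eq mult.commute intro!: exI[of _ 1])
  next
    case False
    then have "Var v \<in> Polys (insert (VZ 1) V)" using Var by (auto simp: V0_eq)
    then show ?thesis by (intro exI[of _ 0] exI[of _ "Var v"] exI[of _ 0]) simp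
  qed
next
  case (add p p')
  then obtain N r d N' r' d' where
    "r \<in> Polys (insert (VZ 1) V)" "d \<in> Polys V0" "mon e1 ^ N * p = r + d * eq"
    "r' \<in> Polys (insert (VZ 1) V)" "d' \<in> Polys V0" "mon e1 ^ N' * p' = r' + d' * eq" by blast
  note * = this
  have m: "mon e1 ^ i \<in> Polys W" if "V \<subseteq> W" for i W
    using subset_trans[OF keys_V(1) that] by (intro Polys_power) simp
  have "mon e1 ^ (N + N') * (p + p') = mon e1 ^ N' * (mon e1 ^ N * p) + mon e1 ^ N * (mon e1 ^ N' * p')"
    by (simp add: power_add algebra_simps)
  also have "\<dots> = (mon e1 ^ N' * r + mon e1 ^ N * r') + (mon e1 ^ N' * d + mon e1 ^ N * d') * eq"
    unfolding * by (simp add: algebra_simps)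
  finally show ?case
    using * m[of "insert (VZ 1) V", OF subset_insertI] m[OF V_subset_V0]
    by (intro exI[of _ "N + N'"] exI[of _ "mon e1 ^ N' * r + mon e1 ^ N * r'"]
        exI[of _ "mon e1 ^ N' * d + mon e1 ^ N * d'"] conjI Polys_add Polys_mult)
next
  case (mult p p')
  then obtain N r d N' r' d' where
    "r \<in> Polys (insert (VZ 1) V)" "d \<in> Polys V0" "mon e1 ^ N * p = r + d * eq"
    "r' \<in> Polys (insert (VZ 1) V)" "d' \<in> Polys V0" "mon e1 ^ N' * p' = r' + d' * eq" by blast
  note * = this
  have r0: "r \<in> Polys V0" "r' \<in> Polys V0"
    using *(1,4) Polys_mono[of "insert (VZ 1) V" V0] by (auto simp: V0_eq)
  have "mon e1 ^ (N + N') * (p * p') = (mon e1 ^ N * p) * (mon e1 ^ N' * p')"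
    by (simp add: power_add algebra_simps)
  also have "\<dots> = r * r' + (r * d' + d * r' + d * d' * eq) * eq"
    unfolding * by (simp add: algebra_simps)
  finally show ?case
    using * r0 eq_in_Polys
    by (intro exI[of _ "N + N'"] exI[of _ "r * r'"]
        exI[of _ "r * d' + d * r' + d * d' * eq"] conjI Polys_add Polys_mult)
qed

text \<open>Separating the terms with and without the letter \<open>w\<close> replaces computations modulo \<open>w\<close>.\<close>

lemma Var_decomposition:
  "p \<in> Polys W \<Longrightarrow> \<exists>p0 p1. p0 \<in> Polys (W - {w}) \<and> p1 \<in> Polys W \<and> p = p0 + Var w * p1"
proof (induction rule: Polys_induct)
  case (Const b)
  show ?case by (rule exI[of _ "Const b"], rule exI[of _ 0]) simp
next
  case (Var v)
  show ?case
  proof (cases "v = w")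
    case True
    then show ?thesis by (intro exI[of _ 0] exI[of _ 1]) simp
  next
    case False
    then show ?thesis using Var by (intro exI[of _ "Var v"] exI[of _ 0]) simp
  qed
next
  case (add p r)
  then obtain p0 p1 r0 r1 where *: "p0 \<in> Polys (W - {w})" "p1 \<in> Polys W" "p = p0 + Var w * p1"
    "r0 \<in> Polys (W - {w})" "r1 \<in> Polys W" "r = r0 + Var w * r1" by blast
  then have "p + r = (p0 + r0) + Var w * (p1 + r1)" by (simp add: algebra_simps)
  then show ?case using * by (intro exI[of _ "p0 + r0"] exI[of _ "p1 + r1"] conjI Polys_add)
next
  case (mult p r)
  then obtain p0 p1 r0 r1 where *: "p0 \<in> Polys (W - {w})" "p1 \<in> Polys W" "p = p0 + Var w * p1"
    "r0 \<in> Polys (W - {w})" "r1 \<in> Polys W" "r = r0 + Var w * r1" by blast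
  then have "p * r = (p0 * r0) + Var w * (p1 * r + p0 * r1)" by (simp add: algebra_simps)
  moreover have "p0 \<in> Polys W" using * Polys_mono[of "W - {w}" W] by blast
  ultimately show ?case using * mult.hyps
    by (intro exI[of _ "p0 * r0"] exI[of _ "p1 * r + p0 * r1"] conjI Polys_add Polys_mult)
qed

lemma Var_times_not_occurring:
  assumes "Var w * p \<in> Polys (W - {w})"
  shows "p = (0 :: 'a mpoly)"
proof (rule ccontr)
  assume "p \<noteq> 0"
  then obtain t where "t \<in> keys p" by (metis all_not_in_conv keys_eq_empty)
  then have "single w 1 + t \<in> keys (Var w * p)"
    by (simp add: Var_def keys_single_times)
  moreover have "w \<in> keys (single w 1 + t)"
    by (simp add: in_keys_iff lookup_add)
  ultimately show False using assms by (auto simp: Polys_def occurring_def)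
qed

text \<open>The element \<open>y\<close> is no zero divisor modulo the equation.\<close>

definition cancellable :: "'a mpoly \<Rightarrow> bool" where
  "cancellable y \<longleftrightarrow> (\<forall>p. \<forall>r\<in>Polys V0. y * p = r * eq \<longrightarrow> (\<exists>r'\<in>Polys V0. p = r' * eq))"

lemma cancellable_1: "cancellable 1"
  by (auto simp: cancellable_def)

lemma cancellable_mult: "cancellable y \<Longrightarrow> cancellable y' \<Longrightarrow> cancellable (y * y')"
  unfolding cancellable_def mult.assoc by blast

lemma cancellable_power: "cancellable y \<Longrightarrow> cancellable (y ^ i)"
  by (induction i) (simp_all add: cancellable_1 cancellable_mult)

text \<open>Write \<open>r = r0 + w r1\<close>. The equation is \<open>- (z\<^sup>l h\<^sub>2 + 1)\<close> plus a multiple of \<open>w\<close>, so that \<open>r0 (z\<^sup>l h\<^sub>2 + 1)\<close> is a multiple of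
\<open>w\<close>. But \<open>w\<close> does not occur in it, so it is zero and \<open>r = w r1\<close>.\<close>

lemma cancellable_Var:
  assumes w: "w \<in> keys e1"
  shows "cancellable (Var w)"
  unfolding cancellable_def
proof (intro allI ballI impI)
  fix p r assume r: "r \<in> Polys V0" and p: "Var w * p = r * eq"
  have w_V: "w \<in> V" using w keys_V(1) by blast
  have w_e2: "w \<notin> keys e2" using w disjoint by blast
  obtain r0 r1 where r01: "r0 \<in> Polys (V0 - {w})" "r1 \<in> Polys V0" "r = r0 + Var w * r1"
    using Var_decomposition[OF r] by blast
  let ?u = "Var (VZ 1) ^ l 1 * mon e2 + 1 :: 'a mpoly"
  have "single w 1 + (e1 - single w 1) = e1"
    using w by (intro poly_mapping_eqI) (auto simp: lookup_add lookup_minus lookup_single when_def in_keys_iff)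
  then have "Var w * mon (e1 - single w 1) = (mon e1 :: 'a mpoly)"
    by (simp add: Var_def mult_single)
  then have eq_w: "eq = Var w * (Var (VX 1) * mon (e1 - single w 1)) - ?u"
    unfolding eq_eq by (simp add: mult.left_commute)
  have "r0 * ?u = Var w * (r0 * (Var (VX 1) * mon (e1 - single w 1)) + r1 * eq - p)"
  proof -
    have "Var w * p = r0 * eq + Var w * (r1 * eq)"
      unfolding p r01(3) by (simp add: algebra_simps)
    also have "r0 * eq = Var w * (r0 * (Var (VX 1) * mon (e1 - single w 1))) - r0 * ?u"
      unfolding eq_w by (simp add: algebra_simps)
    finally show ?thesis by (simp add: algebra_simps)
  qed
  moreover have "r0 * ?u \<in> Polys (V0 - {w})"
  proof -
    have "mon e2 \<in> Polys (V0 - {w})"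
      using w_e2 subset_trans[OF keys_V(2) V_subset_V0] by (simp add: subset_Diff_insert)
    moreover have "Var (VZ 1) \<in> Polys (V0 - {w})" using w_V by auto
    ultimately show ?thesis using r01(1) by (intro Polys_mult Polys_add Polys_power Polys_1)
  qed
  ultimately have "r0 * ?u = 0"
    using Var_times_not_occurring by (metis mult_zero_right)
  moreover have "?u \<noteq> 0"
  proof
    assume "?u = 0"
    then have "coeff (ev ?u) 0 = 0" by (simp only: ev_simps) simp
    then show False
      using l_ge_2 by (simp add: ev_simps ev_Var ev_emb coeff_0_power zero_power)
  qed
  ultimately have "r0 = 0" by (simp only: mult_eq_0_iff simp_thms)
  then have "Var w * p = Var w * (r1 * eq)" using p r01(3) by (simp add: mult.assoc)
  moreover have "Var w \<noteq> (0 :: 'a mpoly)" by (simp add: Var_def)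
  ultimately have "p = r1 * eq" by (simp only: mult_cancel_left simp_thms)
  then show "\<exists>r'\<in>Polys V0. p = r' * eq" using r01(2) by blast
qed

lemma cancellable_e1: "cancellable (mon e1)"
proof -
  have "cancellable (\<Prod>v\<in>W. Var v ^ lookup e1 v)" if "finite W" "W \<subseteq> keys e1" for W
    using that by (induction W rule: finite_induct)
      (auto intro!: cancellable_1 cancellable_mult cancellable_power cancellable_Var)
  then show ?thesis unfolding mon_eq_prod_Var by simp
qed

text \<open>By \<open>pseudo_division\<close>, a power of \<open>h\<^sub>1\<close> times \<open>p\<close> is congruent to a polynomial without \<open>x\<^sub>1\<close>, on which the evaluation
is injective. The power of \<open>h\<^sub>1\<close> can then be cancelled.\<close>

lemma ev_kernel:
  assumes p: "p \<in> Polys V0" and "ev p = 0"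
  shows "\<exists>r\<in>Polys V0. p = r * eq"
proof -
  obtain N r d where *: "r \<in> Polys (insert (VZ 1) V)" "d \<in> Polys V0" "mon e1 ^ N * p = r + d * eq"
    using pseudo_division[OF p] by blast
  have "ev (mon e1 ^ N * p) = ev r" unfolding *(3) by (simp add: ev_simps ev_eq)
  then have "ev r = 0" using assms(2) by (simp add: ev_simps)
  then have "r = 0" using ev_injective_without_x1 * by blast
  then show ?thesis
    using cancellable_power[OF cancellable_e1, of N] * unfolding cancellable_def by auto
qed

end


section \<open>Automorphism groups of algebras\<close>

lemma subgroup_alg_aut_comm:
  fixes R (structure)
  assumes R: "ring R" and \<eta>: "\<And>c. \<eta> c \<in> carrier R" and \<delta>: "\<delta> \<in> carrier R \<rightarrow> carrier R"
  shows "subgroup (alg_aut_comm R \<eta> \<delta>) (BijGroup (carrier R))"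
proof -
  interpret ring R by (rule R)
  let ?S = "carrier R"
  have compose_eq: "f \<otimes>\<^bsub>BijGroup ?S\<^esub> g = compose ?S f g" if "f \<in> Bij ?S" "g \<in> Bij ?S" for f g
    using that by (simp add: BijGroup_def)
  show ?thesis
  proof (rule group.subgroupI[OF group_BijGroup])
    show "alg_aut_comm R \<eta> \<delta> \<subseteq> carrier (BijGroup ?S)"
      by (auto simp: alg_aut_comm_def alg_aut_def BijGroup_def)
    have "(\<lambda>x\<in>?S. x) \<in> alg_aut_comm R \<eta> \<delta>"
      using \<eta> \<delta> by (auto simp: alg_aut_comm_def alg_aut_def id_Bij ring_hom_def)
    then show "alg_aut_comm R \<eta> \<delta> \<noteq> {}" by blast
  next
    fix f assume f: "f \<in> alg_aut_comm R \<eta> \<delta>"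
    let ?g = "restrict (inv_into ?S f) ?S"
    have f_Bij: "f \<in> Bij ?S" and f_hom: "f \<in> ring_hom R R" and f_\<eta>: "f (\<eta> c) = \<eta> c"
      and f_\<delta>: "x \<in> ?S \<Longrightarrow> f (\<delta> x) = \<delta> (f x)" for c x
      using f by (auto simp: alg_aut_comm_def alg_aut_def)
    have bij: "bij_betw f ?S ?S" using f_Bij by (simp add: Bij_def)
    have f_S: "f x \<in> ?S" if "x \<in> ?S" for x using bij_betwE[OF bij] that by blast
    have g_f: "inv_into ?S f (f x) = x" if "x \<in> ?S" for x using bij_betw_inv_into_left[OF bij that] .
    have ex: "\<exists>x\<in>?S. y = f x" if "y \<in> ?S" for y using bij that by (auto simp: bij_betw_def)
    have "?g \<in> alg_aut_comm R \<eta> \<delta>"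
      unfolding alg_aut_comm_def alg_aut_def
    proof (intro CollectI conjI allI ballI)
      show "?g \<in> Bij ?S" using f_Bij by (rule restrict_inv_into_Bij)
      show "?g \<in> ring_hom R R"
      proof (rule ring_hom_memI)
        fix x assume "x \<in> ?S"
        then obtain x' where "x' \<in> ?S" "x = f x'" using ex by blast
        then show "?g x \<in> ?S" by (simp add: f_S g_f)
      next
        fix x y assume xy: "x \<in> ?S" "y \<in> ?S"
        then obtain x' y' where *: "x' \<in> ?S" "x = f x'" "y' \<in> ?S" "y = f y'" using ex by metis
        have "x \<otimes> y = f (x' \<otimes> y')" "x \<oplus> y = f (x' \<oplus> y')"
          using * ring_hom_mult[OF f_hom] ring_hom_add[OF f_hom] by simp_all
        then show "?g (x \<otimes> y) = ?g x \<otimes> ?g y" "?g (x \<oplus> y) = ?g x \<oplus> ?g y"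
          using * xy by (simp_all add: f_S g_f)
      next
        show "?g \<one> = \<one>" using g_f[of \<one>] ring_hom_one[OF f_hom] by simp
      qed
      show "?g (\<eta> c) = \<eta> c" for c using g_f[OF \<eta>[of c]] \<eta>[of c] by (simp add: f_\<eta>)
      fix x assume x: "x \<in> ?S"
      then obtain x' where *: "x' \<in> ?S" "x = f x'" using ex by blast
      have "\<delta> x \<in> ?S" "\<delta> x' \<in> ?S" using \<delta> x * by auto
      then show "?g (\<delta> x) = \<delta> (?g x)" using * x by (simp add: g_f flip: f_\<delta>)
    qed
    then show "inv\<^bsub>BijGroup ?S\<^esub> f \<in> alg_aut_comm R \<eta> \<delta>"
      using f_Bij by (simp add: inv_BijGroup)
  next
    fix f g assume fg: "f \<in> alg_aut_comm R \<eta> \<delta>" "g \<in> alg_aut_comm R \<eta> \<delta>"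
    then have Bij: "f \<in> Bij ?S" "g \<in> Bij ?S" and hom: "f \<in> ring_hom R R" "g \<in> ring_hom R R"
      by (auto simp: alg_aut_comm_def alg_aut_def)
    have S: "f x \<in> ?S" "g x \<in> ?S" if "x \<in> ?S" for x
      using Bij_imp_funcset[OF Bij(1)] Bij_imp_funcset[OF Bij(2)] that by auto
    have "compose ?S f g \<in> ring_hom R R"
      by (rule ring_hom_memI)
        (simp_all add: compose_def S ring_hom_mult[OF hom(1)] ring_hom_mult[OF hom(2)]
          ring_hom_add[OF hom(1)] ring_hom_add[OF hom(2)] ring_hom_one[OF hom(1)] ring_hom_one[OF hom(2)])
    moreover have "\<delta> x \<in> ?S" if "x \<in> ?S" for x using \<delta> that by auto
    ultimately have "compose ?S f g \<in> alg_aut_comm R \<eta> \<delta>"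
      using fg Bij by (auto simp: alg_aut_comm_def alg_aut_def compose_Bij compose_eq compose_def \<eta> S intro: compose_Bij[unfolded compose_def])
    then show "f \<otimes>\<^bsub>BijGroup ?S\<^esub> g \<in> alg_aut_comm R \<eta> \<delta>"
      using Bij by (simp add: compose_eq)
  qed
qed

lemma poly_ring_simps [simp]:
  "carrier (poly_ring W) = Polys W" "x \<otimes>\<^bsub>poly_ring W\<^esub> y = x * y" "x \<oplus>\<^bsub>poly_ring W\<^esub> y = x + y"
  "\<one>\<^bsub>poly_ring W\<^esub> = 1" "\<zero>\<^bsub>poly_ring W\<^esub> = 0"
  by (simp_all add: poly_ring_def Polys_def)

lemma cring_poly_ring: "cring (poly_ring W :: 'a::comm_ring_1 mpoly ring)"
proof (rule cringI)
  show "abelian_group (poly_ring W :: 'a mpoly ring)"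
  proof (rule abelian_groupI)
    fix x :: "'a mpoly" assume "x \<in> carrier (poly_ring W)"
    then show "\<exists>y\<in>carrier (poly_ring W). y \<oplus>\<^bsub>poly_ring W\<^esub> x = \<zero>\<^bsub>poly_ring W\<^esub>"
      by (intro bexI[of _ "- x"]) auto
  qed (auto simp: ac_simps)
  show "Group.comm_monoid (poly_ring W :: 'a mpoly ring)"
    by (rule comm_monoidI) (auto simp: ac_simps)
qed (auto simp: distrib_right)


section \<open>Transport to the polynomial ring\<close>

context hypersurface
begin


sublocale PR: cring P by (rule cring_poly_ring)

sublocale ID: ideal I P
  unfolding eq_ideal_def by (rule PR.cgenideal_ideal) (simp add: eq_in_Polys)

sublocale BR: cring B
  unfolding coord_ring_def by (rule ID.quotient_is_cring) (rule PR.is_cring)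

lemma I_eq: "I = {r * eq | r. r \<in> Polys V0}"
  by (simp add: eq_ideal_def cgenideal_def)

text \<open>Cosets are the fibres of the evaluation, by \<open>ev_kernel\<close>.\<close>

lemma \<pi>_eq:
  assumes p: "p \<in> Polys V0"
  shows "\<pi> p = {r \<in> Polys V0. ev r = ev p}"
proof (intro equalityI subsetI)
  fix r assume "r \<in> \<pi> p"
  then obtain d where "d \<in> Polys V0" "r = d * eq + p"
    by (auto simp: cls_def a_r_coset_def' I_eq)
  then show "r \<in> {r \<in> Polys V0. ev r = ev p}"
    using p eq_in_Polys by (auto simp: ev_simps ev_eq)
next
  fix r assume "r \<in> {r \<in> Polys V0. ev r = ev p}"
  then have r: "r \<in> Polys V0" "ev (r - p) = 0" by (simp_all add: ev_simps)
  obtain d where "d \<in> Polys V0" "r - p = d * eq"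
    using ev_kernel[OF Polys_diff[OF r(1) p] r(2)] by blast
  then have "d * eq \<in> I" "r = d * eq + p" by (auto simp: I_eq algebra_simps)
  then show "r \<in> \<pi> p" by (auto simp: cls_def a_r_coset_def')
qed

lemma \<pi>_self: "p \<in> Polys V0 \<Longrightarrow> p \<in> \<pi> p"
  by (simp add: \<pi>_eq)

lemma carrier_B: "carrier B = \<pi> ` Polys V0"
  by (auto simp: coord_ring_def FactRing_def A_RCOSETS_def' cls_def)

lemma \<pi>_in_B [intro]: "p \<in> Polys V0 \<Longrightarrow> \<pi> p \<in> carrier B"
  by (simp add: carrier_B)

lemma
  assumes "p \<in> Polys V0" "r \<in> Polys V0"
  shows \<pi>_add: "\<pi> (p + r) = \<pi> p \<oplus>\<^bsub>B\<^esub> \<pi> r" and \<pi>_mult: "\<pi> (p * r) = \<pi> p \<otimes>\<^bsub>B\<^esub> \<pi> r"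
  using ring_hom_add[OF ID.rcos_ring_hom, of p r] ring_hom_mult[OF ID.rcos_ring_hom, of p r] assms
  by (simp_all add: cls_def coord_ring_def)

lemma \<pi>_0: "\<pi> 0 = \<zero>\<^bsub>B\<^esub>" and \<pi>_1: "\<pi> 1 = \<one>\<^bsub>B\<^esub>"
proof -
  show "\<pi> 1 = \<one>\<^bsub>B\<^esub>"
    using ring_hom_one[OF ID.rcos_ring_hom] by (simp add: cls_def coord_ring_def)
  have "\<pi> 0 \<oplus>\<^bsub>B\<^esub> \<pi> 0 = \<pi> 0" using \<pi>_add[of 0 0] by simp
  then show "\<pi> 0 = \<zero>\<^bsub>B\<^esub>" using BR.add.l_cancel_one'[of "\<pi> 0" "\<pi> 0"] by auto
qed

lemma \<eta>_eq: "\<eta> b = \<pi> (Const b)"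
  by (simp add: scalar_def)

lemma \<eta>_in_B [intro]: "\<eta> b \<in> carrier B"
  by (auto simp: \<eta>_eq)

text \<open>The embedding of the coordinate ring, with image \<open>Bs\<close>, and below its inverse \<open>\<kappa>\<close>.\<close>

definition \<iota> :: "'a mpoly set \<Rightarrow> 'a mpoly fract poly" where
  "\<iota> W = ev (SOME p. p \<in> W)"

lemma \<iota>_\<pi>: "p \<in> Polys V0 \<Longrightarrow> \<iota> (\<pi> p) = ev p"
  unfolding \<iota>_def using someI[of "\<lambda>r. r \<in> \<pi> p" p] by (simp add: \<pi>_eq)

lemma B_cases [consumes 1]:
  assumes "W \<in> carrier B"
  obtains p where "p \<in> Polys V0" "W = \<pi> p" "\<iota> W = ev p"
  using assms \<iota>_\<pi> by (auto simp: carrier_B)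

lemma \<iota>_in_Bs [intro]: "W \<in> carrier B \<Longrightarrow> \<iota> W \<in> Bs"
  by (elim B_cases) (simp add: ev_in_Bs)

lemma \<iota>_add: "W \<in> carrier B \<Longrightarrow> Y \<in> carrier B \<Longrightarrow> \<iota> (W \<oplus>\<^bsub>B\<^esub> Y) = \<iota> W + \<iota> Y"
  and \<iota>_mult: "W \<in> carrier B \<Longrightarrow> Y \<in> carrier B \<Longrightarrow> \<iota> (W \<otimes>\<^bsub>B\<^esub> Y) = \<iota> W * \<iota> Y"
  by (elim B_cases; simp add: \<iota>_\<pi> Polys_add Polys_mult ev_simps flip: \<pi>_add \<pi>_mult)+

lemma \<iota>_0 [simp]: "\<iota> \<zero>\<^bsub>B\<^esub> = 0" and \<iota>_1 [simp]: "\<iota> \<one>\<^bsub>B\<^esub> = 1" and \<iota>_\<eta> [simp]: "\<iota> (\<eta> b) = emb (Const b)"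
  by (simp_all add: \<iota>_\<pi> ev_simps \<eta>_eq flip: \<pi>_0 \<pi>_1)

lemma \<iota>_inj: "W \<in> carrier B \<Longrightarrow> Y \<in> carrier B \<Longrightarrow> \<iota> W = \<iota> Y \<Longrightarrow> W = Y"
  by (elim B_cases) (simp add: \<pi>_eq)

lemma \<iota>_eq_0_iff: "W \<in> carrier B \<Longrightarrow> \<iota> W = 0 \<longleftrightarrow> W = \<zero>\<^bsub>B\<^esub>"
  using \<iota>_inj[of W "\<zero>\<^bsub>B\<^esub>"] by auto

definition \<kappa> :: "'a mpoly fract poly \<Rightarrow> 'a mpoly set" where
  "\<kappa> f = \<pi> (SOME p. p \<in> Polys V0 \<and> ev p = f)"

lemma
  assumes "f \<in> Bs"
  shows \<kappa>_in_B [intro]: "\<kappa> f \<in> carrier B" and \<iota>_\<kappa>: "\<iota> (\<kappa> f) = f"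
proof -
  have "\<exists>p. p \<in> Polys V0 \<and> ev p = f" using Bs_in_ev[OF assms] by blast
  from someI_ex[OF this] show "\<kappa> f \<in> carrier B" "\<iota> (\<kappa> f) = f"
    by (auto simp: \<kappa>_def \<iota>_\<pi>)
qed

lemma \<kappa>_\<iota>: "W \<in> carrier B \<Longrightarrow> \<kappa> (\<iota> W) = W"
  by (rule \<iota>_inj) (simp_all add: \<iota>_\<kappa> \<iota>_in_Bs \<kappa>_in_B)

lemma \<kappa>_eq: "W \<in> carrier B \<Longrightarrow> \<iota> W = f \<Longrightarrow> \<kappa> f = W"
  using \<kappa>_\<iota> by blast

text \<open>The map on \<open>Bs\<close> that corresponds to a map on the coordinate ring.\<close>

definition conj :: "('a mpoly set \<Rightarrow> 'a mpoly set) \<Rightarrow> 'a mpoly fract poly \<Rightarrow> 'a mpoly fract poly" where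
  "conj \<phi> f = \<iota> (\<phi> (\<kappa> f))"

lemma conj_\<iota>: "W \<in> carrier B \<Longrightarrow> conj \<phi> (\<iota> W) = \<iota> (\<phi> W)"
  by (simp add: conj_def \<kappa>_\<iota>)

lemma conj_emb: "p \<in> Polys V \<Longrightarrow> conj \<phi> (emb p) = \<iota> (\<phi> (\<pi> p))"
  using conj_\<iota>[of "\<pi> p" \<phi>] Polys_V_V0[of p] by (simp add: \<iota>_\<pi> ev_emb \<pi>_in_B)

lemma conj_zz: "conj \<phi> zz = \<iota> (\<phi> (\<pi> (Var (VZ 1))))"
  using conj_\<iota>[of "\<pi> (Var (VZ 1))" \<phi>] by (simp add: \<iota>_\<pi> ev_Var \<pi>_in_B)

lemma alg_aut_in_B: "\<phi> \<in> alg_aut B \<eta> \<Longrightarrow> W \<in> carrier B \<Longrightarrow> \<phi> W \<in> carrier B"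
  unfolding alg_aut_def using Bij_imp_funcset by blast

lemma endo_conj: "\<phi> \<in> alg_aut B \<eta> \<Longrightarrow> endo (conj \<phi>)"
proof -
  assume \<phi>: "\<phi> \<in> alg_aut B \<eta>"
  then have hom: "\<phi> \<in> ring_hom B B" and \<phi>_\<eta>: "\<phi> (\<eta> b) = \<eta> b" for b by (auto simp: alg_aut_def)
  show ?thesis
    unfolding endo_def
  proof (intro conjI ballI allI)
    fix f assume "f \<in> Bs"
    then show "conj \<phi> f \<in> Bs" unfolding conj_def by (intro \<iota>_in_Bs alg_aut_in_B[OF \<phi>] \<kappa>_in_B)
  next
    fix f g assume f: "f \<in> Bs" and g: "g \<in> Bs"
    have "\<kappa> (f + g) = \<kappa> f \<oplus>\<^bsub>B\<^esub> \<kappa> g" "\<kappa> (f * g) = \<kappa> f \<otimes>\<^bsub>B\<^esub> \<kappa> g"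
      using f g by (simp_all add: \<kappa>_eq \<iota>_add \<iota>_mult \<iota>_\<kappa> \<kappa>_in_B)
    then show "conj \<phi> (f + g) = conj \<phi> f + conj \<phi> g" "conj \<phi> (f * g) = conj \<phi> f * conj \<phi> g"
      using f g ring_hom_add[OF hom] ring_hom_mult[OF hom]
      by (simp_all add: conj_def \<iota>_add \<iota>_mult \<kappa>_in_B alg_aut_in_B[OF \<phi>])
  next
    show "conj \<phi> (emb (Const b)) = emb (Const b)" for b
      by (simp add: conj_emb \<phi>_\<eta> flip: \<eta>_eq)
  qed
qed

text \<open>The value at \<open>x\<^sub>1\<close> is determined by the others, since an automorphism does not kill \<open>h\<^sub>1\<close>.\<close>

lemma alg_aut_eqI:
  assumes \<phi>: "\<phi> \<in> alg_aut B \<eta>" and \<psi>: "\<psi> \<in> alg_aut B \<eta>"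
    and vars: "\<And>v. v \<in> V \<Longrightarrow> \<iota> (\<phi> (\<pi> (Var v))) = \<iota> (\<psi> (\<pi> (Var v)))"
    and zz: "\<iota> (\<phi> (\<pi> (Var (VZ 1)))) = \<iota> (\<psi> (\<pi> (Var (VZ 1))))"
  shows "\<phi> = \<psi>"
proof (rule extensionalityI)
  show "\<phi> \<in> extensional (carrier B)" "\<psi> \<in> extensional (carrier B)"
    using \<phi> \<psi> by (auto simp: alg_aut_def Bij_def)
  have inj: "inj_on \<phi> (carrier B)" using \<phi> by (auto simp: alg_aut_def Bij_def bij_betw_def)
  have "conj \<phi> (emb (mon e1)) \<noteq> 0"
  proof
    assume "conj \<phi> (emb (mon e1)) = 0"
    then have "\<iota> (\<phi> (\<pi> (mon e1))) = \<iota> (\<phi> (\<pi> 0))"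
      using endo_0[OF endo_conj[OF \<phi>]] conj_emb[of "mon e1" \<phi>] conj_emb[of 0 \<phi>] by simp
    then have "\<phi> (\<pi> (mon e1)) = \<phi> (\<pi> 0)"
      by (rule \<iota>_inj[rotated 2]) (auto intro!: alg_aut_in_B[OF \<phi>] \<pi>_in_B mon_in_Polys_V0)
    then have "\<pi> (mon e1) = \<pi> 0"
      by (rule inj_onD[OF inj]) (auto intro!: \<pi>_in_B mon_in_Polys_V0)
    then have "ev (mon e1) = ev 0"
      using \<iota>_\<pi>[of "mon e1"] \<iota>_\<pi>[of 0] mon_in_Polys_V0 by simp
    then show False by (simp add: ev_emb)
  qed
  note nonzero = this
  have eq: "conj \<phi> f = conj \<psi> f" if "f \<in> Bs" for f
    by (rule endo_eqI[OF endo_conj[OF \<phi>] endo_conj[OF \<psi>] _ _ nonzero that])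
      (simp_all add: conj_emb conj_zz vars zz)
  fix W assume W: "W \<in> carrier B"
  then have "\<iota> (\<phi> W) = \<iota> (\<psi> W)"
    using eq[of "\<iota> W"] by (simp add: conj_\<iota> \<iota>_in_Bs)
  then show "\<phi> W = \<psi> W"
    by (rule \<iota>_inj[OF alg_aut_in_B[OF \<phi> W] alg_aut_in_B[OF \<psi> W]])
qed

definition lift :: "('a mpoly fract poly \<Rightarrow> 'a mpoly fract poly) \<Rightarrow> 'a mpoly set \<Rightarrow> 'a mpoly set" where
  "lift F = (\<lambda>W\<in>carrier B. \<kappa> (F (\<iota> W)))"

lemma \<iota>_lift: "endo F \<Longrightarrow> W \<in> carrier B \<Longrightarrow> \<iota> (lift F W) = F (\<iota> W)"
  by (simp add: lift_def \<iota>_\<kappa> endo_in_Bs \<iota>_in_Bs)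

lemma lift_alg_aut:
  assumes F: "endo F" and F': "endo F'"
    and inverse: "\<And>f. f \<in> Bs \<Longrightarrow> F' (F f) = f" "\<And>f. f \<in> Bs \<Longrightarrow> F (F' f) = f"
  shows "lift F \<in> alg_aut B \<eta>"
proof -
  have closed: "lift G W \<in> carrier B" if "endo G" "W \<in> carrier B" for G W
    using \<kappa>_in_B[OF endo_in_Bs[OF that(1) \<iota>_in_Bs[OF that(2)]]] that(2) by (simp add: lift_def)
  have "bij_betw (lift F) (carrier B) (carrier B)"
  proof (rule bij_betw_byWitness[where f' = "lift F'"])
    have "lift F' (lift F W) = W" if "W \<in> carrier B" for W
      using that by (intro \<iota>_inj[of "lift F' (lift F W)" W])
        (simp_all add: \<iota>_lift F F' closed \<iota>_in_Bs inverse)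
    moreover have "lift F (lift F' W) = W" if "W \<in> carrier B" for W
      using that by (intro \<iota>_inj[of "lift F (lift F' W)" W])
        (simp_all add: \<iota>_lift F F' closed \<iota>_in_Bs inverse)
    ultimately show "\<forall>W\<in>carrier B. lift F' (lift F W) = W" "\<forall>W\<in>carrier B. lift F (lift F' W) = W"
      by blast+
  qed (use closed F F' in auto)
  moreover have "lift F \<in> ring_hom B B"
  proof (rule ring_hom_memI)
    fix W Y assume WY: "W \<in> carrier B" "Y \<in> carrier B"
    show "lift F (W \<otimes>\<^bsub>B\<^esub> Y) = lift F W \<otimes>\<^bsub>B\<^esub> lift F Y"
      by (rule \<iota>_inj) (simp_all add: \<iota>_lift F WY closed \<iota>_mult endo_mult[OF F] \<iota>_in_Bs)
    show "lift F (W \<oplus>\<^bsub>B\<^esub> Y) = lift F W \<oplus>\<^bsub>B\<^esub> lift F Y"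
      by (rule \<iota>_inj) (simp_all add: \<iota>_lift F WY closed \<iota>_add endo_add[OF F] \<iota>_in_Bs)
  next
    show "lift F \<one>\<^bsub>B\<^esub> = \<one>\<^bsub>B\<^esub>"
      by (rule \<iota>_inj) (simp_all add: \<iota>_lift F closed endo_1[OF F])
  qed (rule closed[OF F])
  moreover have "lift F (\<eta> b) = \<eta> b" for b
    by (rule \<iota>_inj) (simp_all add: \<iota>_lift F closed endo_Const[OF F] \<eta>_in_B)
  ultimately show ?thesis by (auto simp: alg_aut_def Bij_def lift_def)
qed


subsection \<open>Maps induced by substitutions\<close>

text \<open>Such a substitution maps the ideal of the equation into itself.\<close>

definition admissible :: "(letter \<Rightarrow> 'a mpoly) \<Rightarrow> bool" where
  "admissible g \<longleftrightarrow> (\<forall>v\<in>V0. g v \<in> Polys V0) \<and> ev (evalp Const g eq) = 0"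

lemma admissible_Polys: "admissible g \<Longrightarrow> p \<in> Polys V0 \<Longrightarrow> evalp Const g p \<in> Polys V0"
  by (rule subst_in_Polys) (auto simp: admissible_def)

lemma induced_\<pi>:
  assumes g: "admissible g" and p: "p \<in> Polys V0"
  shows "induced k m n a l g (\<pi> p) = \<pi> (evalp Const g p)"
proof -
  have "\<pi> (evalp Const g r) = \<pi> (evalp Const g p)" if "r \<in> \<pi> p" for r
  proof -
    have r: "r \<in> Polys V0" "ev (r - p) = 0" using that p by (simp_all add: \<pi>_eq ev_simps)
    obtain d where d: "d \<in> Polys V0" "r - p = d * eq"
      using ev_kernel[OF Polys_diff[OF r(1) p] r(2)] by blast
    have "ev (evalp Const g (r - p)) = 0"
      unfolding d(2) using g by (simp add: subst_simps ev_simps admissible_def)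
    then have "ev (evalp Const g r) = ev (evalp Const g p)"
      by (simp add: subst_simps ev_simps)
    then show ?thesis
      using r p g by (simp add: \<pi>_eq admissible_Polys)
  qed
  then have "(\<Union>r\<in>\<pi> p. \<pi> (evalp Const g r)) = \<pi> (evalp Const g p)"
    using \<pi>_self[OF p] by blast
  then show ?thesis using p by (simp add: induced_def subst_eq_evalp \<pi>_in_B)
qed

lemma induced_alg_aut:
  assumes g: "admissible g" and g': "admissible g'"
    and inverse: "\<And>v. v \<in> V0 \<Longrightarrow> evalp Const g (g' v) = Var v" "\<And>v. v \<in> V0 \<Longrightarrow> evalp Const g' (g v) = Var v"
  shows "induced k m n a l g \<in> alg_aut B \<eta>"
proof -
  let ?f = "induced k m n a l g" and ?f' = "induced k m n a l g'"
  have evalp_inverse: "evalp Const h (evalp Const h' p) = p"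
    if "\<And>v. v \<in> V0 \<Longrightarrow> evalp Const h (h' v) = Var v" "p \<in> Polys V0" for h h' :: "letter \<Rightarrow> 'a mpoly" and p
    using evalp_subst[OF that(2) subst.coefficient_hom_axioms, of Var h h'] that(1) by (simp add: subst_Var)
  have "bij_betw ?f (carrier B) (carrier B)"
    by (rule bij_betw_byWitness[where f' = ?f'])
      (auto simp: carrier_B induced_\<pi>[OF g] induced_\<pi>[OF g'] admissible_Polys[OF g] admissible_Polys[OF g']
        evalp_inverse[OF inverse(1)] evalp_inverse[OF inverse(2)])
  moreover have "?f \<in> ring_hom B B"
  proof (rule ring_hom_memI)
    fix Y assume "Y \<in> carrier B"
    then show "?f Y \<in> carrier B" by (elim B_cases) (auto simp: induced_\<pi>[OF g] admissible_Polys[OF g])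
  next
    fix W Y assume "W \<in> carrier B" "Y \<in> carrier B"
    then obtain p r where pr: "p \<in> Polys V0" "W = \<pi> p" "r \<in> Polys V0" "Y = \<pi> r" by (metis B_cases)
    then show "?f (W \<otimes>\<^bsub>B\<^esub> Y) = ?f W \<otimes>\<^bsub>B\<^esub> ?f Y" "?f (W \<oplus>\<^bsub>B\<^esub> Y) = ?f W \<oplus>\<^bsub>B\<^esub> ?f Y"
      by (simp_all add: induced_\<pi>[OF g] subst_simps Polys_add Polys_mult admissible_Polys[OF g] flip: \<pi>_add \<pi>_mult)
  next
    show "?f \<one>\<^bsub>B\<^esub> = \<one>\<^bsub>B\<^esub>" by (simp add: induced_\<pi>[OF g] flip: \<pi>_1)
  qed
  moreover have "?f (\<eta> b) = \<eta> b" for b by (simp add: \<eta>_eq induced_\<pi>[OF g])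
  ultimately show ?thesis by (auto simp: alg_aut_def Bij_def induced_def)
qed

lemma induced_cong:
  fixes g g' :: "letter \<Rightarrow> 'a mpoly"
  assumes "\<And>v. v \<in> V0 \<Longrightarrow> g v = g' v"
  shows "induced k m n a l g = induced k m n a l g'"
proof -
  have "evalp Const g p = evalp Const g' p" if "p \<in> Polys V0" for p
    using that by (induction rule: Polys_induct) (simp_all add: subst_simps assms)
  moreover have "p \<in> Polys V0" if "p \<in> Y" "Y \<in> carrier B" for p Y
    using that by (auto simp: carrier_B \<pi>_eq)
  ultimately have "\<pi> (evalp Const g p) = \<pi> (evalp Const g' p)" if "p \<in> Y" "Y \<in> carrier B" for p Y
    using that by metis
  then show ?thesis
    unfolding induced_def subst_eq_evalp by (intro restrict_ext SUP_cong refl)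
qed

end


section \<open>The unipotent group\<close>

lemma to_fract_Const_fact: "to_fract (Const (1 / fact i :: 'a::field_char_0)) = 1 / fact i"
proof -
  have of_nat: "to_fract (Const (of_nat j :: 'a)) = of_nat j" for j
    by (induction j) (simp_all add: Const_add)
  have "to_fract (Const (1 / fact i :: 'a)) * to_fract (Const (of_nat (fact i))) = 1"
    by (simp flip: to_fract_mult Const_mult)
  then show ?thesis unfolding of_nat by (simp add: field_simps)
qed

context trinomial
begin

text \<open>The substitution \<open>z \<mapsto> z + \<beta>\<close>.\<close>

definition translate :: "'a mpoly fract \<Rightarrow> 'a mpoly fract poly \<Rightarrow> 'a mpoly fract poly" where
  "translate \<beta> f = pcompose f [:\<beta>, 1:]"

text \<open>By Taylor's formula the translation is a finite sum of iterates of \<open>\<beta> \<cdot> d/dz\<close> with scalar factors.\<close>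

lemma translate_in_Bs:
  assumes \<beta>: "\<And>f. f \<in> Bs \<Longrightarrow> smult \<beta> (pderiv f) \<in> Bs" and f: "f \<in> Bs"
  shows "translate \<beta> f \<in> Bs"
proof -
  have "((\<lambda>f. smult \<beta> (pderiv f)) ^^ i) f \<in> Bs" for i
    by (induction i) (simp_all add: f \<beta>)
  then have "smult (to_fract (Const (1 / fact i))) (smult (\<beta> ^ i) ((pderiv ^^ i) f)) \<in> Bs" for i
    by (intro Bs_smult) (simp_all add: funpow_smult_pderiv)
  then have "smult (\<beta> ^ i / fact i) ((pderiv ^^ i) f) \<in> Bs" for i
    by (simp add: to_fract_Const_fact)
  then have "(\<Sum>i<Suc (degree f). smult (\<beta> ^ i / fact i) ((pderiv ^^ i) f)) \<in> Bs"
    by (intro Bs_sum) blast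
  then show ?thesis by (simp only: Taylor_pcompose lessI translate_def)
qed

lemma endo_translate:
  assumes \<beta>: "\<And>f. f \<in> Bs \<Longrightarrow> smult \<beta> (pderiv f) \<in> Bs"
  shows "endo (translate \<beta>)"
  using translate_in_Bs[OF \<beta>] by (simp add: endo_def translate_def pcompose_add pcompose_mult)

lemma translate_inverse: "translate (- \<beta>) (translate \<beta> f) = f"
proof -
  have "pcompose [:\<beta>, 1:] [:- \<beta>, 1:] = zz" by (simp add: pcompose_pCons)
  then show ?thesis by (simp add: translate_def flip: pcompose_assoc)
qed

lemma translate_der: "translate \<beta> (der f) = der (translate \<beta> f)"
  by (simp add: translate_def der_def pcompose_smult pderiv_pcompose pderiv_pCons)

end

text \<open>A derivation that kills \<open>A\<close> is determined by its value at \<open>z\<^sub>1\<close>, because \<open>h\<^sub>1 x\<^sub>1\<close> is a polynomial in \<open>z\<^sub>1\<close> over \<open>A\<close>.\<close>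

locale hypersurface_der = hypersurface +
  fixes \<delta> :: "'a mpoly set \<Rightarrow> 'a mpoly set"
  assumes LND: "LND B \<eta> \<delta>"
    and \<delta>_VZ1: "\<iota> (\<delta> (\<pi> (Var (VZ 1)))) = emb s"
    and \<delta>_V: "\<And>v. v \<in> V \<Longrightarrow> \<delta> (\<pi> (Var v)) = \<zero>\<^bsub>B\<^esub>"
begin

lemma derivation_rules:
  assumes "derivation B \<eta> D"
  shows "W \<in> carrier B \<Longrightarrow> D W \<in> carrier B"
    and "f \<in> Bs \<Longrightarrow> conj D f \<in> Bs"
    and "f \<in> Bs \<Longrightarrow> g \<in> Bs \<Longrightarrow> conj D (f + g) = conj D f + conj D g"
    and "f \<in> Bs \<Longrightarrow> g \<in> Bs \<Longrightarrow> conj D (f * g) = conj D f * g + f * conj D g"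
    and "conj D (emb (Const b)) = 0"
proof -
  have closed: "D W \<in> carrier B" if "W \<in> carrier B" for W using assms that by (auto simp: derivation_def)
  have add: "D (W \<oplus>\<^bsub>B\<^esub> Y) = D W \<oplus>\<^bsub>B\<^esub> D Y" if "W \<in> carrier B" "Y \<in> carrier B" for W Y
    using assms that by (auto simp: derivation_def)
  have mult: "D (W \<otimes>\<^bsub>B\<^esub> Y) = (D W \<otimes>\<^bsub>B\<^esub> Y) \<oplus>\<^bsub>B\<^esub> (W \<otimes>\<^bsub>B\<^esub> D Y)" if "W \<in> carrier B" "Y \<in> carrier B" for W Y
    using assms that by (auto simp: derivation_def)
  have linear: "D (\<eta> b \<otimes>\<^bsub>B\<^esub> W) = \<eta> b \<otimes>\<^bsub>B\<^esub> D W" if "W \<in> carrier B" for b W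
    using assms that by (auto simp: derivation_def)
  show "W \<in> carrier B \<Longrightarrow> D W \<in> carrier B" by (rule closed)
  show "f \<in> Bs \<Longrightarrow> conj D f \<in> Bs"
    unfolding conj_def by (intro \<iota>_in_Bs closed \<kappa>_in_B)
  show "conj D (f + g) = conj D f + conj D g" if f: "f \<in> Bs" and g: "g \<in> Bs"
  proof -
    have "\<kappa> (f + g) = \<kappa> f \<oplus>\<^bsub>B\<^esub> \<kappa> g"
      using f g by (simp add: \<kappa>_eq \<iota>_add \<iota>_\<kappa> \<kappa>_in_B)
    then show ?thesis using f g by (simp add: conj_def add \<iota>_add closed \<kappa>_in_B)
  qed
  show conj_mult: "conj D (f * g) = conj D f * g + f * conj D g" if f: "f \<in> Bs" and g: "g \<in> Bs" for f g
  proof -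
    have "\<kappa> (f * g) = \<kappa> f \<otimes>\<^bsub>B\<^esub> \<kappa> g"
      using f g by (simp add: \<kappa>_eq \<iota>_mult \<iota>_\<kappa> \<kappa>_in_B)
    then show ?thesis using f g by (simp add: conj_def mult \<iota>_add \<iota>_mult closed \<kappa>_in_B \<iota>_\<kappa>)
  qed
  have "conj D (1 * 1) = conj D 1 * 1 + 1 * conj D 1" by (rule conj_mult) simp_all
  then have "conj D 1 = 0" by simp
  moreover have "\<kappa> 1 = \<one>\<^bsub>B\<^esub>" by (rule \<kappa>_eq) simp_all
  ultimately have "\<iota> (D \<one>\<^bsub>B\<^esub>) = 0" by (simp add: conj_def)
  moreover have "\<kappa> (emb (Const b)) = \<eta> b \<otimes>\<^bsub>B\<^esub> \<one>\<^bsub>B\<^esub>" by (rule \<kappa>_eq) (simp_all add: \<eta>_in_B)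
  ultimately show "conj D (emb (Const b)) = 0"
    using closed[of "\<one>\<^bsub>B\<^esub>"] linear[of "\<one>\<^bsub>B\<^esub>" b] by (simp add: conj_def \<iota>_mult \<eta>_in_B)
qed

lemma derivation_\<delta>: "derivation B \<eta> \<delta>"
  using LND by (simp add: LND_def)

lemma conj_\<delta>_emb: "p \<in> Polys V \<Longrightarrow> conj \<delta> (emb p) = 0"
proof (induction rule: Polys_induct)
  case (Const b)
  show ?case by (rule derivation_rules(5)[OF derivation_\<delta>])
next
  case (Var v)
  then show ?case by (simp add: conj_emb \<delta>_V)
next
  case (add p r)
  then show ?case
    using derivation_rules(3)[OF derivation_\<delta> emb_in_Bs emb_in_Bs, of p r] by simp
next
  case (mult p r)
  then show ?case
    using derivation_rules(4)[OF derivation_\<delta> emb_in_Bs emb_in_Bs, of p r] by (simp add: mult.commute)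
qed

lemma conj_\<delta>: "f \<in> Bs \<Longrightarrow> conj \<delta> f = der f"
proof (induction rule: Bs_induct_q)
  case (emb p)
  then show ?case by (simp add: conj_\<delta>_emb)
next
  case zz
  show ?case by (simp only: conj_zz \<delta>_VZ1 der_zz)
next
  case x1
  have m1_Bs: "emb (mon e1) \<in> Bs" by (intro emb_in_Bs) simp
  have "emb (mon e1) * conj \<delta> x1 = conj \<delta> (emb (mon e1) * x1)"
    using derivation_rules(4)[OF derivation_\<delta> m1_Bs Bs_intros(1)] conj_\<delta>_emb[of "mon e1"] by simp
  also have "\<dots> = der (emb (mon e1) * x1)"
    using x1 by (simp only: emb_m1_x1)
  also have "\<dots> = emb (mon e1) * der x1"
    by (simp only: der_mult der_emb mult_zero_right add_0_right)
  finally show ?case by (simp add: smult_cancel_left)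
next
  case (add f g)
  then show ?case by (simp add: derivation_rules(3)[OF derivation_\<delta>] der_add)
next
  case (mult f g)
  then show ?case by (simp add: derivation_rules(4)[OF derivation_\<delta>] der_mult mult.commute add.commute)
qed

lemma \<delta>_in_B: "W \<in> carrier B \<Longrightarrow> \<delta> W \<in> carrier B"
  by (rule derivation_rules(1)[OF derivation_\<delta>])

lemma \<iota>_\<delta>: "W \<in> carrier B \<Longrightarrow> \<iota> (\<delta> W) = der (\<iota> W)"
  using conj_\<delta>[of "\<iota> W"] by (simp add: conj_\<iota> \<iota>_in_Bs)

abbreviation Autd :: "('a mpoly set \<Rightarrow> 'a mpoly set) set" where "Autd \<equiv> alg_aut_comm B \<eta> \<delta>"
abbreviation G :: "('a mpoly set \<Rightarrow> 'a mpoly set) monoid" where "G \<equiv> alg_aut_comm_group B \<eta> \<delta>"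

lemma Autd_iff:
  "\<phi> \<in> Autd \<longleftrightarrow> \<phi> \<in> alg_aut B \<eta> \<and> (\<forall>f\<in>Bs. conj \<phi> (der f) = der (conj \<phi> f))"
proof -
  have "(\<forall>W\<in>carrier B. \<phi> (\<delta> W) = \<delta> (\<phi> W)) \<longleftrightarrow> (\<forall>f\<in>Bs. conj \<phi> (der f) = der (conj \<phi> f))"
    if \<phi>: "\<phi> \<in> alg_aut B \<eta>"
  proof -
    have "\<phi> (\<delta> W) = \<delta> (\<phi> W) \<longleftrightarrow> conj \<phi> (der (\<iota> W)) = der (conj \<phi> (\<iota> W))" if W: "W \<in> carrier B" for W
    proof -
      have "\<phi> (\<delta> W) = \<delta> (\<phi> W) \<longleftrightarrow> \<iota> (\<phi> (\<delta> W)) = \<iota> (\<delta> (\<phi> W))"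
        using \<iota>_inj[OF alg_aut_in_B[OF \<phi> \<delta>_in_B[OF W]] \<delta>_in_B[OF alg_aut_in_B[OF \<phi> W]]] by auto
      also have "\<iota> (\<phi> (\<delta> W)) = conj \<phi> (der (\<iota> W))"
        using conj_\<iota>[OF \<delta>_in_B[OF W], of \<phi>] \<iota>_\<delta>[OF W] by simp
      also have "\<iota> (\<delta> (\<phi> W)) = der (conj \<phi> (\<iota> W))"
        using \<iota>_\<delta>[OF alg_aut_in_B[OF \<phi> W]] conj_\<iota>[OF W, of \<phi>] by simp
      finally show ?thesis .
    qed
    then show ?thesis by (metis \<iota>_in_Bs \<kappa>_in_B \<iota>_\<kappa>)
  qed
  then show ?thesis by (auto simp: alg_aut_comm_def)
qed

lemma subgroup_Autd: "subgroup Autd (BijGroup (carrier B))"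
  using \<delta>_in_B by (intro subgroup_alg_aut_comm BR.ring_axioms) auto

sublocale GR: group G
  unfolding alg_aut_comm_group_def by (rule subgroup.subgroup_is_group[OF subgroup_Autd group_BijGroup])

lemma carrier_G [simp]: "carrier G = Autd"
  by (simp add: alg_aut_comm_group_def)

lemma Autd_Bij: "\<phi> \<in> Autd \<Longrightarrow> \<phi> \<in> Bij (carrier B)"
  by (simp add: alg_aut_comm_def alg_aut_def)

lemma Autd_alg_aut: "\<phi> \<in> Autd \<Longrightarrow> \<phi> \<in> alg_aut B \<eta>"
  by (simp add: alg_aut_comm_def)

lemma Autd_in_B: "\<phi> \<in> Autd \<Longrightarrow> W \<in> carrier B \<Longrightarrow> \<phi> W \<in> carrier B"
  using alg_aut_in_B Autd_alg_aut by blast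

lemma G_mult: "\<phi> \<in> Autd \<Longrightarrow> \<psi> \<in> Autd \<Longrightarrow> W \<in> carrier B \<Longrightarrow> (\<phi> \<otimes>\<^bsub>G\<^esub> \<psi>) W = \<phi> (\<psi> W)"
  by (simp add: alg_aut_comm_group_def BijGroup_def Autd_Bij compose_eq)

lemma G_one: "\<one>\<^bsub>G\<^esub> = (\<lambda>W\<in>carrier B. W)"
  by (simp add: alg_aut_comm_group_def BijGroup_def)

lemma G_inv_in: "\<phi> \<in> Autd \<Longrightarrow> inv\<^bsub>G\<^esub> \<phi> \<in> Autd"
  using GR.inv_closed[of \<phi>] by simp

lemma G_inv:
  assumes "\<phi> \<in> Autd" "W \<in> carrier B"
  shows "\<phi> ((inv\<^bsub>G\<^esub> \<phi>) W) = W" "(inv\<^bsub>G\<^esub> \<phi>) (\<phi> W) = W"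
  using G_mult[OF assms(1) G_inv_in[OF assms(1)] assms(2)] G_mult[OF G_inv_in[OF assms(1)] assms]
    GR.r_inv[of \<phi>] GR.l_inv[of \<phi>] assms by (simp_all add: G_one)

lemma der_automorphism_conj:
  assumes \<phi>: "\<phi> \<in> Autd"
  shows "der_automorphism V e1 e2 eh (l 1) c (conj \<phi>) (conj (inv\<^bsub>G\<^esub> \<phi>))"
proof unfold_locales
  note \<phi>' = G_inv_in[OF \<phi>]
  show "endo (conj \<phi>)" "endo (conj (inv\<^bsub>G\<^esub> \<phi>))"
    using \<phi> \<phi>' by (auto intro: endo_conj Autd_alg_aut)
  show "conj (inv\<^bsub>G\<^esub> \<phi>) (conj \<phi> f) = f" "conj \<phi> (conj (inv\<^bsub>G\<^esub> \<phi>) f) = f" if "f \<in> Bs" for f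
    using that \<phi> \<phi>' by (simp_all add: conj_def \<kappa>_\<iota> \<kappa>_in_B Autd_in_B G_inv \<iota>_\<kappa>)
  show "conj \<phi> (der f) = der (conj \<phi> f)" if "f \<in> Bs" for f
    using \<phi> that by (simp add: Autd_iff)
qed

text \<open>The kernel of \<open>\<delta>\<close> is invariant. This is why the pointwise stabiliser of \<open>A\<close> is normal.\<close>

lemma Autd_Polys_V:
  assumes \<phi>: "\<phi> \<in> Autd" and p: "p \<in> Polys V"
  shows "\<exists>r\<in>Polys V. \<phi> (\<pi> p) = \<pi> r"
proof -
  interpret der_automorphism V e1 e2 eh "l 1" c "conj \<phi>" "conj (inv\<^bsub>G\<^esub> \<phi>)"
    by (rule der_automorphism_conj[OF \<phi>])
  have "\<iota> (\<phi> (\<pi> p)) = \<iota> (\<pi> (A p))"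
    using F_emb[OF p] A_in_Polys[OF p] by (simp add: conj_emb p \<iota>_\<pi> Polys_V_V0 ev_emb)
  then have "\<phi> (\<pi> p) = \<pi> (A p)"
    by (rule \<iota>_inj[rotated 2]) (auto intro!: Autd_in_B[OF \<phi>] \<pi>_in_B Polys_V_V0 p A_in_Polys)
  then show ?thesis using A_in_Polys[OF p] by blast
qed

lemma \<iota>_finsum:
  "finite J \<Longrightarrow> (\<And>i. i \<in> J \<Longrightarrow> f i \<in> carrier B) \<Longrightarrow> \<iota> (finsum B f J) = (\<Sum>i\<in>J. \<iota> (f i))"
proof (induction J rule: finite_induct)
  case (insert j J)
  then have f: "f \<in> J \<rightarrow> carrier B" by auto
  then have "\<iota> (finsum B f (insert j J)) = \<iota> (f j \<oplus>\<^bsub>B\<^esub> finsum B f J)"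
    using insert by (subst BR.finsum_insert) auto
  then show ?case using insert BR.finsum_closed[OF f] by (simp add: \<iota>_add)
qed simp

lemma
  assumes D_B: "\<And>W. W \<in> carrier B \<Longrightarrow> D W \<in> carrier B"
    and D: "\<And>W. W \<in> carrier B \<Longrightarrow> \<iota> (D W) = smult \<beta> (pderiv (\<iota> W))"
  shows exp_der_in_Autd: "exp_der B \<eta> D \<in> Autd"
    and \<iota>_exp_der: "W \<in> carrier B \<Longrightarrow> \<iota> (exp_der B \<eta> D W) = translate \<beta> (\<iota> W)"
proof -
  have \<beta>: "smult \<beta> (pderiv f) \<in> Bs" if "f \<in> Bs" for f
    using D[OF \<kappa>_in_B[OF that]] \<iota>_in_Bs[OF D_B[OF \<kappa>_in_B[OF that]]] that by (simp add: \<iota>_\<kappa>)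
  have \<beta>': "smult (- \<beta>) (pderiv f) \<in> Bs" if "f \<in> Bs" for f
    using Bs_uminus[OF \<beta>[OF that]] by simp
  have translate: "endo (translate \<beta>)" "endo (translate (- \<beta>))"
    using endo_translate[of \<beta>] endo_translate[of "- \<beta>"] \<beta> \<beta>' by blast+
  have funpow_B: "(D ^^ i) W \<in> carrier B" if "W \<in> carrier B" for i W
    by (induction i) (simp_all add: that D_B)
  have \<iota>_funpow: "\<iota> ((D ^^ i) W) = smult (\<beta> ^ i) ((pderiv ^^ i) (\<iota> W))" if "W \<in> carrier B" for i W
    by (induction i) (simp_all add: D funpow_B that pderiv_smult)
  have \<iota>_exp: "\<iota> (exp_der B \<eta> D W) = translate \<beta> (\<iota> W)" if W: "W \<in> carrier B" for W
  proof -
    let ?J = "{i. (D ^^ i) W \<noteq> \<zero>\<^bsub>B\<^esub>}" and ?N = "Suc (degree (\<iota> W))"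
    have zero: "(D ^^ i) W = \<zero>\<^bsub>B\<^esub>" if "i \<ge> ?N" for i
    proof (rule \<iota>_inj)
      have "(pderiv ^^ i) (\<iota> W) = 0" using that by (intro pderiv_funpow_degree) simp
      then show "\<iota> ((D ^^ i) W) = \<iota> \<zero>\<^bsub>B\<^esub>" by (simp add: \<iota>_funpow W)
    qed (simp_all add: funpow_B W)
    then have J: "?J \<subseteq> {..<?N}" by (auto simp: not_le[symmetric])
    have "\<iota> (exp_der B \<eta> D W) = (\<Sum>i\<in>?J. \<iota> (\<eta> (1 / fact i) \<otimes>\<^bsub>B\<^esub> (D ^^ i) W))"
      using W finite_subset[OF J] by (simp add: exp_der_def \<iota>_finsum \<eta>_in_B funpow_B)
    also have "\<dots> = (\<Sum>i\<in>?J. smult (\<beta> ^ i / fact i) ((pderiv ^^ i) (\<iota> W)))"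
      by (intro sum.cong) (simp_all add: \<iota>_mult \<eta>_in_B funpow_B W \<iota>_funpow to_fract_Const_fact)
    also have "\<dots> = (\<Sum>i<?N. smult (\<beta> ^ i / fact i) ((pderiv ^^ i) (\<iota> W)))"
    proof (rule sum.mono_neutral_left)
      show "\<forall>i\<in>{..<?N} - ?J. smult (\<beta> ^ i / fact i) ((pderiv ^^ i) (\<iota> W)) = 0"
      proof
        fix i assume "i \<in> {..<?N} - ?J"
        then have "smult (\<beta> ^ i) ((pderiv ^^ i) (\<iota> W)) = 0"
          using \<iota>_funpow[OF W, of i] by simp
        then show "smult (\<beta> ^ i / fact i) ((pderiv ^^ i) (\<iota> W)) = 0" by auto
      qed
    qed (use J in auto)
    also have "\<dots> = translate \<beta> (\<iota> W)" by (simp only: Taylor_pcompose lessI translate_def)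
    finally show ?thesis .
  qed
  have exp_B: "exp_der B \<eta> D W \<in> carrier B" if "W \<in> carrier B" for W
    using that by (auto simp: exp_der_def \<eta>_in_B funpow_B intro!: BR.finsum_closed)
  have exp_lift: "exp_der B \<eta> D = lift (translate \<beta>)"
  proof (rule extensionalityI[of _ "carrier B"])
    fix W assume W: "W \<in> carrier B"
    show "exp_der B \<eta> D W = lift (translate \<beta>) W"
      using \<kappa>_eq[OF exp_B[OF W] \<iota>_exp[OF W]] W by (simp add: lift_def)
  qed (simp_all add: exp_der_def lift_def)
  have "lift (translate \<beta>) \<in> alg_aut B \<eta>"
    using translate_inverse[of "- \<beta>"] by (intro lift_alg_aut[OF translate]) (simp_all add: translate_inverse)
  moreover have "conj (lift (translate \<beta>)) f = translate \<beta> f" if "f \<in> Bs" for f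
    using that by (simp add: conj_def \<iota>_lift translate \<kappa>_in_B \<iota>_\<kappa>)
  ultimately show "exp_der B \<eta> D \<in> Autd"
    unfolding exp_lift by (simp add: Autd_iff der_in_Bs translate_der)
  show "W \<in> carrier B \<Longrightarrow> \<iota> (exp_der B \<eta> D W) = translate \<beta> (\<iota> W)" by (rule \<iota>_exp)
qed

text \<open>The kernel of \<open>D\<close> contains \<open>A\<close>, so that \<open>D\<close> is \<open>b \<cdot> d/dz\<close> with \<open>b\<close> in \<open>A\<close>, and its exponential is a translation.
Translations by elements of \<open>A\<close> commute with \<open>h h\<^sub>1 \<cdot> d/dz\<close>.\<close>

lemma exp_der_in_fixing:
  assumes D: "LND B \<eta> D" and equiv: "LND_equiv B D \<delta> \<or> (\<forall>W\<in>carrier B. D W = \<zero>\<^bsub>B\<^esub>)"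
  shows "exp_der B \<eta> D \<in> Autd \<and> (\<forall>p\<in>Polys V. exp_der B \<eta> D (\<pi> p) = \<pi> p)"
proof -
  have der: "derivation B \<eta> D" using D by (simp add: LND_def)
  note rules = derivation_rules[OF der]
  have D_\<pi>: "D (\<pi> p) = \<zero>\<^bsub>B\<^esub>" if p: "p \<in> Polys V" for p
  proof -
    have \<pi>_p: "\<pi> p \<in> carrier B" using Polys_V_V0[OF p] by blast
    have "\<iota> (\<delta> (\<pi> p)) = 0" using \<iota>_\<delta>[OF \<pi>_p] p by (simp add: \<iota>_\<pi> Polys_V_V0 ev_emb)
    then have "\<pi> p \<in> der_kernel B \<delta>"
      using \<pi>_p \<iota>_eq_0_iff[OF \<delta>_in_B[OF \<pi>_p]] by (simp add: der_kernel_def)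
    then show ?thesis using equiv \<pi>_p by (auto simp: LND_equiv_def der_kernel_def)
  qed
  obtain i where i: "(D ^^ i) (\<kappa> zz) = \<zero>\<^bsub>B\<^esub>"
    using D \<kappa>_in_B[OF Bs_intros(2)] unfolding LND_def by blast
  have "(conj D ^^ i) zz = \<iota> ((D ^^ i) (\<kappa> zz)) \<and> (D ^^ i) (\<kappa> zz) \<in> carrier B" for i
    by (induction i) (simp_all add: \<iota>_\<kappa> \<kappa>_in_B Bs_intros conj_\<iota> rules(1))
  then have nilpotent: "(conj D ^^ i) zz = 0" using i by simp
  have "\<exists>b\<in>Polys V. \<forall>f\<in>Bs. conj D f = smult (to_fract b) (pderiv f)"
    by (rule locally_nilpotent_derivation_eq[OF rules(2) rules(3) rules(4) _ nilpotent])
      (simp_all add: conj_emb D_\<pi>)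
  then obtain b where b: "b \<in> Polys V" "\<And>f. f \<in> Bs \<Longrightarrow> conj D f = smult (to_fract b) (pderiv f)"
    by blast
  have \<iota>_D: "\<iota> (D W) = smult (to_fract b) (pderiv (\<iota> W))" if "W \<in> carrier B" for W
    using b(2)[of "\<iota> W"] that by (simp add: conj_\<iota> \<iota>_in_Bs)
  have exp: "exp_der B \<eta> D \<in> Autd" "W \<in> carrier B \<Longrightarrow> \<iota> (exp_der B \<eta> D W) = translate (to_fract b) (\<iota> W)" for W
    by (rule exp_der_in_Autd[OF rules(1) \<iota>_D] \<iota>_exp_der[OF rules(1) \<iota>_D]; assumption)+
  have "exp_der B \<eta> D (\<pi> p) = \<pi> p" if p: "p \<in> Polys V" for p
  proof (rule \<iota>_inj)
    show \<pi>_p: "\<pi> p \<in> carrier B" using Polys_V_V0[OF p] by blast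
    show "exp_der B \<eta> D (\<pi> p) \<in> carrier B" using Autd_in_B[OF exp(1) \<pi>_p] .
    show "\<iota> (exp_der B \<eta> D (\<pi> p)) = \<iota> (\<pi> p)"
      using exp(2)[OF \<pi>_p] p by (simp add: \<iota>_\<pi> Polys_V_V0 ev_emb translate_def)
  qed
  with exp(1) show ?thesis by blast
qed


text \<open>If all letters of \<open>A\<close> are fixed, the scalars \<open>lam v\<close> in \<open>classification\<close> are \<open>1\<close>, and the slope is a product of them.\<close>

lemma fixing_translation:
  assumes \<phi>: "\<phi> \<in> Autd" and fixing: "\<And>v. v \<in> V \<Longrightarrow> \<phi> (\<pi> (Var v)) = \<pi> (Var v)"
  shows "\<exists>g\<in>Polys V. \<iota> (\<phi> (\<pi> (Var (VZ 1)))) = [:m1 * to_fract g, 1:]"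
proof -
  interpret der_automorphism V e1 e2 eh "l 1" c "conj \<phi>" "conj (inv\<^bsub>G\<^esub> \<phi>)"
    by (rule der_automorphism_conj[OF \<phi>])
  obtain \<sigma> lam d g where "\<sigma> permutes V" "\<And>v. v \<in> V \<Longrightarrow> lam v \<noteq> 0" "d \<noteq> 0" "g \<in> Polys V"
    "\<And>v. v \<in> V \<Longrightarrow> conj \<phi> (emb (Var v)) = emb (Const (lam v) * Var (\<sigma> v))"
    "conj \<phi> zz = [:to_fract (mon e1 * g), to_fract (Const d):]"
    "permute \<sigma> e1 = e1" "permute \<sigma> e2 = e2" "permute \<sigma> eh = eh"
    "weight lam e2 * d ^ l 1 = 1" "weight lam eh * weight lam e1 = d"
    by (rule classification) (rule that)
  note cl = this(4,5,6,11)
  have lam: "lam v = 1" if v: "v \<in> V" for v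
  proof -
    have "emb (Var v) = emb (Const (lam v) * Var (\<sigma> v))"
      using cl(2)[OF v] conj_emb[of "Var v" \<phi>] fixing[OF v] v V_subset_V0
      by (simp add: \<iota>_\<pi> subsetD ev_Var)
    then have "single (single v 1) 1 = (single (single (\<sigma> v) 1) (lam v) :: 'a mpoly)"
      by (simp add: Var_def Const_def mult_single)
    then show ?thesis using single_eq_imp by fastforce
  qed
  have "weight lam eh = 1" "weight lam e1 = 1"
    using lam subsetD[OF keys_V(1)] subsetD[OF keys_V(3)] by (simp_all add: weight_1)
  then have "d = 1" using cl(4) by simp
  then show ?thesis using cl(1,3) by (auto simp: conj_zz m1_def)
qed

text \<open>The translation by \<open>h\<^sub>1 g\<close> is the exponential of \<open>h\<^sub>1 g \<cdot> d/dz\<close>, a derivation of \<open>B\<close> because of the factor \<open>h\<^sub>1\<close>. Its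
kernel is \<open>A\<close> unless \<open>g = 0\<close>.\<close>

lemma fixing_in_U:
  assumes \<phi>: "\<phi> \<in> Autd" and fixing: "\<And>v. v \<in> V \<Longrightarrow> \<phi> (\<pi> (Var v)) = \<pi> (Var v)"
  shows "\<phi> \<in> U_group B \<eta> \<delta>"
proof -
  obtain g where g: "g \<in> Polys V" "\<iota> (\<phi> (\<pi> (Var (VZ 1)))) = [:m1 * to_fract g, 1:]"
    using fixing_translation[OF assms] by blast
  let ?\<beta> = "m1 * to_fract g"
  define D where "D W = \<kappa> (smult ?\<beta> (pderiv (\<iota> W)))" for W
  have in_Bs: "smult ?\<beta> (pderiv (\<iota> W)) \<in> Bs" if "W \<in> carrier B" for W
    using smult_pderiv_in_Bs[OF g(1) \<iota>_in_Bs[OF that]] .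
  have D_B: "D W \<in> carrier B" and \<iota>_D: "\<iota> (D W) = smult ?\<beta> (pderiv (\<iota> W))" if "W \<in> carrier B" for W
    unfolding D_def using in_Bs[OF that] by (auto simp: \<iota>_\<kappa>)
  have "derivation B \<eta> D"
    unfolding derivation_def
  proof (intro conjI ballI allI)
    show "D \<in> carrier B \<rightarrow> carrier B" using D_B by blast
    fix W Y assume WY: "W \<in> carrier B" "Y \<in> carrier B"
    show "D (W \<oplus>\<^bsub>B\<^esub> Y) = D W \<oplus>\<^bsub>B\<^esub> D Y"
      by (rule \<iota>_inj) (simp_all add: WY D_B \<iota>_D \<iota>_add pderiv_add smult_add_right)
    show "D (W \<otimes>\<^bsub>B\<^esub> Y) = D W \<otimes>\<^bsub>B\<^esub> Y \<oplus>\<^bsub>B\<^esub> W \<otimes>\<^bsub>B\<^esub> D Y"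
      by (rule \<iota>_inj) (simp_all add: WY D_B \<iota>_D \<iota>_add \<iota>_mult pderiv_mult smult_add_right algebra_simps)
  next
    fix b W assume W: "W \<in> carrier B"
    show "D (\<eta> b \<otimes>\<^bsub>B\<^esub> W) = \<eta> b \<otimes>\<^bsub>B\<^esub> D W"
      by (rule \<iota>_inj) (simp_all add: W D_B \<iota>_D \<iota>_mult \<eta>_in_B pderiv_smult mult.commute)
  qed
  moreover have "\<exists>i. (D ^^ i) W = \<zero>\<^bsub>B\<^esub>" if W: "W \<in> carrier B" for W
  proof -
    have *: "(D ^^ i) W \<in> carrier B \<and> \<iota> ((D ^^ i) W) = smult (?\<beta> ^ i) ((pderiv ^^ i) (\<iota> W))" for i
      by (induction i) (simp_all add: W D_B \<iota>_D pderiv_smult)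
    have "\<iota> ((D ^^ Suc (degree (\<iota> W))) W) = 0"
      using *[of "Suc (degree (\<iota> W))"] pderiv_funpow_degree[of "\<iota> W" "Suc (degree (\<iota> W))"]
      by (simp only: lessI smult_0_right)
    then show ?thesis using * \<iota>_eq_0_iff by blast
  qed
  ultimately have LND_D: "LND B \<eta> D" by (simp add: LND_def)
  have "LND_equiv B D \<delta> \<or> (\<forall>W\<in>carrier B. D W = \<zero>\<^bsub>B\<^esub>)"
  proof (cases "?\<beta> = 0")
    case True
    then have "D W = \<zero>\<^bsub>B\<^esub>" if "W \<in> carrier B" for W
      using \<iota>_D[OF that] \<iota>_eq_0_iff[OF D_B[OF that]] by (simp del: mult_eq_0_iff)
    then show ?thesis by blast
  next
    case False
    have "D W = \<zero>\<^bsub>B\<^esub> \<longleftrightarrow> \<delta> W = \<zero>\<^bsub>B\<^esub>" if W: "W \<in> carrier B" for W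
    proof -
      have "D W = \<zero>\<^bsub>B\<^esub> \<longleftrightarrow> smult ?\<beta> (pderiv (\<iota> W)) = 0"
        using \<iota>_eq_0_iff[OF D_B[OF W]] \<iota>_D[OF W] by simp
      also have "\<dots> \<longleftrightarrow> der (\<iota> W) = 0"
        using False unfolding der_eq_0_iff smult_eq_0_iff pderiv_eq_0_iff by blast
      also have "\<dots> \<longleftrightarrow> \<delta> W = \<zero>\<^bsub>B\<^esub>"
        using \<iota>_eq_0_iff[OF \<delta>_in_B[OF W]] \<iota>_\<delta>[OF W] by simp
      finally show ?thesis .
    qed
    then show ?thesis by (auto simp: LND_equiv_def der_kernel_def)
  qed
  moreover have "exp_der B \<eta> D = \<phi>"
  proof (rule alg_aut_eqI)
    have exp: "exp_der B \<eta> D \<in> Autd" "W \<in> carrier B \<Longrightarrow> \<iota> (exp_der B \<eta> D W) = translate ?\<beta> (\<iota> W)" for W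
      by (rule exp_der_in_Autd[OF D_B \<iota>_D] \<iota>_exp_der[OF D_B \<iota>_D]; assumption)+
    show "exp_der B \<eta> D \<in> alg_aut B \<eta>" by (rule Autd_alg_aut[OF exp(1)])
    show "\<phi> \<in> alg_aut B \<eta>" by (rule Autd_alg_aut[OF \<phi>])
    show "\<iota> (exp_der B \<eta> D (\<pi> (Var v))) = \<iota> (\<phi> (\<pi> (Var v)))" if v: "v \<in> V" for v
      using exp(2)[of "\<pi> (Var v)"] v V_subset_V0 fixing[OF v]
      by (simp add: \<pi>_in_B subsetD \<iota>_\<pi> ev_Var translate_def)
    show "\<iota> (exp_der B \<eta> D (\<pi> (Var (VZ 1)))) = \<iota> (\<phi> (\<pi> (Var (VZ 1))))"
      using exp(2)[of "\<pi> (Var (VZ 1))"] g(2)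
      by (simp add: \<pi>_in_B \<iota>_\<pi> ev_Var translate_def pcompose_pCons)
  qed
  ultimately show ?thesis using LND_D unfolding U_group_def by blast
qed

text \<open>This description makes both the group structure and the normality of \<open>U(\<delta>)\<close> evident.\<close>

lemma U_group_eq: "U_group B \<eta> \<delta> = {\<phi> \<in> Autd. \<forall>p\<in>Polys V. \<phi> (\<pi> p) = \<pi> p}"
proof (intro equalityI subsetI)
  fix \<phi> assume "\<phi> \<in> U_group B \<eta> \<delta>"
  then show "\<phi> \<in> {\<phi> \<in> Autd. \<forall>p\<in>Polys V. \<phi> (\<pi> p) = \<pi> p}"
    using exp_der_in_fixing by (auto simp: U_group_def)
next
  fix \<phi> assume "\<phi> \<in> {\<phi> \<in> Autd. \<forall>p\<in>Polys V. \<phi> (\<pi> p) = \<pi> p}"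
  then show "\<phi> \<in> U_group B \<eta> \<delta>" by (intro fixing_in_U) auto
qed

lemma U_normal: "U_group B \<eta> \<delta> \<lhd> G"
proof (rule GR.normal_invI)
  show "subgroup (U_group B \<eta> \<delta>) G"
  proof (rule GR.subgroupI)
    show "U_group B \<eta> \<delta> \<subseteq> carrier G" by (auto simp: U_group_eq)
    have "\<one>\<^bsub>G\<^esub> \<in> U_group B \<eta> \<delta>"
      using GR.one_closed Polys_V_V0 by (auto simp: U_group_eq G_one \<pi>_in_B)
    then show "U_group B \<eta> \<delta> \<noteq> {}" by blast
  next
    fix \<phi> assume "\<phi> \<in> U_group B \<eta> \<delta>"
    then have \<phi>: "\<phi> \<in> Autd" "\<And>p. p \<in> Polys V \<Longrightarrow> \<phi> (\<pi> p) = \<pi> p" by (auto simp: U_group_eq)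
    have "(inv\<^bsub>G\<^esub> \<phi>) (\<pi> p) = \<pi> p" if "p \<in> Polys V" for p
      using G_inv(2)[OF \<phi>(1), of "\<pi> p"] \<phi>(2)[OF that] Polys_V_V0[OF that] by (simp add: \<pi>_in_B)
    then show "inv\<^bsub>G\<^esub> \<phi> \<in> U_group B \<eta> \<delta>" using G_inv_in[OF \<phi>(1)] by (simp add: U_group_eq)
  next
    fix \<phi> \<psi> assume "\<phi> \<in> U_group B \<eta> \<delta>" "\<psi> \<in> U_group B \<eta> \<delta>"
    then have *: "\<phi> \<in> Autd" "\<psi> \<in> Autd" "\<And>p. p \<in> Polys V \<Longrightarrow> \<phi> (\<pi> p) = \<pi> p" "\<And>p. p \<in> Polys V \<Longrightarrow> \<psi> (\<pi> p) = \<pi> p"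
      by (auto simp: U_group_eq)
    moreover have "\<phi> \<otimes>\<^bsub>G\<^esub> \<psi> \<in> Autd" using * GR.m_closed[of \<phi> \<psi>] by simp
    ultimately show "\<phi> \<otimes>\<^bsub>G\<^esub> \<psi> \<in> U_group B \<eta> \<delta>"
      by (simp add: U_group_eq G_mult \<pi>_in_B Polys_V_V0)
  qed
next
  fix \<phi> u assume \<phi>': "\<phi> \<in> carrier G" and u': "u \<in> U_group B \<eta> \<delta>"
  then have \<phi>: "\<phi> \<in> Autd" and u: "u \<in> Autd" "\<And>p. p \<in> Polys V \<Longrightarrow> u (\<pi> p) = \<pi> p" by (auto simp: U_group_eq)
  have \<phi>u: "\<phi> \<otimes>\<^bsub>G\<^esub> u \<in> Autd" using GR.m_closed[of \<phi> u] \<phi> u by simp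
  have "(\<phi> \<otimes>\<^bsub>G\<^esub> u \<otimes>\<^bsub>G\<^esub> inv\<^bsub>G\<^esub> \<phi>) (\<pi> p) = \<pi> p" if p: "p \<in> Polys V" for p
  proof -
    have \<pi>_p: "\<pi> p \<in> carrier B" using Polys_V_V0[OF p] by blast
    obtain r where r: "r \<in> Polys V" "(inv\<^bsub>G\<^esub> \<phi>) (\<pi> p) = \<pi> r"
      using Autd_Polys_V[OF G_inv_in[OF \<phi>] p] by blast
    have \<pi>_r: "\<pi> r \<in> carrier B" using Polys_V_V0[OF r(1)] by blast
    have "(\<phi> \<otimes>\<^bsub>G\<^esub> u \<otimes>\<^bsub>G\<^esub> inv\<^bsub>G\<^esub> \<phi>) (\<pi> p) = \<phi> (u (\<pi> r))"
      using G_mult[OF \<phi>u G_inv_in[OF \<phi>] \<pi>_p] G_mult[OF \<phi> u(1) \<pi>_r] r(2) by simp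
    also have "\<dots> = \<phi> ((inv\<^bsub>G\<^esub> \<phi>) (\<pi> p))" using u(2)[OF r(1)] r(2) by simp
    also have "\<dots> = \<pi> p" by (rule G_inv(1)[OF \<phi> \<pi>_p])
    finally show ?thesis .
  qed
  moreover have "\<phi> \<otimes>\<^bsub>G\<^esub> u \<otimes>\<^bsub>G\<^esub> inv\<^bsub>G\<^esub> \<phi> \<in> Autd"
    using GR.m_closed[of "\<phi> \<otimes>\<^bsub>G\<^esub> u" "inv\<^bsub>G\<^esub> \<phi>"] \<phi>u G_inv_in[OF \<phi>] by simp
  ultimately show "\<phi> \<otimes>\<^bsub>G\<^esub> u \<otimes>\<^bsub>G\<^esub> inv\<^bsub>G\<^esub> \<phi> \<in> U_group B \<eta> \<delta>" by (simp add: U_group_eq)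
qed

end


section \<open>Homogeneous polynomials and the quasitorus\<close>

lemma weight_single: "weight t (single v i) = t v ^ i"
  by (cases "i = 0") (simp_all add: weight_def)

lemma weight_add: "weight t (e + f) = weight t e * weight t f"
proof -
  interpret coefficient_hom "\<lambda>x :: 'a. x" by standard simp_all
  show ?thesis unfolding weight_def by (rule prod_power_lookup_add)
qed

lemma weight_0 [simp]: "weight t 0 = 1"
  by (simp add: weight_def)

lemma weight_sum: "weight t (sum f I) = (\<Prod>i\<in>I. weight t (f i))"
  by (induction I rule: infinite_finite_induct) (simp_all add: weight_add)

lemma weight_cong: "(\<And>v. v \<in> keys e \<Longrightarrow> t v = t' v) \<Longrightarrow> weight t e = weight t' e"
  by (simp add: weight_def)

lemma weight_mult: "weight (\<lambda>v. t v * t' v) e = weight t e * weight t' e"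
  by (simp add: weight_def power_mult_distrib prod.distrib)

lemma weight_inverse:
  fixes t :: "letter \<Rightarrow> 'a::field"
  shows "weight (\<lambda>v. inverse (t v)) e = inverse (weight t e)"
  by (simp add: weight_def power_inverse prod_inversef[unfolded comp_def])

lemma weight_permute: "bij \<sigma> \<Longrightarrow> weight t (permute \<sigma> e) = weight (\<lambda>v. t (\<sigma> v)) e"
  by (simp add: permute_expansion weight_sum weight_single) (simp add: weight_def)

lemma permute_permute:
  assumes "bij \<sigma>" "bij \<tau>"
  shows "permute \<sigma> (permute \<tau> e) = permute (\<sigma> \<circ> \<tau>) e"
  using assms by (intro poly_mapping_eqI) (simp add: lookup_permute bij_comp o_inv_distrib)

lemma permute_id [simp]: "permute id e = e"
  by (intro poly_mapping_eqI) (simp add: lookup_permute)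

lemma lookup_map_int [simp]: "lookup (Poly_Mapping.map int e) v = int (lookup e v)"
  by (simp add: map.rep_eq when_def)

lemma map_int_0 [simp]: "Poly_Mapping.map int 0 = 0"
  by (rule poly_mapping_eqI) simp

lemma map_int_add: "Poly_Mapping.map int (e + f) = Poly_Mapping.map int e + Poly_Mapping.map int f"
  by (rule poly_mapping_eqI) (simp add: lookup_add)

lemma map_int_sum: "Poly_Mapping.map int (sum f I) = (\<Sum>i\<in>I. Poly_Mapping.map int (f i))"
  by (induction I rule: infinite_finite_induct) (simp_all add: map_int_add)

lemma map_int_single: "Poly_Mapping.map int (single v i) = single v (int i)"
  by simp

lemma frag_cmul_frag_of: "frag_cmul i (frag_of v) = single v i"
  by (rule poly_mapping_eqI) (simp add: lookup_single when_def)

lemma map_int_inject: "Poly_Mapping.map int e = Poly_Mapping.map int f \<Longrightarrow> e = f"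
  by (metis lookup_map_int of_nat_eq_iff poly_mapping_eqI)

lemma keys_map_int [simp]: "keys (Poly_Mapping.map int e) = keys e"
  by (auto simp: in_keys_iff)

context hypersurface
begin

text \<open>The exponents of the two monomials of the equation. Their degrees generate the relations of the grading group.\<close>

definition u1 :: "letter \<Rightarrow>\<^sub>0 nat" where "u1 = single (VX 1) 1 + e1"
definition u2 :: "letter \<Rightarrow>\<^sub>0 nat" where "u2 = single (VZ 1) (l 1) + e2"

abbreviation Fr where "Fr \<equiv> free_Abelian_group V0"
abbreviation Rel where "Rel \<equiv> relations k m n a l"
abbreviation dg where "dg \<equiv> deg_class k m n a l"

lemma keys_u: "keys u1 \<subseteq> V0" "keys u2 \<subseteq> V0"
proof -
  have "keys u1 \<subseteq> {VX 1} \<union> keys e1"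
    unfolding u1_def by (rule order_trans[OF keys_add]) auto
  then show "keys u1 \<subseteq> V0" using keys_V(1) V_subset_V0 VX1_VZ1 by blast
  have "keys u2 \<subseteq> {VZ 1} \<union> keys e2"
    unfolding u2_def by (rule order_trans[OF keys_add]) (auto split: if_splits)
  then show "keys u2 \<subseteq> V0" using keys_V(2) V_subset_V0 VX1_VZ1 by blast
qed

lemma relations_eq: "Rel = generate Fr {Poly_Mapping.map int u1, Poly_Mapping.map int u2}"
proof -
  have ranges: "{1..k} = insert 1 {2..k}" "{1..n} = insert 1 {2..n}" using k_ge_2 n_ge_2 by auto
  have "(\<Sum>i=1..k. frag_of (VX i)) + (\<Sum>j=1..m. frag_cmul (int (a j)) (frag_of (VY j))) = Poly_Mapping.map int u1"
    unfolding u1_def expo1_def map_int_add map_int_sum map_int_single frag_cmul_frag_of ranges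
    by (simp add: add.assoc)
  moreover have "(\<Sum>j=1..n. frag_cmul (int (l j)) (frag_of (VZ j))) = Poly_Mapping.map int u2"
    unfolding u2_def expo2_def map_int_add map_int_sum map_int_single frag_cmul_frag_of ranges
    by simp
  ultimately show ?thesis by (simp only: relations_def)
qed

lemma relations_imp_combination:
  assumes "e \<in> Rel"
  shows "\<exists>i j. e = frag_cmul i (Poly_Mapping.map int u1) + frag_cmul j (Poly_Mapping.map int u2)"
  using assms unfolding relations_eq
proof (induction rule: generate.induct)
  case one
  show ?case by (intro exI[of _ 0]) simp
next
  case (incl e)
  then consider "e = Poly_Mapping.map int u1" | "e = Poly_Mapping.map int u2" by blast
  then show ?case
  proof cases
    case 1
    then show ?thesis by (intro exI[of _ 1] exI[of _ 0]) simp
  next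
    case 2
    then show ?thesis by (intro exI[of _ 0] exI[of _ 1]) simp
  qed
next
  case (inv e)
  then consider "e = Poly_Mapping.map int u1" | "e = Poly_Mapping.map int u2" by blast
  then show ?case
  proof cases
    case 1
    then show ?thesis using keys_u by (intro exI[of _ "-1"] exI[of _ 0]) simp
  next
    case 2
    then show ?thesis using keys_u by (intro exI[of _ 0] exI[of _ "-1"]) simp
  qed
next
  case (eng e f)
  then obtain i j i' j' where
    "e = frag_cmul i (Poly_Mapping.map int u1) + frag_cmul j (Poly_Mapping.map int u2)"
    "f = frag_cmul i' (Poly_Mapping.map int u1) + frag_cmul j' (Poly_Mapping.map int u2)" by blast
  then show ?case
    by (intro exI[of _ "i + i'"] exI[of _ "j + j'"]) (simp add: frag_cmul_distrib ac_simps)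
qed

sublocale FG: comm_group Fr by (rule abelian_free_Abelian_group)

lemma subgroup_relations: "subgroup Rel Fr"
  unfolding relations_eq using keys_u by (intro FG.generate_is_subgroup) auto

lemma normal_relations: "Rel \<lhd> Fr"
  using subgroup_relations by (rule FG.subgroup_imp_normal)

lemma dg_self: "keys e \<subseteq> V0 \<Longrightarrow> e \<in> dg e"
  unfolding deg_class_def using FG.rcos_self[OF _ subgroup_relations, of e] by simp

lemma dg_memD: "e \<in> dg f \<Longrightarrow> \<exists>r\<in>Rel. e = r + f"
  by (auto simp: deg_class_def r_coset_def)

text \<open>The difference of two exponents of \<open>h\<close> is \<open>i u\<^sub>1 + j u\<^sub>2\<close> with integers \<open>i, j\<close>. Neither \<open>x\<^sub>1\<close> nor \<open>z\<^sub>1\<close> occurs in \<open>h\<close>, whereas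
\<open>x\<^sub>1\<close> occurs only in \<open>u\<^sub>1\<close> and \<open>z\<^sub>1\<close> only in \<open>u\<^sub>2\<close>. So \<open>i = j = 0\<close>.\<close>

lemma homogeneous_imp_monomial:
  fixes h :: "'a mpoly"
  assumes hom: "homogeneous k m n a l h" and h: "h \<noteq> 0" and occ: "occurring h \<subseteq> V"
  shows "\<exists>b e. b \<noteq> 0 \<and> keys e = occurring h \<and> h = Const b * mon e"
proof -
  have unique: "t = t'" if t: "t \<in> keys h" and t': "t' \<in> keys h" for t t'
  proof -
    have V: "keys t \<subseteq> V" "keys t' \<subseteq> V"
      using occ t t' by (auto simp: occurring_def)
    have "dg (Poly_Mapping.map int t) = dg (Poly_Mapping.map int t')"
      using hom t t' unfolding homogeneous_def by metis
    moreover have "Poly_Mapping.map int t \<in> dg (Poly_Mapping.map int t)"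
      using V(1) V_subset_V0 by (intro dg_self) auto
    ultimately obtain r where r: "r \<in> Rel" "Poly_Mapping.map int t = r + Poly_Mapping.map int t'"
      using dg_memD by metis
    obtain i j where ij: "r = frag_cmul i (Poly_Mapping.map int u1) + frag_cmul j (Poly_Mapping.map int u2)"
      using relations_imp_combination[OF r(1)] by blast
    have lookups: "int (lookup t v) = i * int (lookup u1 v) + j * int (lookup u2 v) + int (lookup t' v)" for v
      using arg_cong[OF r(2), of "\<lambda>p. lookup p v"] by (simp add: ij lookup_add)
    have zero: "lookup t (VX 1) = 0" "lookup t' (VX 1) = 0"
      "lookup t (VZ 1) = 0" "lookup t' (VZ 1) = 0"
      using V VX1_VZ1 by (auto simp: in_keys_iff)
    have "i = 0" using lookups[of "VX 1"] zero by (simp add: u1_def u2_def lookup_add lookup_single when_def)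
    moreover have "j = 0" using lookups[of "VZ 1"] zero l_ge_2 \<open>i = 0\<close>
      by (simp add: u1_def u2_def lookup_add lookup_single when_def)
    ultimately show "t = t'" using r(2) ij by (simp add: map_int_inject)
  qed
  obtain t where t: "t \<in> keys h" using h by (metis all_not_in_conv keys_eq_empty)
  then have keys: "keys h = {t}" using unique by blast
  then have "h = single t (lookup h t)"
    using sum_single_lookup[of h] by simp
  then have "h = Const (lookup h t) * mon t"
    by (simp only: single_conv_Const_mon[symmetric])
  moreover have "keys t = occurring h" by (simp add: occurring_def keys)
  moreover have "lookup h t \<noteq> 0" using t by (simp add: in_keys_iff)
  ultimately show ?thesis by blast
qed


subsection \<open>Characters\<close>

text \<open>The diagonal rescalings that leave both monomials of the equation invariant.\<close>

definition torus_point :: "(letter \<Rightarrow> 'a) \<Rightarrow> bool" where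
  "torus_point t \<longleftrightarrow> (\<forall>v\<in>V0. t v \<noteq> 0) \<and> weight t u1 = 1 \<and> weight t u2 = 1"

abbreviation KK :: "'a ring" where "KK \<equiv> ring_of_type_algebra"

lemma units_KK: "carrier (units_of KK) = {x. x \<noteq> 0}" "x \<otimes>\<^bsub>units_of KK\<^esub> y = x * y"
proof -
  have "x \<in> Units KK \<longleftrightarrow> x \<noteq> 0" for x
    by (auto simp: Units_def ring_of_type_algebra_def intro!: exI[of _ "inverse x"])
  then show "carrier (units_of KK) = {x. x \<noteq> 0}" by (auto simp: units_of_def)
  show "x \<otimes>\<^bsub>units_of KK\<^esub> y = x * y" by (simp add: units_of_def ring_of_type_algebra_def)
qed

lemma dg_hom: "dg \<in> hom Fr (grading_group k m n a l)"
  using normal.r_coset_hom_Mod[OF normal_relations] by (simp add: deg_class_def[abs_def] grading_group_def)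

lemma carrier_grading: "w \<in> carrier (grading_group k m n a l) \<Longrightarrow> \<exists>e. keys e \<subseteq> V0 \<and> w = dg e"
proof -
  assume "w \<in> carrier (grading_group k m n a l)"
  then have "w \<in> (\<Union>e\<in>carrier Fr. {Rel #>\<^bsub>Fr\<^esub> e})"
    by (simp only: grading_group_def FactGroup_def RCOSETS_def partial_object.simps)
  then obtain e where "e \<in> carrier Fr" "w = Rel #>\<^bsub>Fr\<^esub> e" by (elim UN_E singletonE)
  then show ?thesis by (intro exI[of _ e]) (simp add: deg_class_def)
qed

text \<open>A character of the grading group is a multiplicative function of the exponent that is trivial on the relations \<open>u1\<close>
and \<open>u2\<close>.\<close>

lemma character_torus_point:
  assumes \<chi>: "\<chi> \<in> hom (grading_group k m n a l) (units_of KK)"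
  shows "torus_point (\<lambda>v. \<chi> (dg (frag_of v)))"
proof -
  define \<psi> where "\<psi> e = \<chi> (dg e)" for e
  have nonzero: "\<psi> e \<noteq> 0" if "keys e \<subseteq> V0" for e
    using hom_in_carrier[OF \<chi> hom_in_carrier[OF dg_hom, of e]] that by (simp add: units_KK \<psi>_def)
  have add: "\<psi> (e + f) = \<psi> e * \<psi> f" if "keys e \<subseteq> V0" "keys f \<subseteq> V0" for e f
    using that hom_mult[OF dg_hom, of e f] hom_mult[OF \<chi>, of "dg e" "dg f"]
      hom_in_carrier[OF dg_hom, of e] hom_in_carrier[OF dg_hom, of f]
    by (simp add: \<psi>_def units_KK)
  have zero: "\<psi> 0 = 1" using add[of 0 0] nonzero[of 0] by simp
  have single: "\<psi> (single v (int i)) = \<psi> (frag_of v) ^ i" if "v \<in> V0" for v i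
  proof (induction i)
    case (Suc i)
    have "\<psi> (single v (int (Suc i))) = \<psi> (frag_of v + single v (int i))"
      by (simp add: single_add)
    also have "\<dots> = \<psi> (frag_of v) * \<psi> (single v (int i))"
      using that by (intro add) auto
    finally show ?case using Suc by simp
  qed (simp add: zero)
  have sum: "\<psi> (\<Sum>v\<in>W. single v (int (f v))) = (\<Prod>v\<in>W. \<psi> (frag_of v) ^ f v) \<and>
      keys (\<Sum>v\<in>W. single v (int (f v))) \<subseteq> V0"
    if "finite W" "W \<subseteq> V0" for W f
    using that
  proof (induction W rule: finite_induct)
    case (insert w W)
    have "keys (single w (int (f w))) \<subseteq> V0" using insert.prems by auto
    then show ?case
      using insert keys_add[of "single w (int (f w))" "\<Sum>v\<in>W. single v (int (f v))"]
      by (simp add: add single) blast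
  qed (simp add: zero)
  have weight: "\<psi> (Poly_Mapping.map int e) = weight (\<lambda>v. \<psi> (frag_of v)) e" if "keys e \<subseteq> V0" for e
  proof -
    have "Poly_Mapping.map int e = (\<Sum>v\<in>keys e. single v (int (lookup e v)))"
      using sum_single_lookup[of "Poly_Mapping.map int e"] by simp
    then show ?thesis using sum[OF finite_keys that] by (simp add: weight_def)
  qed
  have "\<psi> (Poly_Mapping.map int u) = 1" if "u \<in> {u1, u2}" for u
  proof -
    have "Poly_Mapping.map int u \<in> Rel" unfolding relations_eq using that by (intro generate.incl) blast
    moreover have "keys u \<subseteq> V0" using that keys_u by blast
    moreover have "0 \<in> Rel" using subgroup.one_closed[OF subgroup_relations] by simp
    ultimately have "dg (Poly_Mapping.map int u) = dg 0"
      using FG.coset_join2[OF _ subgroup_relations] by (simp add: deg_class_def)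
    then show ?thesis using zero by (simp add: \<psi>_def)
  qed
  then have "weight (\<lambda>v. \<psi> (frag_of v)) u1 = 1" "weight (\<lambda>v. \<psi> (frag_of v)) u2 = 1"
    using weight[OF keys_u(1)] weight[OF keys_u(2)] by simp_all
  then show ?thesis using nonzero by (auto simp: torus_point_def \<psi>_def keys_frag_of)
qed

text \<open>Conversely, \<open>e \<mapsto> \<Prod> t\<^sub>v\<^bsup>e\<^sub>v\<^esup>\<close> is trivial on the relations and descends to the cosets.\<close>

lemma torus_point_character:
  assumes t: "torus_point t"
  shows "\<exists>\<chi>\<in>hom (grading_group k m n a l) (units_of KK). \<forall>v\<in>V0. \<chi> (dg (frag_of v)) = t v"
proof -
  define \<psi> where "\<psi> e = (\<Prod>v\<in>V0. t v powi lookup e v)" for e :: "letter \<Rightarrow>\<^sub>0 int"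
  have t_nonzero: "t v \<noteq> 0" if "v \<in> V0" for v using t that by (simp add: torus_point_def)
  have nonzero: "\<psi> e \<noteq> 0" for e using t_nonzero finite_V0 by (simp add: \<psi>_def)
  have add: "\<psi> (e + f) = \<psi> e * \<psi> f" for e f
    unfolding \<psi>_def prod.distrib[symmetric] by (intro prod.cong) (simp_all add: lookup_add power_int_add t_nonzero)
  have zero: "\<psi> 0 = 1" by (simp add: \<psi>_def)
  have neg: "\<psi> (- e) = inverse (\<psi> e)" for e
    using add[of e "- e"] nonzero[of e] by (simp add: zero inverse_unique)
  have weight: "\<psi> (Poly_Mapping.map int e) = weight t e" if "keys e \<subseteq> V0" for e
    unfolding \<psi>_def weight_def using that finite_V0
    by (simp add: power_int_of_nat) (intro prod.mono_neutral_right; auto simp: in_keys_iff)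
  have Rel: "\<psi> e = 1" if "e \<in> Rel" for e
    using that unfolding relations_eq
  proof (induction rule: generate.induct)
    case (incl e)
    then show ?case using t keys_u by (auto simp: weight torus_point_def)
  next
    case (inv e)
    then have "\<psi> e = 1" "keys e \<subseteq> V0" using t keys_u by (auto simp: weight torus_point_def)
    then show ?case by (simp add: neg)
  qed (simp_all add: zero add)
  define \<chi> where "\<chi> w = \<psi> (SOME e. e \<in> w)" for w
  have \<chi>: "\<chi> (dg e) = \<psi> e" if "keys e \<subseteq> V0" for e
  proof -
    have "(SOME f. f \<in> dg e) \<in> dg e" using dg_self[OF that] by (rule someI)
    then obtain r where "r \<in> Rel" "(SOME f. f \<in> dg e) = r + e" using dg_memD by blast
    then show ?thesis by (simp add: \<chi>_def add Rel)
  qed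
  have "\<chi> \<in> hom (grading_group k m n a l) (units_of KK)"
  proof (rule homI)
    fix w assume "w \<in> carrier (grading_group k m n a l)"
    then show "\<chi> w \<in> carrier (units_of KK)"
      using carrier_grading[of w] nonzero by (auto simp: \<chi> units_KK)
  next
    fix w w' assume "w \<in> carrier (grading_group k m n a l)" "w' \<in> carrier (grading_group k m n a l)"
    then obtain e e' where e: "keys e \<subseteq> V0" "w = dg e" "keys e' \<subseteq> V0" "w' = dg e'"
      using carrier_grading by metis
    have "w \<otimes>\<^bsub>grading_group k m n a l\<^esub> w' = dg (e + e')"
      using hom_mult[OF dg_hom, of e e'] e by simp
    moreover have "keys (e + e') \<subseteq> V0" using keys_add[of e e'] e by blast
    ultimately show "\<chi> (w \<otimes>\<^bsub>grading_group k m n a l\<^esub> w') = \<chi> w \<otimes>\<^bsub>units_of KK\<^esub> \<chi> w'"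
      using e by (simp add: \<chi> add units_KK)
  qed
  moreover have "\<chi> (dg (frag_of v)) = t v" if v: "v \<in> V0" for v
  proof -
    have "\<psi> (frag_of v) = (\<Prod>w\<in>V0. if w = v then t v else 1)"
      unfolding \<psi>_def by (intro prod.cong) auto
    then show ?thesis using v finite_V0 by (simp add: \<chi> keys_frag_of)
  qed
  ultimately show ?thesis by blast
qed

text \<open>A renaming of the letters combined with a rescaling. The permutations in \<open>S\<^sub>\<delta>\<close> and the elements of the quasitorus are the
special cases where one of the two is trivial.\<close>

definition mono_subst :: "(letter \<Rightarrow> letter) \<Rightarrow> (letter \<Rightarrow> 'a) \<Rightarrow> letter \<Rightarrow> 'a mpoly" where
  "mono_subst \<sigma> t v = Const (t v) * Var (\<sigma> v)"

definition mono_map :: "(letter \<Rightarrow> letter) \<Rightarrow> (letter \<Rightarrow> 'a) \<Rightarrow> 'a mpoly set \<Rightarrow> 'a mpoly set" where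
  "mono_map \<sigma> t = induced k m n a l (mono_subst \<sigma> t)"

lemma quasitorus_eq: "quasitorus k m n a l = {mono_map id t | t. torus_point t}"
proof (intro equalityI subsetI)
  fix \<phi> :: "'a mpoly set \<Rightarrow> 'a mpoly set" assume "\<phi> \<in> quasitorus k m n a l"
  then obtain \<chi> where "\<chi> \<in> hom (grading_group k m n a l) (units_of KK)"
    "\<phi> = induced k m n a l (\<lambda>v. Const (\<chi> (dg (frag_of v))) * Var v)"
    by (auto simp: quasitorus_def)
  then show "\<phi> \<in> {mono_map id t | t. torus_point t}"
    using character_torus_point by (auto simp: mono_map_def mono_subst_def[abs_def])
next
  fix \<phi> assume "\<phi> \<in> {mono_map id t | t. torus_point t}"
  then obtain t where t: "torus_point t" "\<phi> = mono_map id t" by blast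
  then obtain \<chi> where \<chi>: "\<chi> \<in> hom (grading_group k m n a l) (units_of KK)" "\<forall>v\<in>V0. \<chi> (dg (frag_of v)) = t v"
    using torus_point_character by blast
  have "\<phi> = induced k m n a l (\<lambda>v. Const (\<chi> (dg (frag_of v))) * Var v)"
    unfolding t(2) mono_map_def using \<chi>(2) by (intro induced_cong) (simp add: mono_subst_def)
  then show "\<phi> \<in> quasitorus k m n a l" using \<chi>(1) by (auto simp: quasitorus_def)
qed

end


section \<open>Monomial automorphisms\<close>

context hypersurface
begin

text \<open>Such a permutation leaves the equation invariant, as it fixes \<open>x\<^sub>1\<close> and \<open>z\<^sub>1\<close>.\<close>

definition symmetry :: "(letter \<Rightarrow> letter) \<Rightarrow> bool" where
  "symmetry \<sigma> \<longleftrightarrow> \<sigma> permutes V \<and> permute \<sigma> e1 = e1 \<and> permute \<sigma> e2 = e2"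

lemma symmetry_bij: "symmetry \<sigma> \<Longrightarrow> bij \<sigma>"
  by (auto simp: symmetry_def permutes_bij)

lemma symmetry_fixes: "symmetry \<sigma> \<Longrightarrow> \<sigma> (VX 1) = VX 1" "symmetry \<sigma> \<Longrightarrow> \<sigma> (VZ 1) = VZ 1"
  using VX1_VZ1 by (auto simp: symmetry_def intro: permutes_not_in)

lemma symmetry_in_V: "symmetry \<sigma> \<Longrightarrow> \<sigma> v \<in> V \<longleftrightarrow> v \<in> V"
  by (simp add: symmetry_def permutes_in_image)

lemma symmetry_in_V0: "symmetry \<sigma> \<Longrightarrow> v \<in> V0 \<Longrightarrow> \<sigma> v \<in> V0"
  unfolding V0_eq using symmetry_fixes[of \<sigma>] symmetry_in_V[of \<sigma> v] by auto

lemma symmetry_u: "symmetry \<sigma> \<Longrightarrow> permute \<sigma> u1 = u1" "symmetry \<sigma> \<Longrightarrow> permute \<sigma> u2 = u2"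
  unfolding u1_def u2_def by (simp_all add: permute_add symmetry_bij permute_single symmetry_fixes) (simp_all add: symmetry_def)

lemma symmetry_comp: "symmetry \<sigma> \<Longrightarrow> symmetry \<tau> \<Longrightarrow> symmetry (\<sigma> \<circ> \<tau>)"
  by (auto simp: symmetry_def permutes_compose permutes_bij simp flip: permute_permute)

lemma permute_inv_eq: "bij \<sigma> \<Longrightarrow> permute \<sigma> e = e \<Longrightarrow> permute (Hilbert_Choice.inv \<sigma>) e = e"
  using permute_permute[of "Hilbert_Choice.inv \<sigma>" \<sigma> e]
  by (simp add: bij_imp_bij_inv bij_is_inj flip: id_def)

lemma symmetry_inv: "symmetry \<sigma> \<Longrightarrow> symmetry (Hilbert_Choice.inv \<sigma>)"
  by (auto simp: symmetry_def permutes_inv permute_inv_eq permutes_bij)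

lemma symmetry_inverses: "symmetry \<sigma> \<Longrightarrow> \<sigma> (Hilbert_Choice.inv \<sigma> v) = v" "symmetry \<sigma> \<Longrightarrow> Hilbert_Choice.inv \<sigma> (\<sigma> v) = v"
  by (auto simp: symmetry_def permutes_inverses)

lemma symmetry_id: "symmetry id"
  by (simp add: symmetry_def permutes_id)

lemma evalp_mono_subst_mon: "bij \<sigma> \<Longrightarrow> evalp Const (mono_subst \<sigma> t) (mon e) = Const (weight t e) * mon (permute \<sigma> e)"
  unfolding mono_subst_def[abs_def] by (rule evalp_monomial_map_mon)

lemma eq_mon: "eq = mon u1 - (mon u2 + 1)"
  by (simp add: eq_eq u1_def u2_def mon_add Var_power) (simp add: Var_def)

lemma mono_subst_admissible:
  assumes \<sigma>: "symmetry \<sigma>" and t: "torus_point t"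
  shows "admissible (mono_subst \<sigma> t)"
proof -
  have "evalp Const (mono_subst \<sigma> t) eq = eq"
    unfolding eq_mon using t
    by (simp add: subst.evalp_diff subst.evalp_add evalp_mono_subst_mon symmetry_bij[OF \<sigma>] symmetry_u[OF \<sigma>] torus_point_def del: single_one)
  then show ?thesis
    using symmetry_in_V0[OF \<sigma>] ev_eq by (auto simp: admissible_def mono_subst_def)
qed

lemma mono_map_\<pi>: "symmetry \<sigma> \<Longrightarrow> torus_point t \<Longrightarrow> p \<in> Polys V0 \<Longrightarrow> mono_map \<sigma> t (\<pi> p) = \<pi> (evalp Const (mono_subst \<sigma> t) p)"
  unfolding mono_map_def by (intro induced_\<pi> mono_subst_admissible)

lemma \<iota>_mono_map_Var:
  assumes "symmetry \<sigma>" "torus_point t" "v \<in> V0"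
  shows "\<iota> (mono_map \<sigma> t (\<pi> (Var v))) = ev (Const (t v) * Var (\<sigma> v))"
  using assms symmetry_in_V0[of \<sigma> v] by (simp add: mono_map_\<pi> \<iota>_\<pi> mono_subst_def Polys_mult)

lemma mono_map_Var: "symmetry \<sigma> \<Longrightarrow> torus_point t \<Longrightarrow> v \<in> V0 \<Longrightarrow> mono_map \<sigma> t (\<pi> (Var v)) = \<pi> (Const (t v) * Var (\<sigma> v))"
  by (simp add: mono_map_\<pi> mono_subst_def)

lemma torus_point_compose: "symmetry \<sigma> \<Longrightarrow> torus_point t \<Longrightarrow> torus_point t' \<Longrightarrow> torus_point (\<lambda>v. t' v * t (\<sigma> v))"
  using symmetry_in_V0[of \<sigma>] by (auto simp: torus_point_def weight_mult symmetry_u simp flip: weight_permute[OF symmetry_bij])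

lemma torus_point_inverse: "torus_point t \<Longrightarrow> torus_point (\<lambda>v. inverse (t v))"
  by (simp add: torus_point_def weight_inverse)

lemma torus_point_1: "torus_point (\<lambda>_. 1)"
  by (simp add: torus_point_def weight_1)

lemma mono_map_alg_aut:
  assumes \<sigma>: "symmetry \<sigma>" and t: "torus_point t"
  shows "mono_map \<sigma> t \<in> alg_aut B \<eta>"
proof -
  let ?\<tau> = "Hilbert_Choice.inv \<sigma>"
  let ?t = "\<lambda>v. inverse (t (?\<tau> v))"
  have \<tau>: "symmetry ?\<tau>" by (rule symmetry_inv[OF \<sigma>])
  have "torus_point ?t" using torus_point_compose[OF \<tau> torus_point_inverse[OF t] torus_point_1] by simp
  then have adm: "admissible (mono_subst \<sigma> t)" "admissible (mono_subst ?\<tau> ?t)"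
    using \<sigma> t \<tau> by (auto intro: mono_subst_admissible)
  have t_nonzero: "t v \<noteq> 0" if "v \<in> V0" for v using t that by (simp add: torus_point_def)
  show ?thesis
    unfolding mono_map_def
  proof (rule induced_alg_aut[OF adm])
    fix v assume v: "v \<in> V0"
    have "Const (inverse (t (?\<tau> v))) * Const (t (?\<tau> v)) = (1 :: 'a mpoly)"
      using t_nonzero[OF symmetry_in_V0[OF \<tau> v]] by (simp flip: Const_mult)
    then show "evalp Const (mono_subst \<sigma> t) (mono_subst ?\<tau> ?t v) = Var v"
      by (simp add: mono_subst_def subst.evalp_mult symmetry_inverses[OF \<sigma>] flip: mult.assoc)
    have "Const (t v) * Const (inverse (t v)) = (1 :: 'a mpoly)"
      using t_nonzero[OF v] by (simp flip: Const_mult)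
    then show "evalp Const (mono_subst ?\<tau> ?t) (mono_subst \<sigma> t v) = Var v"
      by (simp add: mono_subst_def subst.evalp_mult symmetry_inverses[OF \<sigma>] flip: mult.assoc)
  qed
qed

lemma ev_Const_Var: "v \<in> V \<Longrightarrow> ev (Const b * Var v) = emb (Const b * Var v)"
  "ev (Const b * Var (VZ 1)) = [:0, to_fract (Const b):]"
  by (simp_all add: ev_simps ev_Var mult.commute)

end


section \<open>The semidirect decomposition\<close>

text \<open>If \<open>S\<close> normalises \<open>H\<close>, then \<open>s h s' h' = s s' \<cdot> (s'\<^sup>-\<^sup>1 h s') h'\<close>, so that \<open>S H\<close> is a subgroup in which \<open>H\<close> is normal.\<close>

lemma (in group) semidirect_normalized_product:
  assumes S: "subgroup S G" and H: "subgroup H G"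
    and normalizes: "\<And>s h. s \<in> S \<Longrightarrow> h \<in> H \<Longrightarrow> s \<otimes> h \<otimes> inv s \<in> H"
    and trivial: "S \<inter> H = {\<one>}"
  shows "subgroup (S <#> H) G" and "semidirect (G\<lparr>carrier := S <#> H\<rparr>) S H"
proof -
  have S_G: "s \<in> S \<Longrightarrow> s \<in> carrier G" and H_G: "h \<in> H \<Longrightarrow> h \<in> carrier G" for s h
    using subgroup.mem_carrier[OF S] subgroup.mem_carrier[OF H] by auto
  have conj': "inv s \<otimes> h \<otimes> s \<in> H" if "s \<in> S" "h \<in> H" for s h
    using normalizes[of "inv s" h] that subgroup.m_inv_closed[OF S] S_G by simp
  have SH: "x \<in> S <#> H \<longleftrightarrow> (\<exists>s\<in>S. \<exists>h\<in>H. x = s \<otimes> h)" for x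
    by (auto simp: set_mult_def)
  show sub: "subgroup (S <#> H) G"
  proof (rule subgroupI)
    show "S <#> H \<subseteq> carrier G" using S_G H_G by (auto simp: SH)
    show "S <#> H \<noteq> {}" using subgroup.one_closed[OF S] subgroup.one_closed[OF H] by (auto simp: set_mult_def)
  next
    fix x assume "x \<in> S <#> H"
    then obtain s h where sh: "s \<in> S" "h \<in> H" "x = s \<otimes> h" by (auto simp: SH)
    have "inv x = inv s \<otimes> (s \<otimes> inv h \<otimes> inv s)"
      using sh S_G H_G by (simp add: inv_mult_group m_assoc[symmetric])
    then show "inv x \<in> S <#> H"
      using sh normalizes[of s "inv h"] subgroup.m_inv_closed[OF S] subgroup.m_inv_closed[OF H] by (auto simp: SH)
  next
    fix x y assume "x \<in> S <#> H" "y \<in> S <#> H"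
    then obtain s h s' h' where sh: "s \<in> S" "h \<in> H" "x = s \<otimes> h" "s' \<in> S" "h' \<in> H" "y = s' \<otimes> h'"
      by (auto simp: SH)
    have G: "s \<in> carrier G" "h \<in> carrier G" "s' \<in> carrier G" "h' \<in> carrier G" using sh S_G H_G by auto
    have "h \<otimes> s' = s' \<otimes> (inv s' \<otimes> h \<otimes> s')"
      using G by (simp add: m_assoc[symmetric])
    then have "x \<otimes> y = (s \<otimes> s') \<otimes> ((inv s' \<otimes> h \<otimes> s') \<otimes> h')"
      using sh G by (metis inv_closed m_assoc m_closed)
    then show "x \<otimes> y \<in> S <#> H"
      using sh conj' subgroup.m_closed[OF S] subgroup.m_closed[OF H] unfolding SH by blast
  qed
  let ?K = "G\<lparr>carrier := S <#> H\<rparr>"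
  have K: "group ?K" by (rule subgroup.subgroup_is_group[OF sub is_group])
  have S_SH: "S \<subseteq> S <#> H"
  proof
    fix s assume "s \<in> S"
    then show "s \<in> S <#> H" using subgroup.one_closed[OF H] S_G unfolding SH by (metis r_one)
  qed
  have H_SH: "H \<subseteq> S <#> H"
  proof
    fix h assume "h \<in> H"
    then show "h \<in> S <#> H" using subgroup.one_closed[OF S] H_G unfolding SH by (metis l_one)
  qed
  have "H \<lhd> ?K"
  proof (rule group.normal_invI[OF K])
    show "subgroup H ?K" by (rule subgroup_incl[OF H sub H_SH])
    fix x h assume x: "x \<in> carrier ?K" and h: "h \<in> H"
    then obtain s h' where sh: "s \<in> S" "h' \<in> H" "x = s \<otimes> h'" by (auto simp: SH)
    have G: "s \<in> carrier G" "h \<in> carrier G" "h' \<in> carrier G" using sh h S_G H_G by auto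
    have "x \<otimes> h \<otimes> inv x = s \<otimes> (h' \<otimes> h \<otimes> inv h') \<otimes> inv s"
      using sh G by (simp add: inv_mult_group m_assoc)
    moreover have "h' \<otimes> h \<otimes> inv h' \<in> H"
      using sh h subgroup.m_closed[OF H] subgroup.m_inv_closed[OF H] by blast
    ultimately have "x \<otimes> h \<otimes> inv x \<in> H" using normalizes[OF sh(1)] by simp
    moreover have "inv\<^bsub>?K\<^esub> x = inv x" using x by (intro m_inv_consistent sub) simp
    ultimately show "x \<otimes>\<^bsub>?K\<^esub> h \<otimes>\<^bsub>?K\<^esub> inv\<^bsub>?K\<^esub> x \<in> H" by simp
  qed
  moreover have "S <#>\<^bsub>?K\<^esub> H = carrier ?K" by (simp add: set_mult_def)
  ultimately show "semidirect ?K S H"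
    using K subgroup_incl[OF S sub S_SH] trivial by (simp add: semidirect_def)
qed

context hypersurface_der
begin

text \<open>The permutation preserves \<open>h\<close>, and the scalar by which \<open>h h\<^sub>1\<close> is multiplied is that of \<open>z\<^sub>1\<close>. This is the condition for
commuting with \<open>h h\<^sub>1 \<cdot> d/dz\<close>.\<close>

definition compatible :: "(letter \<Rightarrow> letter) \<Rightarrow> (letter \<Rightarrow> 'a) \<Rightarrow> bool" where
  "compatible \<sigma> t \<longleftrightarrow> symmetry \<sigma> \<and> permute \<sigma> eh = eh \<and> torus_point t \<and> weight t eh * weight t e1 = t (VZ 1)"

lemma compatible_symmetry: "compatible \<sigma> t \<Longrightarrow> symmetry \<sigma>" and compatible_torus_point: "compatible \<sigma> t \<Longrightarrow> torus_point t"
  by (simp_all add: compatible_def)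

lemma evalp_mono_subst_s:
  assumes "symmetry \<sigma>" "permute \<sigma> eh = eh"
  shows "evalp Const (mono_subst \<sigma> t) s = s * Const (weight t eh * weight t e1)"
proof -
  have "permute \<sigma> e1 = e1" using assms(1) by (simp add: symmetry_def)
  then show ?thesis
    unfolding s_def using assms
    by (simp add: subst.evalp_mult evalp_mono_subst_mon symmetry_bij Const_mult mult_ac del: single_one)
qed

text \<open>By \<open>endo_commutes_der\<close>, commuting has to be checked only at \<open>z\<^sub>1\<close>, where it is the last condition on compatibility.\<close>

lemma compatible_mono_map_in_Autd:
  assumes "compatible \<sigma> t"
  shows "mono_map \<sigma> t \<in> Autd"
proof -
  have \<sigma>: "symmetry \<sigma>" "permute \<sigma> eh = eh" and t: "torus_point t" "weight t eh * weight t e1 = t (VZ 1)"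
    using assms by (auto simp: compatible_def)
  have aut: "mono_map \<sigma> t \<in> alg_aut B \<eta>" by (rule mono_map_alg_aut[OF \<sigma>(1) t(1)])
  have mono_subst_V: "evalp Const (mono_subst \<sigma> t) p \<in> Polys V" if "p \<in> Polys V" for p
    using that by (rule subst_in_Polys) (auto simp: mono_subst_def symmetry_in_V[OF \<sigma>(1)])
  have conj_mono_map: "conj (mono_map \<sigma> t) (emb p) = emb (evalp Const (mono_subst \<sigma> t) p)" if p: "p \<in> Polys V" for p
    using mono_map_\<pi>[OF \<sigma>(1) t(1) Polys_V_V0[OF p]] mono_subst_V[OF p] p
    by (simp add: conj_emb \<iota>_\<pi> Polys_V_V0 ev_emb)
  have "conj (mono_map \<sigma> t) (der f) = der (conj (mono_map \<sigma> t) f)" if f: "f \<in> Bs" for f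
  proof (rule endo_commutes_der[OF endo_conj[OF aut] _ _ _ _ f])
    show "\<exists>r\<in>Polys V. conj (mono_map \<sigma> t) (emb p) = emb r" if "p \<in> Polys V" for p
      using conj_mono_map[OF that] mono_subst_V[OF that] by blast
    show "conj (mono_map \<sigma> t) (emb s) = emb (s * Const (t (VZ 1)))"
      by (simp only: conj_mono_map[OF s_in_Polys] evalp_mono_subst_s[OF \<sigma>] t(2))
    show "conj (mono_map \<sigma> t) zz = [:0, to_fract (Const (t (VZ 1))):]"
      by (simp add: conj_zz \<iota>_mono_map_Var[OF \<sigma>(1) t(1)] symmetry_fixes[OF \<sigma>(1)] ev_Const_Var)
    have "t v \<noteq> 0" if "v \<in> keys e1" for v
      using t(1) subsetD[OF V_subset_V0 subsetD[OF keys_V(1) that]] by (simp add: torus_point_def)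
    then have "weight t e1 \<noteq> 0" by (simp add: weight_def)
    then show "conj (mono_map \<sigma> t) (emb (mon e1)) \<noteq> 0"
      by (simp add: conj_mono_map evalp_mono_subst_mon symmetry_bij[OF \<sigma>(1)] del: single_one)
  qed
  then show ?thesis using aut by (simp add: Autd_iff)
qed

text \<open>Comparing both sides of \<open>\<phi> (\<delta> z\<^sub>1) = \<delta> (\<phi> z\<^sub>1)\<close>.\<close>

lemma mono_map_id_in_Autd_imp_compatible:
  assumes t: "torus_point t" and "mono_map id t \<in> Autd"
  shows "compatible id t"
proof -
  have "conj (mono_map id t) (der zz) = der (conj (mono_map id t) zz)"
    using assms(2) Bs_intros(2) by (simp add: Autd_iff)
  moreover have "conj (mono_map id t) zz = [:0, to_fract (Const (t (VZ 1))):]"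
    by (simp add: conj_zz \<iota>_mono_map_Var[OF symmetry_id t] ev_Const_Var)
  moreover have "conj (mono_map id t) (emb s) = emb (s * Const (weight t eh * weight t e1))"
  proof -
    have "evalp Const (mono_subst id t) s = s * Const (weight t eh * weight t e1)"
      by (rule evalp_mono_subst_s[OF symmetry_id]) simp
    then show ?thesis
      using mono_map_\<pi>[OF symmetry_id t Polys_V_V0[OF s_in_Polys]] s_in_Polys
      by (simp add: conj_emb \<iota>_\<pi> Polys_V_V0 Polys_mult ev_emb)
  qed
  ultimately have "to_fract (s * Const (weight t eh * weight t e1)) = to_fract (s * Const (t (VZ 1)))"
    unfolding der_zz by (simp add: der_def pderiv_pCons)
  then have "weight t eh * weight t e1 = t (VZ 1)"
    by (simp only: to_fract_eq_iff mult_cancel_left s_nonzero Const_eq_iff simp_thms)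
  then show ?thesis using t symmetry_id by (simp add: compatible_def)
qed

lemma compatible_comp: "compatible \<sigma> t \<Longrightarrow> compatible \<tau> t' \<Longrightarrow> compatible (\<sigma> \<circ> \<tau>) (\<lambda>v. t' v * t (\<tau> v))"
proof -
  assume \<sigma>: "compatible \<sigma> t" and \<tau>: "compatible \<tau> t'"
  note bij = symmetry_bij[OF compatible_symmetry[OF \<sigma>]] symmetry_bij[OF compatible_symmetry[OF \<tau>]]
  have "weight (\<lambda>v. t' v * t (\<tau> v)) e = weight t' e * weight t e" if "permute \<tau> e = e" for e
    using weight_permute[OF bij(2), of t e] that by (simp add: weight_mult)
  moreover have "permute \<tau> e1 = e1" "permute \<tau> eh = eh" "permute (\<sigma> \<circ> \<tau>) eh = eh"
    using \<sigma> \<tau> permute_permute[OF bij, of eh] by (auto simp: compatible_def symmetry_def)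
  moreover have "t' (VZ 1) = weight t' eh * weight t' e1" "t (VZ 1) = weight t eh * weight t e1"
    using \<sigma> \<tau> by (simp_all add: compatible_def)
  ultimately show ?thesis
    unfolding compatible_def
    using symmetry_comp[OF compatible_symmetry[OF \<sigma>] compatible_symmetry[OF \<tau>]] torus_point_compose[OF compatible_symmetry[OF \<tau>] compatible_torus_point[OF \<sigma>] compatible_torus_point[OF \<tau>]]
    by (simp add: symmetry_fixes(2)[OF compatible_symmetry[OF \<tau>]] mult_ac)
qed

lemma compatible_inv_symmetry: "compatible \<sigma> (\<lambda>_. 1) \<Longrightarrow> compatible (Hilbert_Choice.inv \<sigma>) (\<lambda>_. 1)"
  by (simp add: compatible_def symmetry_inv permute_inv_eq symmetry_bij)

lemma compatible_inverse: "compatible id t \<Longrightarrow> compatible id (\<lambda>v. inverse (t v))"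
  by (simp add: compatible_def torus_point_inverse weight_inverse flip: inverse_mult_distrib)

lemma compatible_id: "compatible id (\<lambda>_. 1)"
  by (simp add: compatible_def symmetry_id torus_point_1 weight_1)

lemma compatible_iff_symmetry: "compatible \<sigma> (\<lambda>_. 1) \<longleftrightarrow> symmetry \<sigma> \<and> permute \<sigma> eh = eh"
  by (simp add: compatible_def torus_point_1 weight_1)

lemma mono_map_mult:
  assumes \<sigma>: "compatible \<sigma> t" and \<tau>: "compatible \<tau> t'"
  shows "mono_map \<sigma> t \<otimes>\<^bsub>G\<^esub> mono_map \<tau> t' = mono_map (\<sigma> \<circ> \<tau>) (\<lambda>v. t' v * t (\<tau> v))"
proof -
  note comp = compatible_comp[OF \<sigma> \<tau>]
  have eq: "(mono_map \<sigma> t \<otimes>\<^bsub>G\<^esub> mono_map \<tau> t') (\<pi> (Var v)) = mono_map (\<sigma> \<circ> \<tau>) (\<lambda>v. t' v * t (\<tau> v)) (\<pi> (Var v))"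
    if v: "v \<in> V0" for v
  proof -
    have \<tau>v: "\<tau> v \<in> V0" by (rule symmetry_in_V0[OF compatible_symmetry[OF \<tau>] v])
    have "(mono_map \<sigma> t \<otimes>\<^bsub>G\<^esub> mono_map \<tau> t') (\<pi> (Var v)) = mono_map \<sigma> t (\<pi> (Const (t' v) * Var (\<tau> v)))"
      using v by (simp add: G_mult compatible_mono_map_in_Autd \<sigma> \<tau> \<pi>_in_B mono_map_Var compatible_symmetry[OF \<tau>] compatible_torus_point[OF \<tau>])
    also have "\<dots> = \<pi> (Const (t' v) * (Const (t (\<tau> v)) * Var (\<sigma> (\<tau> v))))"
      using \<tau>v by (simp add: mono_map_\<pi> compatible_symmetry[OF \<sigma>] compatible_torus_point[OF \<sigma>] Polys_mult subst.evalp_mult mono_subst_def)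
    also have "\<dots> = mono_map (\<sigma> \<circ> \<tau>) (\<lambda>v. t' v * t (\<tau> v)) (\<pi> (Var v))"
      using v by (simp add: mono_map_Var compatible_symmetry[OF comp] compatible_torus_point[OF comp] Const_mult mult.assoc)
    finally show ?thesis .
  qed
  have "mono_map \<sigma> t \<otimes>\<^bsub>G\<^esub> mono_map \<tau> t' \<in> Autd"
    using GR.m_closed[of "mono_map \<sigma> t" "mono_map \<tau> t'"] by (simp add: compatible_mono_map_in_Autd \<sigma> \<tau>)
  then show ?thesis
    using eq V_subset_V0 by (intro alg_aut_eqI Autd_alg_aut compatible_mono_map_in_Autd comp) auto
qed

text \<open>All scalars on letters of \<open>A\<close> are \<open>1\<close>, and by compatibility so is the one of \<open>z\<^sub>1\<close>.\<close>

lemma compatible_mono_map_fixing_imp_one: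
  assumes compatible: "compatible \<sigma> t" and fixes_V: "\<And>v. v \<in> V \<Longrightarrow> mono_map \<sigma> t (\<pi> (Var v)) = \<pi> (Var v)"
  shows "mono_map \<sigma> t = \<one>\<^bsub>G\<^esub>"
proof (rule alg_aut_eqI)
  show "mono_map \<sigma> t \<in> alg_aut B \<eta>" "\<one>\<^bsub>G\<^esub> \<in> alg_aut B \<eta>"
    using Autd_alg_aut[OF compatible_mono_map_in_Autd[OF compatible]] Autd_alg_aut[of "\<one>\<^bsub>G\<^esub>"] GR.one_closed by simp_all
  show "\<iota> (mono_map \<sigma> t (\<pi> (Var v))) = \<iota> (\<one>\<^bsub>G\<^esub> (\<pi> (Var v)))" if v: "v \<in> V" for v
    using fixes_V[OF v] v V_subset_V0 by (simp add: G_one \<pi>_in_B subsetD)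
  have t_1: "t v = 1" if v: "v \<in> V" for v
  proof -
    have v0: "v \<in> V0" using v V_subset_V0 by blast
    have "ev (Const (t v) * Var (\<sigma> v)) = ev (Var v)"
      using \<iota>_mono_map_Var[OF compatible_symmetry[OF compatible] compatible_torus_point[OF compatible] v0] fixes_V[OF v] v0 by (simp add: \<iota>_\<pi>)
    then have "Const (t v) * Var (\<sigma> v) = (Var v :: 'a mpoly)"
      using v symmetry_in_V[OF compatible_symmetry[OF compatible], of v] by (simp add: ev_Const_Var ev_Var del: to_fract_mult)
    then have "single (single v 1) 1 = (single (single (\<sigma> v) 1) (t v) :: 'a mpoly)"
      by (simp add: Var_def Const_def mult_single)
    then show ?thesis using single_eq_imp by fastforce
  qed
  have "weight t eh = 1" "weight t e1 = 1"
    using t_1 subsetD[OF keys_V(1)] subsetD[OF keys_V(3)] by (simp_all add: weight_1)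
  then have "t (VZ 1) = 1" using compatible by (simp add: compatible_def)
  then show "\<iota> (mono_map \<sigma> t (\<pi> (Var (VZ 1)))) = \<iota> (\<one>\<^bsub>G\<^esub> (\<pi> (Var (VZ 1))))"
    by (simp add: \<iota>_mono_map_Var compatible_symmetry[OF compatible] compatible_torus_point[OF compatible] symmetry_fixes[OF compatible_symmetry[OF compatible]]
        G_one \<pi>_in_B \<iota>_\<pi>)
qed

lemma mono_map_id_1: "mono_map id (\<lambda>_. 1) = \<one>\<^bsub>G\<^esub>"
  by (rule compatible_mono_map_fixing_imp_one[OF compatible_id]) (simp add: mono_map_Var symmetry_id torus_point_1 subsetD[OF V_subset_V0])

abbreviation Sd where "Sd \<equiv> S_delta k m n a l (Const c * mon eh)"
abbreviation Hd where "Hd \<equiv> H_delta k m n a l \<delta>"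
abbreviation Ud where "Ud \<equiv> U_group B \<eta> \<delta>"

lemma Sd_eq: "Sd = {mono_map \<sigma> (\<lambda>_. 1) | \<sigma>. compatible \<sigma> (\<lambda>_. 1)}"
proof -
  have mono_subst_1: "mono_subst \<sigma> (\<lambda>_. 1) = (\<lambda>v. Var (\<sigma> v))" for \<sigma> by (simp add: mono_subst_def fun_eq_iff)
  have mon_iff: "(mon e :: 'a mpoly) = mon f \<longleftrightarrow> e = f" for e f
    using single_eq_imp[of e "1 :: 'a" f 1] by auto
  have rename_mon: "rename \<sigma> (mon e) = (mon (permute \<sigma> e) :: 'a mpoly)" if "bij \<sigma>" for \<sigma> e
    using evalp_mono_subst_mon[OF that, of "\<lambda>_. 1" e] by (simp add: rename_def subst_eq_evalp mono_subst_1 weight_1 del: single_one)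
  have rename_h: "rename \<sigma> (Const c * mon eh) = Const c * mon eh \<longleftrightarrow> permute \<sigma> eh = eh" if "bij \<sigma>" for \<sigma>
  proof -
    have "rename \<sigma> (Const c * mon eh) = Const c * mon (permute \<sigma> eh)"
      using rename_mon[OF that, of eh] by (simp add: rename_def subst_eq_evalp subst.evalp_mult del: single_one)
    then show ?thesis using c_nonzero by (simp add: mon_iff del: single_one)
  qed
  have "\<sigma> permutes V \<and> rename \<sigma> (Const c * mon eh) = Const c * mon eh
      \<and> rename \<sigma> (h1 k m a) = (h1 k m a :: 'a mpoly) \<and> rename \<sigma> (h2 n l) = (h2 n l :: 'a mpoly)
    \<longleftrightarrow> compatible \<sigma> (\<lambda>_. 1)" for \<sigma>
    using permutes_bij[of \<sigma> V]
    by (auto simp: compatible_iff_symmetry symmetry_def h1_eq_mon h2_eq_mon rename_h rename_mon mon_iff simp del: single_one)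
  then show ?thesis unfolding S_delta_def mono_map_def mono_subst_1 by simp
qed

lemma Hd_eq: "Hd = {mono_map id t | t. compatible id t}"
  unfolding H_delta_def quasitorus_eq
  using mono_map_id_in_Autd_imp_compatible compatible_mono_map_in_Autd compatible_torus_point by auto

lemma subgroup_Sd: "subgroup Sd G"
proof (rule GR.subgroupI)
  show "Sd \<subseteq> carrier G" using compatible_mono_map_in_Autd by (auto simp: Sd_eq)
  show "Sd \<noteq> {}" using compatible_id by (auto simp: Sd_eq)
next
  fix x assume "x \<in> Sd"
  then obtain \<sigma> where \<sigma>: "compatible \<sigma> (\<lambda>_. 1)" "x = mono_map \<sigma> (\<lambda>_. 1)" by (auto simp: Sd_eq)
  let ?y = "mono_map (Hilbert_Choice.inv \<sigma>) (\<lambda>_. 1)"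
  have "Hilbert_Choice.inv \<sigma> \<circ> \<sigma> = id" using symmetry_inverses(2)[OF compatible_symmetry[OF \<sigma>(1)]] by auto
  then have "?y \<otimes>\<^bsub>G\<^esub> x = \<one>\<^bsub>G\<^esub>"
    using mono_map_mult[OF compatible_inv_symmetry[OF \<sigma>(1)] \<sigma>(1)] by (simp add: \<sigma>(2) mono_map_id_1)
  then have "inv\<^bsub>G\<^esub> x = ?y"
    using \<sigma> compatible_inv_symmetry[OF \<sigma>(1)] by (intro GR.inv_equality) (simp_all add: compatible_mono_map_in_Autd)
  then show "inv\<^bsub>G\<^esub> x \<in> Sd" using compatible_inv_symmetry[OF \<sigma>(1)] by (auto simp: Sd_eq)
next
  fix x y assume "x \<in> Sd" "y \<in> Sd"
  then obtain \<sigma> \<tau> where "compatible \<sigma> (\<lambda>_. 1)" "x = mono_map \<sigma> (\<lambda>_. 1)" "compatible \<tau> (\<lambda>_. 1)" "y = mono_map \<tau> (\<lambda>_. 1)"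
    by (auto simp: Sd_eq)
  then show "x \<otimes>\<^bsub>G\<^esub> y \<in> Sd"
    using mono_map_mult[of \<sigma> "\<lambda>_. 1" \<tau> "\<lambda>_. 1"] compatible_comp[of \<sigma> "\<lambda>_. 1" \<tau> "\<lambda>_. 1"] by (auto simp: Sd_eq)
qed

lemma subgroup_Hd: "subgroup Hd G"
proof (rule GR.subgroupI)
  show "Hd \<subseteq> carrier G" using compatible_mono_map_in_Autd by (auto simp: Hd_eq)
  show "Hd \<noteq> {}" using compatible_id by (auto simp: Hd_eq)
next
  fix x assume "x \<in> Hd"
  then obtain t where t: "compatible id t" "x = mono_map id t" by (auto simp: Hd_eq)
  let ?y = "mono_map id (\<lambda>v. inverse (t v))"
  have "?y \<otimes>\<^bsub>G\<^esub> x = mono_map id (\<lambda>v. t v * inverse (t v))"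
    using mono_map_mult[OF compatible_inverse[OF t(1)] t(1)] by (simp add: t(2))
  also have "\<dots> = mono_map id (\<lambda>_. 1)"
    unfolding mono_map_def using compatible_torus_point[OF t(1)] by (intro induced_cong) (simp add: mono_subst_def torus_point_def)
  finally have "?y \<otimes>\<^bsub>G\<^esub> x = \<one>\<^bsub>G\<^esub>" by (simp add: mono_map_id_1)
  then have "inv\<^bsub>G\<^esub> x = ?y"
    using t compatible_inverse[OF t(1)] by (intro GR.inv_equality) (simp_all add: compatible_mono_map_in_Autd)
  then show "inv\<^bsub>G\<^esub> x \<in> Hd" using compatible_inverse[OF t(1)] by (auto simp: Hd_eq)
next
  fix x y assume "x \<in> Hd" "y \<in> Hd"
  then obtain t t' where "compatible id t" "x = mono_map id t" "compatible id t'" "y = mono_map id t'"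
    by (auto simp: Hd_eq)
  then show "x \<otimes>\<^bsub>G\<^esub> y \<in> Hd"
    using mono_map_mult[of id t id t'] compatible_comp[of id t id t'] by (auto simp: Hd_eq)
qed

lemma Sd_normalizes_Hd:
  assumes "x \<in> Sd" "y \<in> Hd"
  shows "x \<otimes>\<^bsub>G\<^esub> y \<otimes>\<^bsub>G\<^esub> inv\<^bsub>G\<^esub> x \<in> Hd"
proof -
  obtain \<sigma> where \<sigma>: "compatible \<sigma> (\<lambda>_. 1)" "x = mono_map \<sigma> (\<lambda>_. 1)" using assms(1) by (auto simp: Sd_eq)
  obtain t where t: "compatible id t" "y = mono_map id t" using assms(2) by (auto simp: Hd_eq)
  have xy: "x \<otimes>\<^bsub>G\<^esub> y = mono_map \<sigma> t" "compatible \<sigma> t"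
    using mono_map_mult[OF \<sigma>(1) t(1)] compatible_comp[OF \<sigma>(1) t(1)] by (simp_all add: \<sigma> t)
  let ?t = "\<lambda>v. t (Hilbert_Choice.inv \<sigma> v)"
  have compatible: "compatible id ?t" and prod: "mono_map id ?t \<otimes>\<^bsub>G\<^esub> x = mono_map \<sigma> t"
  proof -
    have \<sigma>_inv: "\<sigma> \<circ> Hilbert_Choice.inv \<sigma> = id" using symmetry_inverses(1)[OF compatible_symmetry[OF \<sigma>(1)]] by auto
    show compatible: "compatible id ?t"
      using compatible_comp[OF xy(2) compatible_inv_symmetry[OF \<sigma>(1)]] by (simp add: \<sigma>_inv)
    show "mono_map id ?t \<otimes>\<^bsub>G\<^esub> x = mono_map \<sigma> t"
      using mono_map_mult[OF compatible \<sigma>(1)] symmetry_inverses(2)[OF compatible_symmetry[OF \<sigma>(1)]] by (simp add: \<sigma>(2))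
  qed
  have x: "x \<in> carrier G" and t': "mono_map id ?t \<in> carrier G" using \<sigma> compatible by (simp_all add: compatible_mono_map_in_Autd)
  have "x \<otimes>\<^bsub>G\<^esub> y \<otimes>\<^bsub>G\<^esub> inv\<^bsub>G\<^esub> x = mono_map id ?t \<otimes>\<^bsub>G\<^esub> (x \<otimes>\<^bsub>G\<^esub> inv\<^bsub>G\<^esub> x)"
    unfolding xy(1) prod[symmetric] by (rule GR.m_assoc[OF t' x GR.inv_closed[OF x]])
  also have "\<dots> = mono_map id ?t" by (simp only: GR.r_inv[OF x] GR.r_one[OF t'])
  finally have "x \<otimes>\<^bsub>G\<^esub> y \<otimes>\<^bsub>G\<^esub> inv\<^bsub>G\<^esub> x = mono_map id ?t" .
  then show ?thesis using compatible by (auto simp: Hd_eq)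
qed

lemma Sd_Hd_product:
  assumes \<sigma>: "compatible \<sigma> (\<lambda>_. 1)" and t: "compatible id t"
  shows "mono_map \<sigma> (\<lambda>_. 1) \<otimes>\<^bsub>G\<^esub> mono_map id t = mono_map \<sigma> t" "compatible \<sigma> t"
  using mono_map_mult[OF \<sigma> t] compatible_comp[OF \<sigma> t] by simp_all

lemma Sd_Int_Hd: "Sd \<inter> Hd = {\<one>\<^bsub>G\<^esub>}"
proof (intro equalityI subsetI)
  fix x assume "x \<in> Sd \<inter> Hd"
  then obtain \<sigma> t where \<sigma>: "compatible \<sigma> (\<lambda>_. 1)" "x = mono_map \<sigma> (\<lambda>_. 1)" and t: "compatible id t" "x = mono_map id t"
    by (auto simp: Sd_eq Hd_eq)
  have "mono_map \<sigma> (\<lambda>_. 1) (\<pi> (Var v)) = \<pi> (Var v)" if v: "v \<in> V" for v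
  proof -
    have v0: "v \<in> V0" using v V_subset_V0 by blast
    have "ev (Const 1 * Var (\<sigma> v)) = ev (Const (t v) * Var (id v))"
      using \<iota>_mono_map_Var[OF compatible_symmetry[OF \<sigma>(1)] compatible_torus_point[OF \<sigma>(1)] v0] \<iota>_mono_map_Var[OF compatible_symmetry[OF t(1)] compatible_torus_point[OF t(1)] v0]
      by (simp add: \<sigma>(2)[symmetric] t(2)[symmetric])
    then have "Const 1 * Var (\<sigma> v) = (Const (t v) * Var v :: 'a mpoly)"
      using v symmetry_in_V[OF compatible_symmetry[OF \<sigma>(1)], of v] ev_Const_Var(1)[of "\<sigma> v" 1] ev_Const_Var(1)[of v "t v"]
      by (simp del: to_fract_mult)
    then have "single (single (\<sigma> v) 1) 1 = (single (single v 1) (t v) :: 'a mpoly)"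
      by (simp add: Var_def Const_def mult_single)
    then have "single (\<sigma> v) (1::nat) = single v 1" using single_eq_imp by fastforce
    then have "\<sigma> v = v" using single_eq_imp by fastforce
    then show ?thesis using v0 by (simp add: mono_map_Var compatible_symmetry[OF \<sigma>(1)] compatible_torus_point[OF \<sigma>(1)])
  qed
  then show "x \<in> {\<one>\<^bsub>G\<^esub>}" using compatible_mono_map_fixing_imp_one[OF \<sigma>(1)] \<sigma>(2) by simp
qed (use subgroup.one_closed[OF subgroup_Sd] subgroup.one_closed[OF subgroup_Hd] in auto)

text \<open>The scalars of \<open>x\<^sub>1\<close> and \<open>z\<^sub>1\<close> are chosen so that both monomials of the equation are invariant: they are the inverse of the
weight of \<open>h\<^sub>1\<close> and the slope \<open>d\<close> from \<open>classification\<close>.\<close>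

lemma monomial_part:
  assumes \<phi>: "\<phi> \<in> Autd"
  shows "\<exists>\<sigma> t. compatible \<sigma> t \<and> (\<forall>v\<in>V. \<phi> (\<pi> (Var v)) = mono_map \<sigma> t (\<pi> (Var v)))"
proof -
  interpret der_automorphism V e1 e2 eh "l 1" c "conj \<phi>" "conj (inv\<^bsub>G\<^esub> \<phi>)"
    by (rule der_automorphism_conj[OF \<phi>])
  obtain \<sigma> lam d g where "\<sigma> permutes V" "\<And>v. v \<in> V \<Longrightarrow> lam v \<noteq> 0" "d \<noteq> 0" "g \<in> Polys V"
    "\<And>v. v \<in> V \<Longrightarrow> conj \<phi> (emb (Var v)) = emb (Const (lam v) * Var (\<sigma> v))"
    "conj \<phi> zz = [:to_fract (mon e1 * g), to_fract (Const d):]"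
    "permute \<sigma> e1 = e1" "permute \<sigma> e2 = e2" "permute \<sigma> eh = eh"
    "weight lam e2 * d ^ l 1 = 1" "weight lam eh * weight lam e1 = d"
    by (rule classification) (rule that)
  note cl = this
  define t where "t v = (if v = VX 1 then inverse (weight lam e1) else if v = VZ 1 then d else lam v)" for v
  have t_V: "t v = lam v" if "v \<in> V" for v using that VX1_VZ1 by (auto simp: t_def)
  have weights: "weight t e1 = weight lam e1" "weight t e2 = weight lam e2" "weight t eh = weight lam eh"
    using t_V subsetD[OF keys_V(1)] subsetD[OF keys_V(2)] subsetD[OF keys_V(3)] by (auto intro!: weight_cong)
  have w1: "weight lam e1 \<noteq> 0" using cl(3,11) by auto
  have "torus_point t"
    unfolding torus_point_def u1_def u2_def weight_add weight_single weights
    using cl(2,3,10) w1 by (auto simp: V0_eq t_def mult.commute)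
  moreover have symmetry: "symmetry \<sigma>" using cl(1,7,8) by (simp add: symmetry_def)
  ultimately have compatible: "compatible \<sigma> t"
    using cl(9,11) by (simp add: compatible_def weights) (simp add: t_def)
  have "\<phi> (\<pi> (Var v)) = mono_map \<sigma> t (\<pi> (Var v))" if v: "v \<in> V" for v
  proof (rule \<iota>_inj)
    have v0: "v \<in> V0" using v V_subset_V0 by blast
    then have "\<pi> (Var v) \<in> carrier B" by auto
    then show "\<phi> (\<pi> (Var v)) \<in> carrier B" "mono_map \<sigma> t (\<pi> (Var v)) \<in> carrier B"
      using Autd_in_B[OF \<phi>] Autd_in_B[OF compatible_mono_map_in_Autd[OF compatible]] by auto
    show "\<iota> (\<phi> (\<pi> (Var v))) = \<iota> (mono_map \<sigma> t (\<pi> (Var v)))"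
      using cl(5)[OF v] v \<iota>_mono_map_Var[OF symmetry compatible_torus_point[OF compatible] v0] symmetry_in_V[OF symmetry, of v]
      by (simp add: conj_emb ev_Const_Var t_V)
  qed
  then show ?thesis using compatible by blast
qed

text \<open>The quotient of an automorphism by its monomial part fixes \<open>A\<close> and so lies in \<open>U(\<delta>)\<close>. A monomial automorphism that fixes
\<open>A\<close> is the identity.\<close>

theorem semidirect_decomposition:
  "semidirect (G\<lparr>carrier := Sd <#>\<^bsub>G\<^esub> Hd\<rparr>) Sd Hd \<and> semidirect G (Sd <#>\<^bsub>G\<^esub> Hd) Ud"
proof
  note SH = GR.semidirect_normalized_product[OF subgroup_Sd subgroup_Hd Sd_normalizes_Hd Sd_Int_Hd]
  show "semidirect (G\<lparr>carrier := Sd <#>\<^bsub>G\<^esub> Hd\<rparr>) Sd Hd" by (rule SH(2))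
  have SH_eq: "Sd <#>\<^bsub>G\<^esub> Hd = {mono_map \<sigma> t | \<sigma> t. compatible \<sigma> (\<lambda>_. 1) \<and> compatible id t}"
  proof (intro equalityI subsetI)
    fix x assume "x \<in> {mono_map \<sigma> t | \<sigma> t. compatible \<sigma> (\<lambda>_. 1) \<and> compatible id t}"
    then obtain \<sigma> t where "compatible \<sigma> (\<lambda>_. 1)" "compatible id t" "x = mono_map \<sigma> (\<lambda>_. 1) \<otimes>\<^bsub>G\<^esub> mono_map id t"
      using Sd_Hd_product(1) by fastforce
    then show "x \<in> Sd <#>\<^bsub>G\<^esub> Hd" unfolding set_mult_def Sd_eq Hd_eq by blast
  next
    fix x assume "x \<in> Sd <#>\<^bsub>G\<^esub> Hd"
    then obtain \<sigma> t where \<sigma>t: "compatible \<sigma> (\<lambda>_. 1)" "compatible id t" and "x = mono_map \<sigma> (\<lambda>_. 1) \<otimes>\<^bsub>G\<^esub> mono_map id t"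
      by (auto simp: set_mult_def Sd_eq Hd_eq)
    then have "x = mono_map \<sigma> t" using Sd_Hd_product(1) by simp
    with \<sigma>t show "x \<in> {mono_map \<sigma> t | \<sigma> t. compatible \<sigma> (\<lambda>_. 1) \<and> compatible id t}" by blast
  qed
  have compatible_SH: "mono_map \<sigma> t \<in> Sd <#>\<^bsub>G\<^esub> Hd" if "compatible \<sigma> t" for \<sigma> t
  proof -
    have "compatible \<sigma> (\<lambda>_. 1)" "compatible id t" using that by (auto simp: compatible_def symmetry_id torus_point_1 weight_1)
    then show ?thesis by (auto simp: SH_eq)
  qed
  have "(Sd <#>\<^bsub>G\<^esub> Hd) \<inter> Ud = {\<one>\<^bsub>G\<^esub>}"
  proof (intro equalityI subsetI)
    fix x assume x: "x \<in> (Sd <#>\<^bsub>G\<^esub> Hd) \<inter> Ud"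
    then obtain \<sigma> t where "compatible \<sigma> (\<lambda>_. 1)" "compatible id t" "x = mono_map \<sigma> t" by (auto simp: SH_eq)
    moreover have "x (\<pi> (Var v)) = \<pi> (Var v)" if "v \<in> V" for v
      using x that by (auto simp: U_group_eq)
    ultimately show "x \<in> {\<one>\<^bsub>G\<^esub>}" using compatible_mono_map_fixing_imp_one Sd_Hd_product(2) by auto
  next
    fix x assume "x \<in> {\<one>\<^bsub>G\<^esub>}"
    then show "x \<in> (Sd <#>\<^bsub>G\<^esub> Hd) \<inter> Ud"
      using subgroup.one_closed[OF SH(1)] subgroup.one_closed[OF normal_imp_subgroup[OF U_normal]] by simp
  qed
  moreover have "(Sd <#>\<^bsub>G\<^esub> Hd) <#>\<^bsub>G\<^esub> Ud = carrier G"
  proof (intro equalityI subsetI)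
    fix x assume "x \<in> (Sd <#>\<^bsub>G\<^esub> Hd) <#>\<^bsub>G\<^esub> Ud"
    then obtain y u where "y \<in> Sd <#>\<^bsub>G\<^esub> Hd" "u \<in> Ud" "x = y \<otimes>\<^bsub>G\<^esub> u" by (auto simp: set_mult_def)
    then show "x \<in> carrier G"
      using subgroup.mem_carrier[OF SH(1)] subgroup.mem_carrier[OF normal_imp_subgroup[OF U_normal]] GR.m_closed by blast
  next
    fix \<phi> assume "\<phi> \<in> carrier G"
    then have \<phi>: "\<phi> \<in> Autd" by simp
    obtain \<sigma> t where compatible: "compatible \<sigma> t" and eq: "\<And>v. v \<in> V \<Longrightarrow> \<phi> (\<pi> (Var v)) = mono_map \<sigma> t (\<pi> (Var v))"
      using monomial_part[OF \<phi>] by blast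
    let ?M = "mono_map \<sigma> t"
    have M: "?M \<in> Autd" by (rule compatible_mono_map_in_Autd[OF compatible])
    let ?u = "inv\<^bsub>G\<^esub> ?M \<otimes>\<^bsub>G\<^esub> \<phi>"
    have u: "?u \<in> Autd" using GR.m_closed[of "inv\<^bsub>G\<^esub> ?M" \<phi>] G_inv_in[OF M] \<phi> by simp
    have "?u (\<pi> (Var v)) = \<pi> (Var v)" if v: "v \<in> V" for v
    proof -
      have \<pi>_v: "\<pi> (Var v) \<in> carrier B" using v V_subset_V0 by (intro \<pi>_in_B) auto
      show ?thesis using G_mult[OF G_inv_in[OF M] \<phi> \<pi>_v] G_inv(2)[OF M \<pi>_v] eq[OF v] by simp
    qed
    then have "?u \<in> Ud" by (rule fixing_in_U[OF u])
    moreover have "\<phi> = ?M \<otimes>\<^bsub>G\<^esub> ?u"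
      using M \<phi> G_inv_in[OF M] GR.m_assoc[of ?M "inv\<^bsub>G\<^esub> ?M" \<phi>] GR.r_inv[of ?M] GR.l_one[of \<phi>] by simp
    ultimately show "\<phi> \<in> (Sd <#>\<^bsub>G\<^esub> Hd) <#>\<^bsub>G\<^esub> Ud"
      using compatible_SH[OF compatible] unfolding set_mult_def[of G "Sd <#>\<^bsub>G\<^esub> Hd"] by blast
  qed
  ultimately show "semidirect G (Sd <#>\<^bsub>G\<^esub> Hd) Ud"
    using SH(1) U_normal GR.is_group by (simp add: semidirect_def)
qed

end


theorem theorem10p3:
  fixes k m n :: nat and a l :: "nat \<Rightarrow> nat"
    and h :: "'a::{alg_closed_field, field_char_0} mpoly"
    and \<delta> :: "'a mpoly set \<Rightarrow> 'a mpoly set"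
  defines "B \<equiv> coord_ring k m n a l :: 'a mpoly set ring"
    and "\<eta> \<equiv> scalar k m n a l :: 'a \<Rightarrow> 'a mpoly set"
    and "\<pi> \<equiv> cls k m n a l :: 'a mpoly \<Rightarrow> 'a mpoly set"
  defines "G \<equiv> alg_aut_comm_group B \<eta> \<delta>"
    and "S \<equiv> S_delta k m n a l h"
    and "H \<equiv> H_delta k m n a l \<delta>"
    and "U \<equiv> U_group B \<eta> \<delta>"
  assumes "k \<ge> 2" and "n \<ge> 2"
    and "\<And>s. s \<in> {1..m} \<Longrightarrow> a s > 1"
    and "\<And>j. j \<in> {1..n} \<Longrightarrow> l j > 1"
    and "h \<noteq> 0" and "homogeneous k m n a l h"
    and "occurring h \<subseteq> letters' k m n"
    and "\<And>s. s \<in> {2..n} \<Longrightarrow> VZ s \<in> occurring h"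
    and "LND B \<eta> \<delta>"
    and "\<delta> (\<pi> (Var (VX 1))) = \<pi> (h * of_nat (l 1) * Var (VZ 1) ^ (l 1 - 1) * (\<Prod>j=2..n. Var (VZ j) ^ l j))"
    and "\<delta> (\<pi> (Var (VZ 1))) = \<pi> (h * (\<Prod>s=1..m. Var (VY s) ^ a s) * (\<Prod>i=2..k. Var (VX i)))"
    and "\<And>r. r \<in> {2..k} \<Longrightarrow> \<delta> (\<pi> (Var (VX r))) = \<zero>\<^bsub>B\<^esub>"
    and "\<And>s. s \<in> {1..m} \<Longrightarrow> \<delta> (\<pi> (Var (VY s))) = \<zero>\<^bsub>B\<^esub>"
    and "\<And>p. p \<in> {2..n} \<Longrightarrow> \<delta> (\<pi> (Var (VZ p))) = \<zero>\<^bsub>B\<^esub>"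
  shows "semidirect (G\<lparr>carrier := S <#>\<^bsub>G\<^esub> H\<rparr>) S H \<and> semidirect G (S <#>\<^bsub>G\<^esub> H) U"
proof -
  note hyps = assms(8-21)
  \<comment> \<open>The locale has the exponent of \<open>h\<close> as a parameter. To see that \<open>h\<close> is a monomial, it is first used with \<open>h\<^sub>1 h\<^sub>2\<close>
    in place of \<open>h\<close>; the grading does not depend on \<open>h\<close>.\<close>
  have "hypersurface k m n a l (1 :: 'a) (expo1 k m a + expo2 n l)"
  proof
    show "keys (expo1 k m a + expo2 n l) \<subseteq> letters' k m n"
      using keys_add[of "expo1 k m a" "expo2 n l"] keys_expo1_subset[of k m a n] keys_expo2_subset[of n l k m] by blast
    show "VZ j \<in> keys (expo1 k m a + expo2 n l)" if "j \<in> {2..n}" for j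
      using that hyps(4)[of j] by (simp add: in_keys_iff lookup_add)
  qed (use hyps(1-4) in auto)
  then obtain c e where ce: "c \<noteq> 0" "keys e = occurring h" "h = Const c * mon e"
    using hypersurface.homogeneous_imp_monomial[OF _ hyps(6,5,7)] by blast
  interpret hypersurface k m n a l c e
    using hyps(1-4,7,8) ce by unfold_locales auto
  interpret hypersurface_der k m n a l c e \<delta>
  proof unfold_locales
    show "LND (coord_ring k m n a l) (scalar k m n a l) \<delta>"
      using hyps(9) by (simp add: B_def \<eta>_def)
    have "h * (\<Prod>s=1..m. Var (VY s) ^ a s) * (\<Prod>i=2..k. Var (VX i)) = h * h1 k m a"
      by (simp add: h1_def mult_ac)
    also have "\<dots> = s" by (simp add: ce(3) s_def h1_eq_mon)
    finally have "\<delta> (cls k m n a l (Var (VZ 1))) = cls k m n a l s"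
      using hyps(11) by (simp add: \<pi>_def)
    then show "\<iota> (\<delta> (cls k m n a l (Var (VZ 1)))) = emb s"
      using \<iota>_\<pi>[OF Polys_V_V0[OF s_in_Polys]] ev_emb[OF s_in_Polys] by simp
    show "\<delta> (cls k m n a l (Var v)) = \<zero>\<^bsub>coord_ring k m n a l\<^esub>" if "v \<in> letters' k m n" for v
      using that hyps(12-14) by (auto simp: letters'_def B_def \<pi>_def)
  qed
  show ?thesis
    using semidirect_decomposition unfolding G_def S_def H_def U_def B_def \<eta>_def ce(3) .
qed


end
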